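(* Let $(\Omega,|\cdot|)$ be a $\sigma$-finite measure space and $\mathcal{E}$ a basis of sets in $\Omega$. Let $\alpha\in\mathbf{R}$ and let $r_1,r_2\in(0,\infty)$, $s_1\in(0,\infty]$, $\frac1{s_2}\in\mathbf{R}$ satisfy $\frac1{r_1}>\frac1{s_1}$, $\frac1{r_2}>\frac1{s_2}$ and $\frac1{r_2}-\frac1{r_1}=\frac1{s_2}-\frac1{s_1}=\alpha$. Let $p_1,p_2\in(0,\infty]$ with $\frac1{p_1}\in[\frac1{s_1},\frac1{r_1}]$, $\frac1{p_2}\in[\frac1{s_2},\frac1{r_2}]$ and $\frac1{p_2}-\frac1{p_1}=\alpha$. Let $V$ be a set and $S:V\to L^0(\Omega)$ a map. Suppose we are in one of the following situations: (i) $T:\bigcup_{w\in A_{\vec p,(\vec r,\vec s)}(\mathcal{E})}S^{-1}(L^{p_1}_w(\Omega))\to L^0(\Omega)$ is a map for which there is an increasing function $\phi:[0,\infty)\to[0,\infty)$ such that for all weights $w\in A_{\vec p,(\vec r,\vec s)}(\mathcal{E})$ and all $f\in V$ with $Sf\in L^{p_1}_w(\Omega)$, \[\|Tf\|_{L^{p_2}_w(\Omega)}\leq\phi([w]^{\mathcal{E}}_{\vec p,(\vec r,\vec s)})\|Sf\|_{L^{p_1}_w(\Omega)}.\] (ii) $T:\bigcup_{(w_1,w_2)\in A_{\vec p,(\vec r,\vec s)}(\mathcal{E})}S^{-1}(L^{p_1}_{w_1}(\Omega))\to L^0(\Omega)$ is a map for which there is an increasing function $\phi:[0,\infty)\to[0,\infty)$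 such that for all $(w_1,w_2)\in A_{\vec p,(\vec r,\vec s)}(\mathcal{E})$ and all $f\in V$ with $Sf\in L^{p_1}_{w_1}(\Omega)$, \[\|Tf\|_{L^{p_2}_{w_2}(\Omega)}\leq\phi([w_1,w_2]^{\mathcal{E}}_{\vec p,(\vec r,\vec s)})\|Sf\|_{L^{p_1}_{w_1}(\Omega)}.\] Then $T$ satisfies the respective conclusion: (I) In situation (i): let $X,Y$ be quasi-Banach function spaces over $\Omega$ that are respectively $r_1$- and $r_2$-convex and $s_1$- and $s_2$-concave, satisfy $[(X^{r_1})']^{(\frac{s_1}{r_1})'}=[(Y^{r_2})']^{(\frac{s_2}{r_2})'}$, and such that: if $p_1\neq r_1$, then $M^{\mathcal{E}}:X_{r_1,s_1}\to X_{r_1,s_1}$ is bounded; and if $p_1\neq s_1$, then $M^{\mathcal{E}}:(X_{r_1,s_1})'\to(X_{r_1,s_1})'$ is bounded. Then $Tf$ is well-defined for all $f\in V$ with $Sf\in X$ and \[\|Tf\|_Y\leq2^{\frac1{r_1}-\frac1{s_1}}\phi\Big(2^{\frac1{r_1}-\frac1{s_1}}\|M^{\mathcal{E}}\|_{X_{r_1,s_1}\to X_{r_1,s_1}}^{\frac1{r_1}-\frac1{p_1}}\|M^{\mathcal{E}}\|_{(X_{r_1,s_1})'\to(X_{r_1,s_1})'}^{\frac1{p_2}-\frac1{s_2}}\Big)\|Sf\|_X.\] (II) In situation (ii): let $X,Y$ be quasi-Banach function spaces over $\Omega$ that are respectively $r_1$- and $r_2$-convex and $s_1$- and $s_2$-concave,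 and such that: if $p_1\neq r_1$, there exists a positive isometric linear isomorphism $L_1:X_{r_1,s_1}\to Y_{r_2,s_2}$ and $M^{\mathcal{E}}:X_{r_1,s_1}\to Y_{r_2,s_2}$ is bounded; and if $\frac{1}{p_2}\neq\frac{1}{s_2}$, there exists a positive isometric linear isomorphism $L_2:(Y_{r_2,s_2})'\to(X_{r_1,s_1})'$ and $M^{\mathcal{E}}:(Y_{r_2,s_2})'\to(X_{r_1,s_1})'$ is bounded. Then $Tf$ is well-defined for all $f\in V$ with $Sf\in X$ and \[\|Tf\|_Y\leq2^{\frac1{r_1}-\frac1{s_1}}\phi\Big(2^{\frac1{r_1}-\frac1{s_1}}\|M^{\mathcal{E}}\|_{X_{r_1,s_1}\to Y_{r_2,s_2}}^{\frac1{r_1}-\frac1{p_1}}\|M^{\mathcal{E}}\|_{(Y_{r_2,s_2})'\to(X_{r_1,s_1})'}^{\frac1{p_2}-\frac1{s_2}}\Big)\|Sf\|_X.\]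
   Context: Conventions: $\frac1\infty=0$, $\frac10=\infty$; $\frac1{s_2}$ is a possibly negative real; factors raised to the power $0$ are read as $1$. A weight is a measurable function with $0<w<\infty$ a.e.; $L^0(\Omega)$: a.e. finite measurable functions; $\|f\|_{L^p_w}=\|fw\|_{L^p}$. A basis of sets in $\Omega$ is a collection $\mathcal{E}$ of measurable sets $E$ with $0<|E|<\infty$ such that (1) $\bigcup_{E\in\mathcal{E}}E=\Omega$; (2) any $x_1,x_2\in\Omega$ lie in a common $E\in\mathcal{E}$; (3) there is a countable $\mathcal{E}'\subseteq\mathcal{E}$ such that for all $\varepsilon>0$, $E\in\mathcal{E}$ there is $E'\in\mathcal{E}'$ with $E\subseteq E'$, $|E'|\le(1+\varepsilon)|E|$. $\langle f\rangle_{p,E}=|E|^{-1/p}\|f\mathbf{1}_E\|_{L^p(\Omega)}$ and $M^{\mathcal{E}}f=\sup_{E\in\mathcal{E}}\langle f\rangle_{1,E}\mathbf{1}_E$. $(w_1,w_2)\in A_{\vec p,(\vec r,\vec s)}(\mathcal{E})$ iff $[w_1,w_2]^{\mathcal{E}}_{\vec p,(\vec r,\vec s)}=\sup_{E\in\mathcal{E}}\langle w_1^{-1}\rangle_{\frac1{\frac1{r_1}-\frac1{p_1}},E}\langle w_2\rangle_{\frac1{\frac1{p_2}-\frac1{s_2}},E}<\infty$; $w\in A_{\vec p,(\vec r,\vec s)}(\mathcal{E})$ iff $[w]^{\mathcal{E}}_{\vec p,(\vec r,\vec s)}:=[w,w]^{\mathcal{E}}_{\vec p,(\vec r,\vec s)}<\infty$.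 A quasi-Banach function space over $\Omega$ is a vector space $X\subseteq L^0(\Omega)$ with a quasi-norm such that: (ideal) $f\in X$, $g\in L^0$, $|g|\le|f|$ imply $g\in X$, $\|g\|_X\le\|f\|_X$; (Fatou) $0\le f_n\uparrow f$, $f_n\in X$, $\sup_n\|f_n\|_X<\infty$ imply $f\in X$, $\|f\|_X=\sup_n\|f_n\|_X$; (saturation) every measurable set of positive measure contains a measurable $F$ of positive measure with $\mathbf{1}_F\in X$. The Köthe dual is $X'=\{g\in L^0: fg\in L^1\ \forall f\in X\}$, $\|g\|_{X'}=\sup_{\|f\|_X=1}\|fg\|_{L^1}$. For $p\in(0,\infty)$, $X^p=\{f:|f|^{1/p}\in X\}$, $\|f\|_{X^p}=\||f|^{1/p}\|_X^p$. $X$ is $p$-convex if $\|(|f|^p+|g|^p)^{1/p}\|_X\le(\|f\|_X^p+\|g\|_X^p)^{1/p}$ and $q$-concave if $(\|f\|_X^q+\|g\|_X^q)^{1/q}\le\|(|f|^q+|g|^q)^{1/q}\|_X$ for all $f,g\in X$ (usual modification for $\infty$; when $\frac1q<0$, $q$-concavity is by convention no additional condition). For $\frac1r>\frac1s$, $X_{r,s}=\big[[(X^r)']^{(s/r)'}\big]'$ with $(s/r)'=\frac1{1-r/s}$. *)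

theory Defs
  imports "HOL-Analysis.Analysis" "HOL-Probability.Essential_Supremum"
begin

text \<open>
  Scalars are an arbitrary type \<open>'k\<close> of sort \<open>{real_normed_field, euclidean_space}\<close>, i.e. the
  reals or the complex numbers.  Elements of $L^0(\Omega)$ are represented by measurable functions
  with (finite) scalar values; every notion below is invariant under modification on null sets, and
  all pointwise relations between functions are required almost everywhere only.

  Exponents in $(0,\infty]$ have type \<^typ>\<open>ennreal\<close>, where \<open>inverse 0 = \<infinity>\<close> and
  \<open>inverse \<infinity> = 0\<close>; the possibly negative reciprocal $1/s_2$ is a real number.
\<close>

definition recip :: "ennreal \<Rightarrow> real" where
  "recip p = enn2real (inverse p)"

text \<open>Powers with factors raised to the power $0$ read as $1$ (note that \<open>0 powr 0 = 0\<close>).\<close>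

definition rpow :: "real \<Rightarrow> real \<Rightarrow> real" where
  "rpow x a = (if a = 0 then 1 else x powr a)"

text \<open>Only used for positive exponents.\<close>

definition epowr :: "ennreal \<Rightarrow> real \<Rightarrow> ennreal" where
  "epowr x a = (if x = \<infinity> then \<infinity> else ennreal (enn2real x powr a))"

definition Lp_norm :: "'a measure \<Rightarrow> ennreal \<Rightarrow> ('a \<Rightarrow> 'b::real_normed_vector) \<Rightarrow> ennreal" where
  "Lp_norm M p f =
     (if p = \<infinity> then esssup M (\<lambda>x. ennreal (norm (f x)))
      else epowr (\<integral>\<^sup>+x. ennreal (norm (f x) powr enn2real p) \<partial>M) (1 / enn2real p))"

definition weight :: "'a measure \<Rightarrow> ('a \<Rightarrow> real) \<Rightarrow> bool" where
  "weight M w \<longleftrightarrow> w \<in> borel_measurable M \<and> (AE x in M. 0 < w x)"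

definition weighted_norm ::
  "'a measure \<Rightarrow> ennreal \<Rightarrow> ('a \<Rightarrow> real) \<Rightarrow> ('a \<Rightarrow> 'b::real_normed_vector) \<Rightarrow> ennreal" where
  "weighted_norm M p w f = Lp_norm M p (\<lambda>x. w x *\<^sub>R f x)"

definition weighted_Lp ::
  "'a measure \<Rightarrow> ennreal \<Rightarrow> ('a \<Rightarrow> real) \<Rightarrow> ('a \<Rightarrow> 'b::real_normed_vector) set" where
  "weighted_Lp M p w = {f \<in> borel_measurable M. weighted_norm M p w f < \<infinity>}"

definition basis_of_sets :: "'a measure \<Rightarrow> 'a set set \<Rightarrow> bool" where
  "basis_of_sets M \<E> \<longleftrightarrow>
     (\<forall>E\<in>\<E>. E \<in> sets M \<and> 0 < emeasure M E \<and> emeasure M E < \<infinity>) \<and>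
     \<Union>\<E> = space M \<and>
     (\<forall>x\<in>space M. \<forall>y\<in>space M. \<exists>E\<in>\<E>. x \<in> E \<and> y \<in> E) \<and>
     (\<exists>\<E>'\<subseteq>\<E>. countable \<E>' \<and>
        (\<forall>\<epsilon>>0. \<forall>E\<in>\<E>. \<exists>E'\<in>\<E>'. E \<subseteq> E' \<and> measure M E' \<le> (1 + \<epsilon>) * measure M E))"

definition avg :: "'a measure \<Rightarrow> ennreal \<Rightarrow> 'a set \<Rightarrow> ('a \<Rightarrow> 'b::real_normed_vector) \<Rightarrow> ennreal" where
  "avg M p E f =
     ennreal (measure M E powr (- recip p)) * Lp_norm M p (\<lambda>x. indicator E x *\<^sub>R f x)"

definition maximal ::
  "'a measure \<Rightarrow> 'a set set \<Rightarrow> ('a \<Rightarrow> 'b::real_normed_vector) \<Rightarrow> 'a \<Rightarrow> ennreal" where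
  "maximal M \<E> f x = (SUP E\<in>\<E>. avg M 1 E f * indicator E x)"

text \<open>
  The weight constant $[w_1,w_2]^{\mathcal{E}}_{\vec p,(\vec r,\vec s)}$.  It depends on
  $\vec r,\vec s$ only through $r_1$ and $1/s_2$ (the real argument \<open>t\<^sub>2\<close>).
\<close>

definition A_const ::
  "'a measure \<Rightarrow> 'a set set \<Rightarrow> ennreal \<Rightarrow> ennreal \<Rightarrow> real \<Rightarrow> real \<Rightarrow>
     ('a \<Rightarrow> real) \<Rightarrow> ('a \<Rightarrow> real) \<Rightarrow> ennreal" where
  "A_const M \<E> p\<^sub>1 p\<^sub>2 r\<^sub>1 t\<^sub>2 w\<^sub>1 w\<^sub>2 =
     (SUP E\<in>\<E>. avg M (inverse (ennreal (1 / r\<^sub>1 - recip p\<^sub>1))) E (\<lambda>x. inverse (w\<^sub>1 x)) *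
               avg M (inverse (ennreal (recip p\<^sub>2 - t\<^sub>2))) E w\<^sub>2)"

definition A_class ::
  "'a measure \<Rightarrow> 'a set set \<Rightarrow> ennreal \<Rightarrow> ennreal \<Rightarrow> real \<Rightarrow> real \<Rightarrow>
     (('a \<Rightarrow> real) \<times> ('a \<Rightarrow> real)) set" where
  "A_class M \<E> p\<^sub>1 p\<^sub>2 r\<^sub>1 t\<^sub>2 =
     {(w\<^sub>1, w\<^sub>2). weight M w\<^sub>1 \<and> weight M w\<^sub>2 \<and> A_const M \<E> p\<^sub>1 p\<^sub>2 r\<^sub>1 t\<^sub>2 w\<^sub>1 w\<^sub>2 < \<infinity>}"

text \<open>
  A function space together with its (quasi-)norm; the value of \<open>nrm X\<close> outside \<open>carr X\<close> is
  irrelevant.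
\<close>

record ('a, 'k) fspace =
  carr :: "('a \<Rightarrow> 'k) set"
  nrm :: "('a \<Rightarrow> 'k) \<Rightarrow> real"

definition fspace_eq :: "('a, 'k) fspace \<Rightarrow> ('a, 'k) fspace \<Rightarrow> bool" where
  "fspace_eq X Y \<longleftrightarrow> carr X = carr Y \<and> (\<forall>f\<in>carr X. nrm X f = nrm Y f)"

definition quasi_normed_space ::
  "'a measure \<Rightarrow> ('a, 'k::{real_normed_field, euclidean_space}) fspace \<Rightarrow> bool" where
  "quasi_normed_space M X \<longleftrightarrow>
     carr X \<subseteq> borel_measurable M \<and>
     (\<lambda>x. 0) \<in> carr X \<and>
     (\<forall>f\<in>carr X. \<forall>g\<in>carr X. (\<lambda>x. f x + g x) \<in> carr X) \<and>
     (\<forall>c. \<forall>f\<in>carr X. (\<lambda>x. c * f x) \<in> carr X) \<and>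
     (\<forall>f\<in>carr X. 0 \<le> nrm X f) \<and>
     (\<forall>f\<in>carr X. nrm X f = 0 \<longleftrightarrow> (AE x in M. f x = 0)) \<and>
     (\<forall>c. \<forall>f\<in>carr X. nrm X (\<lambda>x. c * f x) = norm c * nrm X f) \<and>
     (\<exists>K\<ge>1. \<forall>f\<in>carr X. \<forall>g\<in>carr X. nrm X (\<lambda>x. f x + g x) \<le> K * (nrm X f + nrm X g))"

definition ideal_property ::
  "'a measure \<Rightarrow> ('a, 'k::{real_normed_field, euclidean_space}) fspace \<Rightarrow> bool" where
  "ideal_property M X \<longleftrightarrow>
     (\<forall>f\<in>carr X. \<forall>g\<in>borel_measurable M.
        (AE x in M. norm (g x) \<le> norm (f x)) \<longrightarrow> g \<in> carr X \<and> nrm X g \<le> nrm X f)"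

text \<open>
  The limit is taken in $L^0(\Omega)$; in the presence of the ideal property and saturation, the
  a.e. finiteness of the limit of a norm-bounded increasing sequence is automatic.
\<close>

definition fatou_property ::
  "'a measure \<Rightarrow> ('a, 'k::{real_normed_field, euclidean_space}) fspace \<Rightarrow> bool" where
  "fatou_property M X \<longleftrightarrow>
     (\<forall>(u :: nat \<Rightarrow> 'a \<Rightarrow> real) (v :: 'a \<Rightarrow> real).
        (\<forall>n. (\<lambda>x. of_real (u n x)) \<in> carr X) \<and>
        v \<in> borel_measurable M \<and>
        (AE x in M. (\<forall>n. 0 \<le> u n x) \<and> incseq (\<lambda>n. u n x) \<and> (\<lambda>n. u n x) \<longlonglongrightarrow> v x) \<and>
        bdd_above (range (\<lambda>n. nrm X (\<lambda>x. of_real (u n x))))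
        \<longrightarrow> (\<lambda>x. of_real (v x)) \<in> carr X \<and>
            nrm X (\<lambda>x. of_real (v x)) = (SUP n. nrm X (\<lambda>x. of_real (u n x))))"

definition saturation_property ::
  "'a measure \<Rightarrow> ('a, 'k::{real_normed_field, euclidean_space}) fspace \<Rightarrow> bool" where
  "saturation_property M X \<longleftrightarrow>
     (\<forall>A\<in>sets M. 0 < emeasure M A \<longrightarrow>
        (\<exists>F\<in>sets M. F \<subseteq> A \<and> 0 < emeasure M F \<and> indicator F \<in> carr X))"

definition quasi_BFS ::
  "'a measure \<Rightarrow> ('a, 'k::{real_normed_field, euclidean_space}) fspace \<Rightarrow> bool" where
  "quasi_BFS M X \<longleftrightarrow>
     quasi_normed_space M X \<and> ideal_property M X \<and> fatou_property M X \<and> saturation_property M X"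

text \<open>
  The supremum is formed in \<^typ>\<open>ennreal\<close>, so that it is $0$ if there are no $f$ of norm $1$ (i.e.
  if the measure vanishes).  For a quasi-Banach function space $X$ it is finite for each $g\in X'$.
\<close>

definition koethe_dual ::
  "'a measure \<Rightarrow> ('a, 'k::{real_normed_field, euclidean_space}) fspace \<Rightarrow> ('a, 'k) fspace" where
  "koethe_dual M X =
     \<lparr>carr = {g \<in> borel_measurable M. \<forall>f\<in>carr X. integrable M (\<lambda>x. f x * g x)},
      nrm = (\<lambda>g. enn2real (SUP f\<in>{f \<in> carr X. nrm X f = 1}.
                   \<integral>\<^sup>+x. ennreal (norm (f x * g x)) \<partial>M))\<rparr>"

definition power_space ::
  "'a measure \<Rightarrow> real \<Rightarrow> ('a, 'k::{real_normed_field, euclidean_space}) fspace \<Rightarrow> ('a, 'k) fspace"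
where
  "power_space M p X =
     \<lparr>carr = {f \<in> borel_measurable M. (\<lambda>x. of_real (norm (f x) powr (1 / p))) \<in> carr X},
      nrm = (\<lambda>f. nrm X (\<lambda>x. of_real (norm (f x) powr (1 / p))) powr p)\<rparr>"

definition fs_convex :: "real \<Rightarrow> ('a, 'k::{real_normed_field, euclidean_space}) fspace \<Rightarrow> bool"
where
  "fs_convex p X \<longleftrightarrow>
     (\<forall>f\<in>carr X. \<forall>g\<in>carr X.
        nrm X (\<lambda>x. of_real ((norm (f x) powr p + norm (g x) powr p) powr (1 / p)))
          \<le> (nrm X f powr p + nrm X g powr p) powr (1 / p))"

text \<open>$q$-concavity, in terms of \<open>t\<close> $= 1/q$; no condition if $1/q<0$.\<close>

definition fs_concave :: "real \<Rightarrow> ('a, 'k::{real_normed_field, euclidean_space}) fspace \<Rightarrow> bool"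
where
  "fs_concave t X \<longleftrightarrow>
     (0 < t \<longrightarrow>
       (\<forall>f\<in>carr X. \<forall>g\<in>carr X.
          (nrm X f powr (1 / t) + nrm X g powr (1 / t)) powr t
            \<le> nrm X (\<lambda>x. of_real ((norm (f x) powr (1 / t) + norm (g x) powr (1 / t)) powr t)))) \<and>
     (t = 0 \<longrightarrow>
       (\<forall>f\<in>carr X. \<forall>g\<in>carr X.
          max (nrm X f) (nrm X g) \<le> nrm X (\<lambda>x. of_real (max (norm (f x)) (norm (g x))))))"

text \<open>
  \<open>pre_XRS M r t X\<close> is $[(X^r)']^{(s/r)'}$ and \<open>XRS M r t X\<close> is $X_{r,s}$, where \<open>t\<close> $= 1/s$, so
  that $(s/r)' = 1/(1-rt)$, which is positive and finite since $1/r>t$.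
\<close>

definition pre_XRS ::
  "'a measure \<Rightarrow> real \<Rightarrow> real \<Rightarrow> ('a, 'k::{real_normed_field, euclidean_space}) fspace
     \<Rightarrow> ('a, 'k) fspace" where
  "pre_XRS M r t X = power_space M (1 / (1 - r * t)) (koethe_dual M (power_space M r X))"

definition XRS ::
  "'a measure \<Rightarrow> real \<Rightarrow> real \<Rightarrow> ('a, 'k::{real_normed_field, euclidean_space}) fspace
     \<Rightarrow> ('a, 'k) fspace" where
  "XRS M r t X = koethe_dual M (pre_XRS M r t X)"

text \<open>The maximal function as an element of $L^0(\Omega)$, meaningful where it is a.e. finite.\<close>

definition maximal_fun ::
  "'a measure \<Rightarrow> 'a set set \<Rightarrow> ('a \<Rightarrow> 'k) \<Rightarrow> 'a \<Rightarrow> 'k::{real_normed_field, euclidean_space}" where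
  "maximal_fun M \<E> f x = of_real (enn2real (maximal M \<E> f x))"

definition maximal_bound ::
  "'a measure \<Rightarrow> 'a set set \<Rightarrow> ('a, 'k::{real_normed_field, euclidean_space}) fspace
     \<Rightarrow> ('a, 'k) fspace \<Rightarrow> real \<Rightarrow> bool" where
  "maximal_bound M \<E> X Y C \<longleftrightarrow>
     0 \<le> C \<and>
     (\<forall>f\<in>carr X. (AE x in M. maximal M \<E> f x < \<infinity>) \<and> maximal_fun M \<E> f \<in> carr Y \<and>
        nrm Y (maximal_fun M \<E> f) \<le> C * nrm X f)"

definition maximal_bounded ::
  "'a measure \<Rightarrow> 'a set set \<Rightarrow> ('a, 'k::{real_normed_field, euclidean_space}) fspace
     \<Rightarrow> ('a, 'k) fspace \<Rightarrow> bool" where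
  "maximal_bounded M \<E> X Y \<longleftrightarrow> (\<exists>C. maximal_bound M \<E> X Y C)"

text \<open>The operator norm of $M^{\mathcal{E}}:X\to Y$; meaningful only if this map is bounded.\<close>

definition maximal_opnorm ::
  "'a measure \<Rightarrow> 'a set set \<Rightarrow> ('a, 'k::{real_normed_field, euclidean_space}) fspace
     \<Rightarrow> ('a, 'k) fspace \<Rightarrow> real" where
  "maximal_opnorm M \<E> X Y = Inf {C. maximal_bound M \<E> X Y C}"

text \<open>
  Positive isometric linear isomorphisms, modulo null sets.  Compatibility with a.e. equality and
  injectivity follow from linearity and the isometry condition.  A scalar \<open>z\<close> is nonnegative iff
  \<open>z = of_real (norm z)\<close>.
\<close>

definition pos_isometric_iso ::
  "'a measure \<Rightarrow> ('a, 'k::{real_normed_field, euclidean_space}) fspace \<Rightarrow> ('a, 'k) fspace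
     \<Rightarrow> (('a \<Rightarrow> 'k) \<Rightarrow> 'a \<Rightarrow> 'k) \<Rightarrow> bool" where
  "pos_isometric_iso M X Y L \<longleftrightarrow>
     (\<forall>f\<in>carr X. L f \<in> carr Y) \<and>
     (\<forall>f\<in>carr X. \<forall>g\<in>carr X. AE x in M. L (\<lambda>y. f y + g y) x = L f x + L g x) \<and>
     (\<forall>c. \<forall>f\<in>carr X. AE x in M. L (\<lambda>y. c * f y) x = c * L f x) \<and>
     (\<forall>f\<in>carr X. nrm Y (L f) = nrm X f) \<and>
     (\<forall>g\<in>carr Y. \<exists>f\<in>carr X. AE x in M. L f x = g x) \<and>
     (\<forall>f\<in>carr X. (AE x in M. f x = of_real (norm (f x))) \<longrightarrow>
        (AE x in M. L f x = of_real (norm (L f x))))"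

text \<open>
  The domains of \<open>T\<close> in the one-weight and the two-weight situation: the unions of
  $S^{-1}(L^{p_1}_w(\Omega))$ over all $w$, respectively of $S^{-1}(L^{p_1}_{w_1}(\Omega))$ over all
  pairs $(w_1,w_2)$, in the class \<open>A\<close>.  As \<open>T\<close> is a total function in HOL, that $Tf$ is well-defined
  is expressed by membership of $f$ in these sets.
\<close>

definition one_weight_dom ::
  "'a measure \<Rightarrow> ennreal \<Rightarrow> (('a \<Rightarrow> real) \<times> ('a \<Rightarrow> real)) set \<Rightarrow> 'v set
     \<Rightarrow> ('v \<Rightarrow> 'a \<Rightarrow> 'b::real_normed_vector) \<Rightarrow> 'v set" where
  "one_weight_dom M p\<^sub>1 A V S = (\<Union>w\<in>{w. (w, w) \<in> A}. {f \<in> V. S f \<in> weighted_Lp M p\<^sub>1 w})"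

definition two_weight_dom ::
  "'a measure \<Rightarrow> ennreal \<Rightarrow> (('a \<Rightarrow> real) \<times> ('a \<Rightarrow> real)) set \<Rightarrow> 'v set
     \<Rightarrow> ('v \<Rightarrow> 'a \<Rightarrow> 'b::real_normed_vector) \<Rightarrow> 'v set" where
  "two_weight_dom M p\<^sub>1 A V S = (\<Union>(w\<^sub>1, w\<^sub>2)\<in>A. {f \<in> V. S f \<in> weighted_Lp M p\<^sub>1 w\<^sub>1})"

definition increasing_fun :: "(real \<Rightarrow> real) \<Rightarrow> bool" where
  "increasing_fun \<phi> \<longleftrightarrow> mono_on {0..} \<phi> \<and> (\<forall>x\<ge>0. 0 \<le> \<phi> x)"

end

theory Submission
  imports Defs
begin

text \<open>
  Write \<open>\<delta> = 1/r\<^sub>1 - 1/s\<^sub>1 = 1/r\<^sub>2 - t\<^sub>2\<close>, \<open>a = 1/r\<^sub>1 - 1/p\<^sub>1\<close> and \<open>b = 1/p\<^sub>2 - t\<^sub>2\<close>, so that \<open>a + b = \<delta>\<close>,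
  \<open>1/p\<^sub>1 = 1/s\<^sub>1 + b\<close> and \<open>1/r\<^sub>2 = 1/p\<^sub>2 + a\<close>, and abbreviate \<open>Z\<^sub>X = X\<^bsub>r\<^sub>1,s\<^sub>1\<^esub>\<close> and \<open>Z\<^sub>Y = Y\<^bsub>r\<^sub>2,s\<^sub>2\<^esub>\<close>.
  The estimate for \<open>T\<close> is reduced to the weighted hypothesis in four steps.

  First, \<open>f = S f\<^sub>0\<close> factors as \<open>|f| \<le> c H\<^sub>0\<^sup>\<delta> k\<^bsup>1/s\<^sub>1\<^esup>\<close> with \<open>H\<^sub>0\<close> in the unit ball of \<open>Z\<^sub>X\<close>, \<open>k\<close> in that of
  $L^1$, and \<open>c\<close> as close to the norm of \<open>f\<close> as desired (\<open>function_factorization\<close>).  This is the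
  identity \<open>X\<^sup>r = Z\<^sub>X\<^sup>\<theta> (L\<^sup>1)\<^bsup>1-\<theta>\<^esup>\<close>, \<open>\<theta> = r \<delta>\<close>, for Calderon products; it comes out of the bipolar theorem
  (\<open>bipolar\<close>): the product on the right has a convex unit ball which is closed in $L^0$, and its
  polar lies in the polar of the unit ball of \<open>X\<^sup>r\<close> (\<open>lozanovskii_factorization\<close>).

  Secondly, membership of \<open>g = T f\<^sub>0\<close> in \<open>Y\<close> and the size of its norm are tested by duality: by the
  bipolar theorem for the unit ball of \<open>Y\<^bsup>r\<^sub>2\<^esup>\<close> it suffices to bound the $L^{r_2}$ norm of \<open>g G\<^sub>0\<^sup>\<delta>\<close> for all
  a.e. positive \<open>G\<^sub>0\<close> in the unit ball of the space whose Koethe dual is \<open>Z\<^sub>Y\<close>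
  (\<open>carr_of_test_functions\<close>).  In particular, \<open>G\<^sub>0\<close> has norm at most one in the dual of \<open>Z\<^sub>Y\<close>.

  Thirdly, the Rubio de Francia algorithm turns \<open>H\<^sub>0\<close> and \<open>G\<^sub>0\<close> into functions \<open>H \<ge> H\<^sub>0/2\<close> and
  \<open>G \<ge> G\<^sub>0/2\<close> of the same unit balls, and finds \<open>H\<^sub>2\<close> and \<open>G\<^sub>1\<close> in the unit balls of \<open>Z\<^sub>Y\<close> and of the
  dual of \<open>Z\<^sub>X\<close> such that \<open>2 N\<^sub>1 H\<^sub>2\<close> dominates the maximal function of \<open>H\<close>, and \<open>2 N\<^sub>2 G\<^sub>1\<close> that of \<open>G\<close>
  (\<open>rubio_de_francia\<close>); \<open>N\<^sub>1\<close> and \<open>N\<^sub>2\<close> are the two operator norms.  Here \<open>H\<^sub>2\<close> and \<open>G\<^sub>1\<close> are the images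
  of \<open>H\<close> and \<open>G\<close> under the positive isometries.  In the situation of one weight the isometries are
  identities, hence \<open>H\<^sub>2 = H\<close> and \<open>G\<^sub>1 = G\<close>, and this situation becomes a special case of the other one.

  Finally, the weights are \<open>w\<^sub>1 = H\<^bsup>-a\<^esup> G\<^sub>1\<^sup>b\<close> and \<open>w\<^sub>2 = H\<^sub>2\<^bsup>-a\<^esup> G\<^sup>b\<close>.  The domination of the averages gives
  \<open>[w\<^sub>1, w\<^sub>2] \<le> (2 N\<^sub>1)\<^sup>a (2 N\<^sub>2)\<^sup>b\<close> (\<open>A_const_le\<close>), and Hoelder's inequality gives
  \<open>\<parallel>f w\<^sub>1\<parallel> \<le> 2\<^sup>a c\<close> in $L^{p_1}$ and \<open>\<parallel>g G\<^sub>0\<^sup>\<delta>\<parallel> \<le> 2\<^sup>b \<parallel>g w\<^sub>2\<parallel>\<close> between $L^{r_2}$ and $L^{p_2}$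
  (\<open>weight_pair_exists\<close>).  In the first of these estimates only \<open>G\<^sub>1\<close>, and in the second only \<open>H\<^sub>2\<close>, is
  integrated against a function of the dual unit ball, while \<open>H\<close> and \<open>G\<close> are compared with \<open>H\<^sub>0\<close> and
  \<open>G\<^sub>0\<close> pointwise; this is what keeps the outer constant at \<open>2\<^sup>a 2\<^sup>b = 2\<^sup>\<delta>\<close>.

  All spaces are handled through their unit balls, as sets of nonnegative real functions, on which
  Koethe duals become polars (\<open>represents_koethe_dual\<close>).
\<close>

section \<open>Unit balls as sets of nonnegative functions\<close>

definition nnfun :: "'a measure \<Rightarrow> ('a \<Rightarrow> real) set" where
  "nnfun M = {u \<in> borel_measurable M. \<forall>x. 0 \<le> u x}"

text \<open>
  The properties of the set of nonnegative members of the unit ball of an ideal function space which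
  do not involve the triangle inequality: solidity, the Fatou property, saturation, and, as the last
  clause, the absence of half-lines, which makes the gauge vanish only at the zero function.
  Convexity is kept apart because the unit ball of a quasi-normed space is in general not convex.
\<close>

definition solid_ball :: "'a measure \<Rightarrow> ('a \<Rightarrow> real) set \<Rightarrow> bool" where
  "solid_ball M B \<longleftrightarrow>
     B \<subseteq> nnfun M \<and> (\<lambda>x. 0) \<in> B \<and>
     (\<forall>u\<in>B. \<forall>v\<in>nnfun M. (AE x in M. v x \<le> u x) \<longrightarrow> v \<in> B) \<and>
     (\<forall>U. \<forall>v\<in>nnfun M. (\<forall>n::nat. U n \<in> B) \<and>
        (AE x in M. incseq (\<lambda>n. U n x) \<and> (\<lambda>n. U n x) \<longlonglongrightarrow> v x) \<longrightarrow> v \<in> B) \<and>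
     (\<forall>A\<in>sets M. 0 < emeasure M A \<longrightarrow> (\<exists>u\<in>B. \<not> (AE x in M. x \<in> A \<longrightarrow> u x = 0))) \<and>
     (\<forall>u\<in>nnfun M. (\<forall>n::nat. (\<lambda>x. real n * u x) \<in> B) \<longrightarrow> (AE x in M. u x = 0))"

definition convex_ball :: "('a \<Rightarrow> real) set \<Rightarrow> bool" where
  "convex_ball B \<longleftrightarrow>
     (\<forall>u\<in>B. \<forall>v\<in>B. \<forall>c. 0 \<le> c \<longrightarrow> c \<le> 1 \<longrightarrow> (\<lambda>x. c * u x + (1 - c) * v x) \<in> B)"

definition polar :: "'a measure \<Rightarrow> ('a \<Rightarrow> real) set \<Rightarrow> ('a \<Rightarrow> real) set" where
  "polar M B = {g \<in> nnfun M. \<forall>u\<in>B. (\<integral>\<^sup>+x. ennreal (u x * g x) \<partial>M) \<le> 1}"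

text \<open>
  If \<open>B\<close> is the unit ball of a space \<open>E\<close>, this is the unit ball of \<open>E\<^sup>p\<close>.
\<close>

definition power_ball :: "'a measure \<Rightarrow> real \<Rightarrow> ('a \<Rightarrow> real) set \<Rightarrow> ('a \<Rightarrow> real) set" where
  "power_ball M p B = {u \<in> nnfun M. (\<lambda>x. u x powr (1 / p)) \<in> B}"

lemma nnfunI [intro]: "u \<in> borel_measurable M \<Longrightarrow> (\<And>x. 0 \<le> u x) \<Longrightarrow> u \<in> nnfun M"
  by (simp add: nnfun_def)

lemma nnfun_measurable: "u \<in> nnfun M \<Longrightarrow> u \<in> borel_measurable M"
  and nnfun_nonneg: "u \<in> nnfun M \<Longrightarrow> 0 \<le> u x"
  by (auto simp: nnfun_def)

lemma polar_nnfun: "g \<in> polar M B \<Longrightarrow> g \<in> nnfun M"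
  and polarD: "g \<in> polar M B \<Longrightarrow> u \<in> B \<Longrightarrow> (\<integral>\<^sup>+x. ennreal (u x * g x) \<partial>M) \<le> 1"
  by (auto simp: polar_def)

lemma convex_ballD:
  "convex_ball B \<Longrightarrow> u \<in> B \<Longrightarrow> v \<in> B \<Longrightarrow> 0 \<le> c \<Longrightarrow> c \<le> 1 \<Longrightarrow> (\<lambda>x. c * u x + (1 - c) * v x) \<in> B"
  by (auto simp: convex_ball_def)

lemma solid_ball_nnfun: "solid_ball M B \<Longrightarrow> u \<in> B \<Longrightarrow> u \<in> nnfun M"
  and solid_ball_zero: "solid_ball M B \<Longrightarrow> (\<lambda>x. 0) \<in> B"
  and solid_ball_solid:
    "solid_ball M B \<Longrightarrow> u \<in> B \<Longrightarrow> v \<in> nnfun M \<Longrightarrow> (AE x in M. v x \<le> u x) \<Longrightarrow> v \<in> B"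
  and solid_ball_saturated:
    "solid_ball M B \<Longrightarrow> A \<in> sets M \<Longrightarrow> 0 < emeasure M A \<Longrightarrow>
       \<exists>u\<in>B. \<not> (AE x in M. x \<in> A \<longrightarrow> u x = 0)"
  and solid_ball_bounded:
    "solid_ball M B \<Longrightarrow> u \<in> nnfun M \<Longrightarrow> (\<And>n::nat. (\<lambda>x. real n * u x) \<in> B) \<Longrightarrow>
       AE x in M. u x = 0"
  unfolding solid_ball_def by blast+

lemma solid_ball_mono_limit:
  assumes "solid_ball M B" "\<And>n::nat. U n \<in> B" "v \<in> nnfun M"
    and "AE x in M. incseq (\<lambda>n. U n x) \<and> (\<lambda>n. U n x) \<longlonglongrightarrow> v x"
  shows "v \<in> B"
  using assms unfolding solid_ball_def by blast

text \<open>
  The infima of the tails of a convergent sequence increase to its limit and stay in the ball by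
  solidity, so closedness under increasing limits already gives closedness in $L^0$.
\<close>

lemma solid_ball_limit:
  assumes B: "solid_ball M B" and U: "\<And>n::nat. U n \<in> B" and v: "v \<in> nnfun M"
    and lim: "AE x in M. (\<lambda>n. U n x) \<longlonglongrightarrow> v x"
  shows "v \<in> B"
proof -
  define V where "V n x = (INF m\<in>{n..}. U m x)" for n x
  have U0: "0 \<le> U n x" and Um [measurable]: "U n \<in> borel_measurable M" for n x
    using solid_ball_nnfun[OF B U] by (auto simp: nnfun_def)
  have bdd: "bdd_below ((\<lambda>m. U m x) ` {n..})" for n x
    by (rule bdd_belowI[of _ 0]) (auto simp: U0)
  have VU: "V n x \<le> U n x" for n x
    unfolding V_def by (rule cINF_lower[OF bdd]) auto
  have V0: "0 \<le> V n x" for n x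
    unfolding V_def by (rule cINF_greatest) (auto simp: U0)
  have [measurable]: "V n \<in> borel_measurable M" for n
    unfolding V_def[abs_def] by (rule borel_measurable_cINF) (auto simp: bdd)
  have VB: "V n \<in> B" for n
    by (rule solid_ball_solid[OF B U[of n]]) (auto simp: VU V0)
  have inc: "incseq (\<lambda>n. V n x)" for x
    unfolding incseq_def V_def by (intro allI impI cINF_superset_mono bdd) auto
  have conv: "(\<lambda>n. V n x) \<longlonglongrightarrow> v x" if cx: "(\<lambda>n. U n x) \<longlonglongrightarrow> v x" for x
  proof (rule LIMSEQ_I)
    fix e :: real assume "0 < e"
    then obtain n0 where n0: "\<And>n. n \<ge> n0 \<Longrightarrow> norm (U n x - v x) < e / 2"
      using LIMSEQ_D[OF cx, of "e/2"] by auto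
    have "norm (V n x - v x) < e" if "n \<ge> n0" for n
    proof -
      have "v x - e / 2 \<le> V n x"
        unfolding V_def
      proof (rule cINF_greatest)
        fix m assume "m \<in> {n..}"
        with that n0[of m] have "\<bar>U m x - v x\<bar> < e / 2" by simp
        then show "v x - e / 2 \<le> U m x" by linarith
      qed auto
      moreover have "V n x < v x + e / 2" using VU[of n x] n0[OF that, unfolded real_norm_def]
        by linarith
      ultimately show ?thesis using \<open>0 < e\<close> unfolding real_norm_def by linarith
    qed
    then show "\<exists>n0. \<forall>n\<ge>n0. norm (V n x - v x) < e" by blast
  qed
  show ?thesis
    by (rule solid_ball_mono_limit[OF B, of V v]) (use VB v lim conv inc in auto)
qed

text \<open>
  If the sequence were unbounded on a set \<open>A\<close>, truncating its members at \<open>k\<close> on \<open>A\<close> would show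
  that every multiple of the indicator of \<open>A\<close> is in the ball, which contains no half-line.
\<close>

lemma solid_ball_incseq_finite:
  assumes B: "solid_ball M B" and U: "\<And>n::nat. U n \<in> B" and inc: "AE x in M. incseq (\<lambda>n. U n x)"
  shows "AE x in M. bdd_above (range (\<lambda>n. U n x))"
proof -
  have U0: "0 \<le> U n x" and Um [measurable]: "U n \<in> borel_measurable M" for n x
    using solid_ball_nnfun[OF B U] by (auto simp: nnfun_def)
  define A where "A = {x \<in> space M. \<forall>k::nat. \<exists>n. real k \<le> U n x}"
  have [measurable]: "A \<in> sets M" unfolding A_def by measurable
  have "(\<lambda>x. real k * indicator A x) \<in> B" for k :: nat
  proof (rule solid_ball_mono_limit[OF B])
    show "(\<lambda>x. min (U n x) (real k * indicator A x)) \<in> B" for n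
      by (rule solid_ball_solid[OF B U[of n]]) (auto simp: U0)
    show "AE x in M. incseq (\<lambda>n. min (U n x) (real k * indicator A x)) \<and>
        (\<lambda>n. min (U n x) (real k * indicator A x)) \<longlonglongrightarrow> real k * indicator A x"
      using inc
    proof eventually_elim
      case (elim x)
      have "(\<lambda>n. min (U n x) (real k * indicator A x)) \<longlonglongrightarrow> real k * indicator A x"
      proof (cases "x \<in> A")
        case True
        then obtain n where n: "real k \<le> U n x" by (auto simp: A_def)
        have "min (U m x) (real k) = real k" if "m \<ge> n" for m
          using n elim that unfolding incseq_def by (metis min.absorb2 order_trans)
        then show ?thesis using True
          by (intro tendsto_eventually) (auto simp: eventually_sequentially)
      qed (auto simp: U0 min_absorb2)
      with elim show ?case by (auto simp: incseq_def intro: min.coboundedI1)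
    qed
  qed auto
  then have "AE x in M. indicator A x = (0::real)"
    by (intro solid_ball_bounded[OF B]) auto
  with inc show ?thesis using AE_space
  proof eventually_elim
    case (elim x)
    then obtain k :: nat where "\<And>n. \<not> real k \<le> U n x"
      by (auto simp: A_def indicator_def split: if_splits)
    then show ?case by (intro bdd_aboveI2[of _ _ "real k"]) (meson less_imp_le not_le)
  qed
qed

lemma dyadic_partial_sum_mem:
  assumes B: "solid_ball M B" and c: "convex_ball B" and U: "\<And>n::nat. U n \<in> B"
  shows "(\<lambda>x. \<Sum>k<n. U k x / 2 ^ Suc k) \<in> B"
  using U
proof (induction n arbitrary: U)
  case 0
  then show ?case using solid_ball_zero[OF B] by simp
next
  case (Suc n)
  have "(\<lambda>x. 1/2 * U 0 x + (1 - 1/2) * (\<Sum>k<n. U (Suc k) x / 2 ^ Suc k)) \<in> B"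
    using c[unfolded convex_ball_def, rule_format, OF Suc.prems[of 0] Suc.IH[of "\<lambda>k. U (Suc k)"],
        of "1/2"]
      Suc.prems by simp
  then show ?case
    by (subst sum.lessThan_Suc_shift) (simp add: sum_distrib_left field_simps)
qed

text \<open>
  Completeness of the spaces enters in this form: the partial sums stay in the ball by convexity, and
  they cannot increase to infinity on a set of positive measure.
\<close>

lemma dyadic_sum_mem:
  assumes B: "solid_ball M B" and c: "convex_ball B" and U: "\<And>n::nat. U n \<in> B"
  shows "\<exists>v\<in>B. AE x in M. (\<lambda>k. U k x / 2 ^ Suc k) sums v x"
proof -
  have U0: "0 \<le> U n x" and Um [measurable]: "U n \<in> borel_measurable M" for n x
    using solid_ball_nnfun[OF B U] by (auto simp: nnfun_def)
  define v where "v x = max 0 (\<Sum>k. U k x / 2 ^ Suc k)" for x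
  have inc: "incseq (\<lambda>n. \<Sum>k<n. U k x / 2 ^ Suc k)" for x
    by (intro incseq_SucI) (simp add: U0)
  have "AE x in M. bdd_above (range (\<lambda>n. \<Sum>k<n. U k x / 2 ^ Suc k))"
    by (rule solid_ball_incseq_finite[OF B dyadic_partial_sum_mem[OF B c U]]) (intro AE_I2 inc)
  then have s: "AE x in M. (\<lambda>k. U k x / 2 ^ Suc k) sums v x"
  proof eventually_elim
    case (elim x)
    then obtain K where "\<And>n. (\<Sum>k<n. U k x / 2 ^ Suc k) \<le> K" by (auto simp: bdd_above_def)
    then have "summable (\<lambda>k. U k x / 2 ^ Suc k)"
      by (intro summableI_nonneg_bounded[of _ K]) (auto simp: U0)
    moreover from this have "0 \<le> (\<Sum>k. U k x / 2 ^ Suc k)" by (intro suminf_nonneg) (auto simp: U0)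
    ultimately show ?case by (auto simp: v_def max_absorb2 summable_sums)
  qed
  have "v \<in> nnfun M" unfolding v_def[abs_def] by (rule nnfunI) auto
  moreover have "(\<lambda>x. \<Sum>k<n. U k x / 2 ^ Suc k) \<in> B" for n
    by (rule dyadic_partial_sum_mem[OF B c U])
  ultimately have "v \<in> B"
    by (intro solid_ball_mono_limit[OF B, of "\<lambda>n x. \<Sum>k<n. U k x / 2 ^ Suc k" v])
       (use s inc in \<open>auto simp: sums_def\<close>)
  with s show ?thesis by blast
qed

section \<open>Nested convex families in $L^0$\<close>

lemma (in sigma_finite_measure) obtain_equivalent_density:
  obtains \<rho> :: "'a \<Rightarrow> real" where "\<rho> \<in> borel_measurable M" "\<And>x. 0 < \<rho> x" "(\<integral>\<^sup>+x. ennreal (\<rho> x) \<partial>M) < \<infinity>"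
proof -
  obtain h where h: "h \<in> borel_measurable M" "integral\<^sup>N M h \<noteq> \<infinity>"
    "\<And>x. x \<in> space M \<Longrightarrow> 0 < h x \<and> h x < \<infinity>"
    using Ex_finite_integrable_function by blast
  note [measurable] = h(1)
  define \<rho> where "\<rho> x = (if x \<in> space M then enn2real (h x) else 1)" for x
  show ?thesis
  proof
    show "\<rho> \<in> borel_measurable M" unfolding \<rho>_def[abs_def] by measurable
    show "0 < \<rho> x" for x using h(3) by (auto simp: \<rho>_def enn2real_positive_iff)
    have "(\<integral>\<^sup>+x. ennreal (\<rho> x) \<partial>M) = integral\<^sup>N M h"
      by (intro nn_integral_cong) (use h(3) in \<open>auto simp: \<rho>_def\<close>)
    then show "(\<integral>\<^sup>+x. ennreal (\<rho> x) \<partial>M) < \<infinity>" using h(2) by (simp add: top.not_eq_extremum)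
  qed
qed

text \<open>
  Replacing \<open>M\<close> by \<open>N\<close> makes bounded functions integrable and leaves a.e. statements unchanged.
\<close>

lemma (in sigma_finite_measure) obtain_equivalent_finite_measure:
  obtains N and \<rho> :: "'a \<Rightarrow> real"
  where "finite_measure N" "sets N = sets M" "\<rho> \<in> borel_measurable M" "\<And>x. 0 < \<rho> x"
    "\<And>P. (AE x in N. P x) \<longleftrightarrow> (AE x in M. P x)"
    "\<And>f. f \<in> borel_measurable M \<Longrightarrow> (\<integral>\<^sup>+x. f x \<partial>N) = (\<integral>\<^sup>+x. ennreal (\<rho> x) * f x \<partial>M)"
proof -
  obtain \<rho> :: "'a \<Rightarrow> real" where [measurable]: "\<rho> \<in> borel_measurable M"
    and \<rho>: "\<And>x. 0 < \<rho> x" and int: "(\<integral>\<^sup>+x. ennreal (\<rho> x) \<partial>M) < \<infinity>"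
    using obtain_equivalent_density by blast
  let ?N = "density M (\<lambda>x. ennreal (\<rho> x))"
  show ?thesis
  proof (rule that[of ?N \<rho>])
    show "finite_measure ?N"
      by (rule finite_measureI) (use int in \<open>simp add: emeasure_density nn_integral_set_ennreal\<close>)
    show "(AE x in ?N. P x) \<longleftrightarrow> (AE x in M. P x)" for P
      by (subst AE_density) (auto simp: \<rho>)
    show "(\<integral>\<^sup>+x. f x \<partial>?N) = (\<integral>\<^sup>+x. ennreal (\<rho> x) * f x \<partial>M)"
      if "f \<in> borel_measurable M" for f
      using that by (simp add: nn_integral_density)
  qed (auto simp: \<rho>)
qed

lemma (in sigma_finite_measure) obtain_positive_integrable:
  obtains k :: "'a \<Rightarrow> real" where "k \<in> borel_measurable M" "\<And>x. 0 < k x" "(\<integral>\<^sup>+x. ennreal (k x) \<partial>M) \<le> 1"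
proof -
  obtain \<rho> :: "'a \<Rightarrow> real" where \<rho>: "\<rho> \<in> borel_measurable M" "\<And>x. 0 < \<rho> x" "(\<integral>\<^sup>+x. ennreal (\<rho> x) \<partial>M)
      < \<infinity>"
    using obtain_equivalent_density by blast
  note [measurable] = \<rho>(1)
  obtain R where R: "0 \<le> R" "(\<integral>\<^sup>+x. ennreal (\<rho> x) \<partial>M) = ennreal R" using \<rho>(3)
    by (metis ennreal_cases less_irrefl infinity_ennreal_def)
  show ?thesis
  proof (rule that[of "\<lambda>x. \<rho> x / (R + 1)"])
    show "0 < \<rho> x / (R + 1)" for x using \<rho>(2)[of x] R by simp
    have "(\<integral>\<^sup>+x. ennreal (\<rho> x / (R + 1)) \<partial>M) = (\<integral>\<^sup>+x. ennreal (1 / (R + 1)) * ennreal (\<rho> x) \<partial>M)"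
      using R less_imp_le[OF \<rho>(2)] by (intro nn_integral_cong) (simp add: ennreal_mult[symmetric])
    also have "\<dots> = ennreal (1 / (R + 1)) * ennreal R" by (simp add: nn_integral_cmult R)
    also have "\<dots> = ennreal (R / (R + 1))" using R by (simp add: ennreal_mult[symmetric])
    also have "\<dots> \<le> 1" using R by (simp add: ennreal_le_1)
    finally show "(\<integral>\<^sup>+x. ennreal (\<rho> x / (R + 1)) \<partial>M) \<le> 1" .
  qed simp
qed

lemma nn_integral_le_of_tendsto:
  fixes f :: "nat \<Rightarrow> 'a \<Rightarrow> ennreal"
  assumes [measurable]: "\<And>n. f n \<in> borel_measurable M"
    and lim: "AE x in M. (\<lambda>n. f n x) \<longlonglongrightarrow> g x" and le: "\<And>n. (\<integral>\<^sup>+x. f n x \<partial>M) \<le> K"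
  shows "(\<integral>\<^sup>+x. g x \<partial>M) \<le> K"
proof -
  have "(\<integral>\<^sup>+x. g x \<partial>M) = (\<integral>\<^sup>+x. liminf (\<lambda>n. f n x) \<partial>M)"
    by (rule nn_integral_cong_AE) (use lim in \<open>eventually_elim, auto simp: lim_imp_Liminf\<close>)
  also have "\<dots> \<le> liminf (\<lambda>n. \<integral>\<^sup>+x. f n x \<partial>M)" by (rule nn_integral_liminf) simp
  also have "\<dots> \<le> K" using le by (intro Liminf_le) auto
  finally show ?thesis .
qed

text \<open>
  The exponentials of the sequence converge, but their limit might vanish on a set where the sequence
  itself tends to infinity; the bound on the weighted integrals excludes this by Fatou's lemma.
\<close>

lemma AE_limit_from_exp_limit:
  fixes U :: "nat \<Rightarrow> 'a \<Rightarrow> real"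
  assumes U: "\<And>n. U n \<in> nnfun M" and \<eta> [measurable]: "\<eta> \<in> borel_measurable M"
    and \<eta>0: "AE x in M. 0 < \<eta> x"
    and K: "\<And>n. (\<integral>\<^sup>+x. ennreal (U n x * \<eta> x) \<partial>M) \<le> K" "K < \<infinity>"
    and conv: "AE x in M. convergent (\<lambda>n. exp (- U n x / 2))"
  shows "\<exists>u\<in>nnfun M. AE x in M. (\<lambda>n. U n x) \<longlonglongrightarrow> u x"
proof -
  note [measurable] = nnfun_measurable[OF U]
  define a where "a x = lim (\<lambda>n. exp (- U n x / 2))" for x
  define u where "u x = max 0 (- 2 * ln (a x))" for x
  have [measurable]: "a \<in> borel_measurable M"
    unfolding a_def[abs_def] by (rule borel_measurable_lim_metric) auto
  have "(\<integral>\<^sup>+x. liminf (\<lambda>n. ennreal (U n x * \<eta> x)) \<partial>M) \<le> liminf (\<lambda>n. \<integral>\<^sup>+x. ennreal (U n x * \<eta> x) \<partial>M)"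
    by (rule nn_integral_liminf) simp
  also have "\<dots> \<le> K" using K(1) by (intro Liminf_le) auto
  finally have "AE x in M. liminf (\<lambda>n. ennreal (U n x * \<eta> x)) \<noteq> \<infinity>"
    using K(2) by (intro nn_integral_PInf_AE) (auto simp: top_unique)
  with conv \<eta>0 have "AE x in M. (\<lambda>n. U n x) \<longlonglongrightarrow> u x"
  proof eventually_elim
    case (elim x)
    have ax: "(\<lambda>n. exp (- U n x / 2)) \<longlonglongrightarrow> a x"
      using elim by (simp add: a_def convergent_LIMSEQ_iff)
    have "a x \<noteq> 0"
    proof
      assume "a x = 0"
      have "(\<lambda>n. ennreal (U n x * \<eta> x)) \<longlonglongrightarrow> top"
        unfolding tendsto_top_iff_ennreal
      proof (intro allI impI)
        fix l :: real assume "0 \<le> l"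
        have "\<forall>\<^sub>F n in sequentially. exp (- U n x / 2) < exp (- (l / \<eta> x) / 2)"
          using order_tendstoD(2)[OF ax, of "exp (- (l / \<eta> x) / 2)"] \<open>a x = 0\<close> by simp
        then show "\<forall>\<^sub>F n in sequentially. ennreal l < ennreal (U n x * \<eta> x)"
          by (rule eventually_mono) (use \<open>0 < \<eta> x\<close> \<open>0 \<le> l\<close> in \<open>auto
              simp: field_simps ennreal_less_iff\<close>)
      qed
      then have "liminf (\<lambda>n. ennreal (U n x * \<eta> x)) = \<infinity>"
        by (auto dest: lim_imp_Liminf[rotated])
      with elim show False by simp
    qed
    have "(\<lambda>n. - 2 * ln (exp (- U n x / 2))) \<longlonglongrightarrow> - 2 * ln (a x)"
      by (intro tendsto_intros ax \<open>a x \<noteq> 0\<close>)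
    then have lim: "(\<lambda>n. U n x) \<longlonglongrightarrow> - 2 * ln (a x)" by simp
    then have "0 \<le> - 2 * ln (a x)"
      by (rule LIMSEQ_le_const) (auto simp: nnfun_nonneg[OF U])
    with lim show ?case by (simp add: u_def max_absorb2)
  qed
  moreover have "u \<in> nnfun M" unfolding u_def[abs_def] by auto
  ultimately show ?thesis by blast
qed

text \<open>
  A parallelogram identity: the defect of midpoint convexity of the exponential is a square.
\<close>

lemma exp_half_diff_square:
  "(exp (- x / 2) - exp (- y / 2))\<^sup>2 = exp (- x) + exp (- y) - 2 * exp (- ((x + y) / 2))"
    for x y :: real
proof -
  have "exp (- x / 2) * exp (- x / 2) = exp (- x)" "exp (- y / 2) * exp (- y / 2) = exp (- y)"
    "exp (- x / 2) * exp (- y / 2) = exp (- ((x + y) / 2))"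
    by (auto simp: field_simps simp flip: exp_add)
  then show ?thesis by (simp add: power2_diff power2_eq_square algebra_simps)
qed

text \<open>
  Decreasing sequences of convex sets which are closed under a.e. convergence and bounded in $L^0$
  have a common point.  Choose \<open>(u\<^sub>n, v\<^sub>n)\<close> almost minimizing \<open>\<integral> exp (-u) + exp (-v)\<close> over the \<open>n\<close>-th set.
  As midpoints stay in the sets, the parallelogram identity above makes \<open>exp (-u\<^sub>n/2)\<close> and
  \<open>exp (-v\<^sub>n/2)\<close> Cauchy in $L^2$ of a finite measure, so that a subsequence converges a.e.  Pairs are
  treated because both factors of a product have to be found simultaneously.
\<close>

lemma (in sigma_finite_measure) nested_pairs_Int_nonempty:
  fixes C :: "nat \<Rightarrow> (('a \<Rightarrow> real) \<times> ('a \<Rightarrow> real)) set"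
  assumes sub: "\<And>n. C n \<subseteq> nnfun M \<times> nnfun M" and ne: "\<And>n. C n \<noteq> {}" and dec: "decseq C"
    and mid: "\<And>n u v u' v'. (u, v) \<in> C n \<Longrightarrow> (u', v') \<in> C n \<Longrightarrow>
      ((\<lambda>x. (u x + u' x) / 2), (\<lambda>x. (v x + v' x) / 2)) \<in> C n"
    and cl: "\<And>n U V u v. (\<And>j::nat. (U j, V j) \<in> C n) \<Longrightarrow> u \<in> nnfun M \<Longrightarrow> v \<in> nnfun M \<Longrightarrow>
      (AE x in M. (\<lambda>j. U j x) \<longlonglongrightarrow> u x) \<Longrightarrow> (AE x in M. (\<lambda>j. V j x) \<longlonglongrightarrow> v x) \<Longrightarrow> (u, v) \<in> C n"
    and \<eta>: "\<eta> \<in> borel_measurable M" "AE x in M. 0 < \<eta> x"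
    and K: "\<And>u v. (u, v) \<in> C 0 \<Longrightarrow> (\<integral>\<^sup>+x. ennreal (u x * \<eta> x) \<partial>M) \<le> K"
      "\<And>u v. (u, v) \<in> C 0 \<Longrightarrow> (\<integral>\<^sup>+x. ennreal (v x * \<eta> x) \<partial>M) \<le> K" "K < \<infinity>"
  shows "\<exists>u v. \<forall>n. (u, v) \<in> C n"
proof -
  obtain N and \<rho> :: "'a \<Rightarrow> real" where "finite_measure N" and sN [measurable_cong]: "sets N = sets M"
    and AEN: "\<And>P. (AE x in N. P x) \<longleftrightarrow> (AE x in M. P x)"
    by (metis obtain_equivalent_finite_measure)
  interpret N: finite_measure N by fact
  define m where "m = measure N (space N)"
  have m0: "0 \<le> m" by (simp add: m_def)
  define \<Psi> where "\<Psi> p = (\<integral>x. exp (- fst p x) + exp (- snd p x) \<partial>N)"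
    for p :: "('a \<Rightarrow> real) \<times> ('a \<Rightarrow> real)"
  have meas: "u \<in> borel_measurable N" if "u \<in> nnfun M" for u
    using nnfun_measurable[OF that] by simp
  have int: "integrable N (\<lambda>x. exp (- u x))" if "u \<in> nnfun M" for u
    using meas[OF that] by (intro N.integrable_const_bound[of _ 1]) (auto simp: nnfun_nonneg[OF that])
  have \<Psi>0: "0 \<le> \<Psi> p" for p unfolding \<Psi>_def by (intro integral_nonneg_AE) auto
  have \<Psi>2: "\<Psi> p \<le> 2 * m" if "p \<in> C n" for p n
  proof -
    have p: "fst p \<in> nnfun M" "snd p \<in> nnfun M" using sub[of n] that by auto
    have "\<Psi> p \<le> (\<integral>x. 2 \<partial>N)" unfolding \<Psi>_def
    proof (intro integral_mono)
      show "exp (- fst p x) + exp (- snd p x) \<le> 2" for x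
        using p[THEN nnfun_nonneg, of x] by (smt (verit) exp_le_one_iff)
    qed (use int p in auto)
    then show ?thesis by (simp add: m_def)
  qed
  define I where "I n = (INF p\<in>C n. \<Psi> p)" for n
  have bdd: "bdd_below (\<Psi> ` C n)" for n by (rule bdd_belowI[of _ 0]) (auto simp: \<Psi>0)
  have Iinc: "incseq I" unfolding incseq_def I_def
    using dec by (intro allI impI cINF_superset_mono ne bdd) (auto simp: decseq_def)
  have I2: "I n \<le> 2 * m" for n
  proof -
    obtain p where "p \<in> C n" using ne by blast
    then show ?thesis unfolding I_def using cINF_lower[OF bdd, of p n] \<Psi>2[of p n] by linarith
  qed
  obtain L where L: "I \<longlonglongrightarrow> L" using incseq_convergent[OF Iinc] I2 by blast
  have "\<exists>p\<in>C n. \<Psi> p < I n + 1 / (real n + 1)" for n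
    using cInf_lessD[of "\<Psi> ` C n" "I n + 1 / (real n + 1)"] ne unfolding I_def by auto
  then obtain p where p: "\<And>n. p n \<in> C n" "\<And>n. \<Psi> (p n) < I n + 1 / (real n + 1)" by metis
  define U V where "U n = fst (p n)" and "V n = snd (p n)" for n
  have UV: "U n \<in> nnfun M" "V n \<in> nnfun M" and UVC: "(U n, V n) \<in> C n" for n
    using sub[of n] p(1)[of n] by (auto simp: U_def V_def)
  note [measurable] = UV[THEN meas]
  define d where "d i j x = (exp (- U i x / 2) - exp (- U j x / 2))\<^sup>2 + (exp (- V i x / 2)
      - exp (- V j x / 2))\<^sup>2"
    for i j x
  have pm: "(U j, V j) \<in> C i" if "i \<le> j" for i j
    using dec UVC[of j] that by (auto simp: decseq_def)
  have nnm: "(\<lambda>x. (u x + v x) / 2) \<in> nnfun M" if "u \<in> nnfun M" "v \<in> nnfun M" for u v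
    using that by (auto simp: nnfun_def)
  have dint: "integrable N (d i j)" for i j
    unfolding d_def[abs_def] exp_half_diff_square
    by (intro Bochner_Integration.integrable_add Bochner_Integration.integrable_diff
        Bochner_Integration.integrable_mult_right int nnm UV)
  \<comment> \<open>The midpoint of the two almost minimizers lies in the larger set \<open>C i\<close>, so its value is at least \<open>I i\<close>.\<close>
  have dle: "(\<integral>x. d i j x \<partial>N) \<le> I j - I i + 2 / (real i + 1)" if "i \<le> j" for i j
  proof -
    let ?q = "((\<lambda>x. (U i x + U j x) / 2), (\<lambda>x. (V i x + V j x) / 2))"
    have "?q \<in> C i" using mid[OF UVC pm[OF that]] .
    then have "I i \<le> \<Psi> ?q" unfolding I_def by (intro cINF_lower bdd)
    moreover have "(\<integral>x. d i j x \<partial>N) = \<Psi> (p i) + \<Psi> (p j) - 2 * \<Psi> ?q"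
      unfolding d_def \<Psi>_def exp_half_diff_square
      using int[OF UV(1)] int[OF UV(2)] int[OF nnm[OF UV(1) UV(1)]] int[OF nnm[OF UV(2) UV(2)]]
      by (simp add: U_def V_def)
    moreover have "1 / (real j + 1) \<le> 1 / (real i + 1)" using that by (simp add: frac_le)
    ultimately show ?thesis using p(2)[of i] p(2)[of j] by (simp add: add_divide_distrib)
  qed
  define s where "s n x = (exp (- U n x / 2), exp (- V n x / 2))" for n x
  have sm [measurable]: "s n \<in> borel_measurable N" for n
    unfolding s_def[abs_def] by measurable
  have sint: "integrable N (s n)" for n
  proof (rule N.integrable_const_bound[of _ 2])
    have "norm (s n x) \<le> 2" for x
      using norm_Pair_le[of "exp (- U n x / 2)" "exp (- V n x / 2)"] UV[THEN nnfun_nonneg, of n x]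
      unfolding s_def by (smt (verit) exp_le_one_iff real_norm_def abs_exp_cancel divide_nonneg_pos
          minus_divide_left)
    then show "AE x in N. norm (s n x) \<le> 2" by simp
  qed simp
  \<comment> \<open>$L^2$ estimates become $L^1$ estimates, as \<open>|y| \<le> \<epsilon>/2 + y\<^sup>2/(2\<epsilon>)\<close>.\<close>
  have sle: "(\<integral>x. norm (s i x - s j x) \<partial>N) \<le> \<epsilon> * m + (\<integral>x. d i j x \<partial>N) / (2 * \<epsilon>)" if "0 < \<epsilon>" for \<epsilon> i j
  proof -
    have abs: "\<bar>y\<bar> \<le> \<epsilon> / 2 + y\<^sup>2 / (2 * \<epsilon>)" for y
    proof -
      have "0 \<le> (\<bar>y\<bar> - \<epsilon>)\<^sup>2" by simp
      then have "2 * \<bar>y\<bar> * \<epsilon> \<le> \<epsilon>\<^sup>2 + y\<^sup>2" by (simp add: power2_diff)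
      then show ?thesis using that by (simp add: field_simps power2_eq_square)
    qed
    have "norm (s i x - s j x) \<le> \<epsilon> + d i j x / (2 * \<epsilon>)" for x
    proof -
      have "norm (s i x - s j x) \<le> \<bar>exp (- U i x / 2) - exp (- U j x / 2)\<bar> + \<bar>exp (- V i x / 2)
          - exp (- V j x / 2)\<bar>"
        unfolding s_def diff_Pair using norm_Pair_le by (metis real_norm_def)
      also have "\<dots> \<le> \<epsilon> + d i j x / (2 * \<epsilon>)"
        unfolding d_def using abs[of "exp (- U i x / 2) - exp (- U j x / 2)"] abs[of "exp (- V i x
            / 2) - exp (- V j x / 2)"]
        by (simp add: add_divide_distrib)
      finally show ?thesis .
    qed
    then have "(\<integral>x. norm (s i x - s j x) \<partial>N) \<le> (\<integral>x. \<epsilon> + d i j x / (2 * \<epsilon>) \<partial>N)"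
      using sint dint by (intro integral_mono) auto
    also have "\<dots> = \<epsilon> * m + (\<integral>x. d i j x \<partial>N) / (2 * \<epsilon>)" using dint by (simp add: m_def)
    finally show ?thesis .
  qed
  have cau: "\<exists>n0. \<forall>i\<ge>n0. \<forall>j\<ge>n0. (\<integral>x. norm (s i x - s j x) \<partial>N) < e" if "0 < e" for e
  proof -
    define \<epsilon> where "\<epsilon> = e / (2 * (m + 1))"
    have \<epsilon>: "0 < \<epsilon>" "\<epsilon> * m < e / 2" using that m0 by (auto simp: \<epsilon>_def field_simps)
    have "(\<lambda>n. L - I n + 2 / (real n + 1)) \<longlonglongrightarrow> L - L + 0"
      by (intro tendsto_intros L real_tendsto_divide_at_top[OF tendsto_const]
          filterlim_tendsto_add_at_top[OF _ filterlim_real_sequentially,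
          of "\<lambda>_. 1" 1, unfolded add.commute[of 1]])
    then have "\<forall>\<^sub>F n in sequentially. L - I n + 2 / (real n + 1) < \<epsilon> * e"
      by (rule order_tendstoD) (use \<epsilon> that in auto)
    then obtain n0 where n0: "\<And>n. n \<ge> n0 \<Longrightarrow> L - I n + 2 / (real n + 1) < \<epsilon> * e"
      by (auto simp: eventually_sequentially)
    have A: "(\<integral>x. norm (s i x - s j x) \<partial>N) < e" if "n0 \<le> i" "i \<le> j" for i j
    proof -
      have "(\<integral>x. d i j x \<partial>N) < \<epsilon> * e"
        using dle[OF that(2)] n0[OF that(1)] incseq_le[OF Iinc L, of j] by linarith
      then have "(\<integral>x. d i j x \<partial>N) / (2 * \<epsilon>) < e / 2" using \<epsilon> by (simp add: field_simps)
      with sle[OF \<epsilon>(1), of i j] \<epsilon>(2) show ?thesis by linarith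
    qed
    have "(\<integral>x. norm (s i x - s j x) \<partial>N) < e" if "n0 \<le> i" "n0 \<le> j" for i j
      using A[of i j] A[of j i] that by (cases "i \<le> j") (auto simp: norm_minus_commute)
    then show ?thesis by blast
  qed
  obtain r where r: "strict_mono r" "AE x in N. Cauchy (\<lambda>i. s (r i) x)"
    by (rule cauchy_L1_AE_cauchy_subseq[OF sint cau]) (assumption, rule that)
  have rC: "(U (r j), V (r j)) \<in> C n" if "n \<le> j" for n j
    using pm[of n "r j"] strict_mono_imp_increasing[OF r(1), of j] that by simp
  have conv: "AE x in M. convergent (\<lambda>i. s (r i) x)" using r(2)
    by (simp add: AEN Cauchy_convergent_iff)
  have cU: "AE x in M. convergent (\<lambda>i. exp (- U (r i) x / 2))"
    using conv proof eventually_elim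
    case (elim x)
    then obtain l where "(\<lambda>i. s (r i) x) \<longlonglongrightarrow> l" by (auto simp: convergent_def)
    from tendsto_fst[OF this] show ?case by (auto simp: s_def convergent_def)
  qed
  have cV: "AE x in M. convergent (\<lambda>i. exp (- V (r i) x / 2))"
    using conv proof eventually_elim
    case (elim x)
    then obtain l where "(\<lambda>i. s (r i) x) \<longlonglongrightarrow> l" by (auto simp: convergent_def)
    from tendsto_snd[OF this] show ?case by (auto simp: s_def convergent_def)
  qed
  have "\<exists>u\<in>nnfun M. AE x in M. (\<lambda>n. U (r n) x) \<longlonglongrightarrow> u x"
    by (rule AE_limit_from_exp_limit[OF UV(1) \<eta> _ K(3) cU]) (rule K(1)[OF rC], simp)
  then obtain u where u: "u \<in> nnfun M" "AE x in M. (\<lambda>n. U (r n) x) \<longlonglongrightarrow> u x" by blast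
  have "\<exists>v\<in>nnfun M. AE x in M. (\<lambda>n. V (r n) x) \<longlonglongrightarrow> v x"
    by (rule AE_limit_from_exp_limit[OF UV(2) \<eta> _ K(3) cV]) (rule K(2)[OF rC], simp)
  then obtain v where v: "v \<in> nnfun M" "AE x in M. (\<lambda>n. V (r n) x) \<longlonglongrightarrow> v x" by blast
  have "(u, v) \<in> C n" for n
  proof (rule cl[of "\<lambda>j. U (r (j + n))" "\<lambda>j. V (r (j + n))"])
    show "AE x in M. (\<lambda>j. U (r (j + n)) x) \<longlonglongrightarrow> u x"
      using u(2) by eventually_elim (rule LIMSEQ_ignore_initial_segment)
    show "AE x in M. (\<lambda>j. V (r (j + n)) x) \<longlonglongrightarrow> v x"
      using v(2) by eventually_elim (rule LIMSEQ_ignore_initial_segment)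
  qed (use rC u v in auto)
  then show ?thesis by blast
qed

section \<open>The bipolar theorem\<close>

lemma ennreal_le_linear_combination:
  assumes "A \<le> c * p + d * q" "0 \<le> c" "0 \<le> d" "0 \<le> p" "0 \<le> q"
  shows "ennreal A \<le> ennreal c * ennreal p + ennreal d * ennreal q"
  using assms by (auto simp: ennreal_mult[symmetric] ennreal_plus[symmetric] simp del: ennreal_plus
      intro: ennreal_leI)

text \<open>
  For the unit ball of a Banach function space with the Fatou property, this is the
  Lorentz-Luxemburg theorem \<open>E'' = E\<close>.  If a bounded \<open>h'\<close> below \<open>h\<close> is not in \<open>B\<close>, let \<open>w\<close> be its
  nearest point in \<open>B\<close> with respect to $L^2(N)$, \<open>N\<close> a finite measure with density \<open>\<rho>\<close>; it exists by
  \<open>nested_pairs_Int_nonempty\<close>.  The variational inequality at \<open>w\<close> says that \<open>\<integral> d u dN \<le> \<integral> d w dN =: k\<close> for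
  all \<open>u\<close> in \<open>B\<close>, where \<open>d = h' - w\<close>.  So \<open>d \<rho> / k\<close> is in the polar, whereas its integral against \<open>h'\<close> is
  \<open>1 + \<integral> d\<^sup>2 dN / k > 1\<close>.
\<close>

theorem (in sigma_finite_measure) bipolar:
  assumes B: "solid_ball M B" and c: "convex_ball B" and h: "h \<in> nnfun M"
    and pol: "\<And>g. g \<in> polar M B \<Longrightarrow> (\<integral>\<^sup>+x. ennreal (h x * g x) \<partial>M) \<le> 1"
  shows "h \<in> B"
proof (rule ccontr)
  assume "h \<notin> B"
  have "\<exists>m::nat. (\<lambda>x. min (h x) (real m)) \<notin> B"
  proof (rule ccontr)
    assume "\<nexists>m::nat. (\<lambda>x. min (h x) (real m)) \<notin> B"
    then have *: "(\<lambda>x. min (h x) (real m)) \<in> B" for m :: nat by blast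
    have lim: "(\<lambda>m. min (h x) (real m)) \<longlonglongrightarrow> h x" for x
    proof (rule tendsto_eventually)
      obtain m :: nat where "h x \<le> m" using real_arch_simple by blast
      then show "\<forall>\<^sub>F m in sequentially. min (h x) (real m) = h x"
        by (intro eventually_sequentiallyI[of m]) auto
    qed
    have "h \<in> B"
      by (rule solid_ball_limit[OF B, of "\<lambda>m x. min (h x) (real m)"]) (use * h lim in auto)
    with \<open>h \<notin> B\<close> show False ..
  qed
  then obtain m :: nat where m: "(\<lambda>x. min (h x) (real m)) \<notin> B" by blast
  define h' where "h' x = min (h x) (real m)" for x
  have h': "h' \<in> nnfun M" "h' \<notin> B" and h'm: "h' x \<le> m" and h'0: "0 \<le> h' x" and h'h: "h' x \<le> h x" for x
    using m h unfolding h'_def[abs_def] by (auto simp: nnfun_def)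
  obtain N and \<rho> :: "'a \<Rightarrow> real" where "finite_measure N" and sN [measurable_cong]: "sets N = sets M"
    and \<rho> [measurable]: "\<rho> \<in> borel_measurable M" and \<rho>0: "\<And>x. 0 < \<rho> x"
    and AEN: "\<And>P. (AE x in N. P x) \<longleftrightarrow> (AE x in M. P x)"
    and intN: "\<And>f. f \<in> borel_measurable M \<Longrightarrow> (\<integral>\<^sup>+x. f x \<partial>N) = (\<integral>\<^sup>+x. ennreal (\<rho> x) * f x \<partial>M)"
    by (rule obtain_equivalent_finite_measure) (rule that)
  interpret N: finite_measure N by fact
  have Bn: "u \<in> nnfun M" if "u \<in> B" for u using solid_ball_nnfun[OF B that] .
  note [measurable] = nnfun_measurable[OF h] nnfun_measurable[OF h'(1)]
  have meas [measurable_dest]: "u \<in> borel_measurable M" if "u \<in> B" for u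
    using nnfun_measurable[OF Bn[OF that]] .
  define F where "F u = (\<integral>\<^sup>+x. ennreal ((h' x - u x)\<^sup>2) \<partial>N)" for u
  define D where "D = (INF u\<in>B. F u)"
  have DF: "D \<le> F u" if "u \<in> B" for u unfolding D_def using that by (rule INF_lower)
  have "F (\<lambda>x. 0) \<le> (\<integral>\<^sup>+x. ennreal (real m ^ 2) \<partial>N)"
    unfolding F_def by (intro nn_integral_mono ennreal_leI power_mono) (auto simp: h'm h'0)
  also have "\<dots> < \<infinity>" by (simp add: ennreal_mult_eq_top_iff less_top[symmetric] del: ennreal_power)
  finally have Dfin: "D < \<infinity>" using DF[OF solid_ball_zero[OF B]] by (rule order.strict_trans1[rotated])
  \<comment> \<open>Near minimizers of the distance; the second components are a.e. zero and carry no information.\<close>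
  define C where "C n = {(u, v). u \<in> B \<and> v \<in> nnfun M \<and> (AE x in M. v x = 0) \<and> F u
      \<le> D + ennreal (1 / (real n + 1))}" for n
  have "\<exists>u v. \<forall>n. (u, v) \<in> C n"
  proof (rule nested_pairs_Int_nonempty[where \<eta> = \<rho>
      and K = "(\<integral>\<^sup>+x. ennreal (real m + 1) \<partial>N) + (D + 1)"])
    show "C n \<subseteq> nnfun M \<times> nnfun M" for n using Bn by (auto simp: C_def)
    show "C n \<noteq> {}" for n
    proof -
      have "D + 0 < D + ennreal (1 / (real n + 1))"
        unfolding ennreal_add_left_cancel_less using Dfin by (auto simp: less_top)
      then obtain u where "u \<in> B" "F u < D + ennreal (1 / (real n + 1))"
        using INF_less_iff[of F B "D + ennreal (1 / (real n + 1))"] by (auto simp flip: D_def)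
      then have "(u, \<lambda>x. 0) \<in> C n" by (auto simp: C_def)
      then show ?thesis by blast
    qed
    show "decseq C"
    proof -
      have "D + ennreal (1 / (real j + 1)) \<le> D + ennreal (1 / (real i + 1))" if "i \<le> j" for i j
        using that by (intro add_left_mono ennreal_leI) (simp add: frac_le)
      then show ?thesis unfolding decseq_def C_def by (auto intro: order_trans)
    qed
    show "((\<lambda>x. (u x + u' x) / 2), (\<lambda>x. (v x + v' x) / 2)) \<in> C n"
      if "(u, v) \<in> C n" "(u', v') \<in> C n" for n u v u' v'
    proof -
      have u: "u \<in> B" "u' \<in> B" using that by (auto simp: C_def)
      note [measurable] = meas[OF u(1)] meas[OF u(2)]
      let ?K = "D + ennreal (1 / (real n + 1))"
      have "(\<lambda>x. (u x + u' x) / 2) \<in> B"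
        using c[unfolded convex_ball_def, rule_format, OF u, of "1/2"] by (simp add: field_simps)
      moreover have "F (\<lambda>x. (u x + u' x) / 2) \<le> ?K"
      proof -
        have "((h' x - (u x + u' x) / 2))\<^sup>2 \<le> (h' x - u x)\<^sup>2 / 2 + (h' x - u' x)\<^sup>2 / 2" for x
          using sum_squares_bound[of "h' x - u x" "h' x - u' x"]
          by (simp add: power2_eq_square field_simps)
        then have "F (\<lambda>x. (u x + u' x) / 2) \<le> (\<integral>\<^sup>+x. ennreal (1/2) * ennreal ((h' x - u x)\<^sup>2)
            + ennreal (1/2) * ennreal ((h' x - u' x)\<^sup>2) \<partial>N)"
          unfolding F_def by (intro nn_integral_mono ennreal_le_linear_combination) auto
        also have "\<dots> = ennreal (1/2) * F u + ennreal (1/2) * F u'"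
          unfolding F_def by (subst nn_integral_add) (auto simp: nn_integral_cmult)
        also have "\<dots> \<le> ennreal (1/2) * ?K + ennreal (1/2) * ?K"
          using that by (intro add_mono mult_left_mono) (auto simp: C_def)
        also have "\<dots> = (ennreal (1/2) + ennreal (1/2)) * ?K" by (simp only: distrib_right)
        also have "ennreal (1/2) + ennreal (1/2) = 1" by (subst ennreal_plus[symmetric]) (simp_all
            del: ennreal_half)
        finally show ?thesis by simp
      qed
      moreover have "(\<lambda>x. (v x + v' x) / 2) \<in> nnfun M" "AE x in M. (v x + v' x) / 2 = 0"
        using that by (auto simp: C_def nnfun_def)
      ultimately show ?thesis by (simp add: C_def)
    qed
    show "(u, v) \<in> C n" if UV: "\<And>j::nat. (U j, V j) \<in> C n" and u: "u \<in> nnfun M" and v: "v \<in> nnfun M"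
      and lim: "AE x in M. (\<lambda>j. U j x) \<longlonglongrightarrow> u x" "AE x in M. (\<lambda>j. V j x) \<longlonglongrightarrow> v x"
      for n U V u v
    proof -
      have U: "U j \<in> B" "F (U j) \<le> D + ennreal (1 / (real n + 1))" "AE x in M. V j x = 0" for j
        using UV[of j] by (auto simp: C_def)
      note [measurable] = meas[OF U(1)]
      have "AE x in M. \<forall>j. V j x = 0" using U(3) by (simp add: AE_all_countable)
      with lim(2) have "AE x in M. v x = 0"
        by eventually_elim (simp add: LIMSEQ_const_iff)
      moreover have "u \<in> B" by (rule solid_ball_limit[OF B U(1) u lim(1)])
      moreover have "F u \<le> D + ennreal (1 / (real n + 1))"
        unfolding F_def
      proof (rule nn_integral_le_of_tendsto)
        show "AE x in N. (\<lambda>j. ennreal ((h' x - U j x)\<^sup>2)) \<longlonglongrightarrow> ennreal ((h' x - u x)\<^sup>2)"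
          unfolding AEN using lim(1) by eventually_elim (intro tendsto_intros)
      qed (use U(2) in \<open>auto simp: F_def\<close>)
      ultimately show ?thesis using v by (simp add: C_def)
    qed
    show "(\<integral>\<^sup>+x. ennreal (u x * \<rho> x) \<partial>M) \<le> (\<integral>\<^sup>+x. ennreal (real m + 1) \<partial>N) + (D + 1)"
      if "(u, v) \<in> C 0" for u v
    proof -
      have u: "u \<in> B" and Fu: "F u \<le> D + 1" using that by (auto simp: C_def)
      note [measurable] = meas[OF u]
      have "(\<integral>\<^sup>+x. ennreal (u x * \<rho> x) \<partial>M) = (\<integral>\<^sup>+x. ennreal (u x) \<partial>N)"
        by (subst intN) (auto simp: ennreal_mult mult.commute less_imp_le[OF \<rho>0] nnfun_nonneg[OF
            Bn[OF u]] intro!: nn_integral_cong)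
      also have "\<dots> \<le> (\<integral>\<^sup>+x. ennreal (real m + 1) + ennreal ((h' x - u x)\<^sup>2) \<partial>N)"
      proof (intro nn_integral_mono)
        fix x
        have "0 \<le> (h' x - u x + 1/2)\<^sup>2" by simp
        then have "u x \<le> h' x + (h' x - u x)\<^sup>2 + 1" by (simp add: power2_eq_square algebra_simps)
        then show "ennreal (u x) \<le> ennreal (real m + 1) + ennreal ((h' x - u x)\<^sup>2)"
          using h'm[of x] by (subst ennreal_plus[symmetric]) (auto intro!: ennreal_leI
              simp del: ennreal_plus)
      qed
      also have "\<dots> = (\<integral>\<^sup>+x. ennreal (real m + 1) \<partial>N) + F u"
        unfolding F_def by (subst nn_integral_add) auto
      also have "\<dots> \<le> (\<integral>\<^sup>+x. ennreal (real m + 1) \<partial>N) + (D + 1)" by (intro add_left_mono Fu)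
      finally show ?thesis .
    qed
    show "(\<integral>\<^sup>+x. ennreal (v x * \<rho> x) \<partial>M) \<le> (\<integral>\<^sup>+x. ennreal (real m + 1) \<partial>N) + (D + 1)"
      if "(u, v) \<in> C 0" for u v
    proof -
      have "AE x in M. v x = 0" using that by (auto simp: C_def)
      then have "(\<integral>\<^sup>+x. ennreal (v x * \<rho> x) \<partial>M) = (\<integral>\<^sup>+x. 0 \<partial>M)"
        by (intro nn_integral_cong_AE) auto
      then show ?thesis by simp
    qed
    show "(\<integral>\<^sup>+x. ennreal (real m + 1) \<partial>N) + (D + 1) < \<infinity>"
      using Dfin by (simp add: ennreal_mult_eq_top_iff less_top[symmetric] del: ennreal_plus)
  qed (auto simp: \<rho>0)
  then obtain u0 where u0: "u0 \<in> B" "\<And>n. F u0 \<le> D + ennreal (1 / (real n + 1))"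
    by (auto simp: C_def)
  have Fu0: "F u0 \<le> D"
  proof (rule ennreal_le_epsilon)
    fix e :: real assume "0 < e"
    then obtain n where "1 / (real n + 1) < e" by (metis nat_approx_posE of_nat_Suc add.commute)
    then have "ennreal (1 / (real n + 1)) \<le> ennreal e" by (intro ennreal_leI) simp
    then show "F u0 \<le> D + ennreal e" using u0(2)[of n] by (meson add_left_mono order_trans)
  qed
  note [measurable] = meas[OF u0(1)]
  \<comment> \<open>Passing to the minimum with \<open>h'\<close> does not increase the distance and makes \<open>d\<close> nonnegative.\<close>
  define w where "w x = min (u0 x) (h' x)" for x
  have w: "w \<in> B"
    by (rule solid_ball_solid[OF B u0(1)]) (auto
        simp: w_def[abs_def] h'0 nnfun_nonneg[OF Bn[OF u0(1)]])
  note [measurable] = meas[OF w]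
  have w0: "0 \<le> w x" and wh: "w x \<le> h' x" for x
    using nnfun_nonneg[OF Bn[OF w]] by (auto simp: w_def)
  have Fw: "F w \<le> D"
  proof -
    have "F w \<le> F u0" unfolding F_def
      by (intro nn_integral_mono ennreal_leI) (auto simp: w_def min_def)
    with Fu0 show ?thesis by (rule order_trans[rotated])
  qed
  have wm: "w x \<le> m" for x using wh[of x] h'm[of x] by linarith
  define d where "d x = h' x - w x" for x
  have [measurable]: "d \<in> borel_measurable M" unfolding d_def[abs_def] by measurable
  have d0: "0 \<le> d x" and dm: "d x \<le> m" for x
    using w0[of x] wh[of x] h'm[of x] by (auto simp: d_def)
  have bint: "integrable N f" if "f \<in> borel_measurable M" "\<And>x. \<bar>f x\<bar> \<le> K" for f :: "'a \<Rightarrow> real" and K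
    using that by (intro N.integrable_const_bound[of _ K]) auto
  have var: "(\<integral>x. d x * v x \<partial>N) \<le> (\<integral>x. d x * w x \<partial>N)"
    if v: "v \<in> B" and vn: "\<And>x. v x \<le> real n" for v and n :: nat
  proof (rule ccontr)
    note [measurable] = meas[OF v]
    have v0: "0 \<le> v x" for x using nnfun_nonneg[OF Bn[OF v]] .
    define y where "y x = v x - w x" for x
    have [measurable]: "y \<in> borel_measurable M" unfolding y_def[abs_def] by measurable
    have ym: "\<bar>y x\<bar> \<le> real n + m" for x
      using v0[of x] vn[of x] w0[of x] wh[of x] h'm[of x] by (auto simp: y_def)
    have i1: "integrable N (\<lambda>x. d x * y x)"
      by (rule bint[of _ "m * (real n + m)"]) (use d0 dm ym in \<open>auto simp: abs_mult
          intro!: mult_mono\<close>)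
    have i2: "integrable N (\<lambda>x. (y x)\<^sup>2)"
      by (rule bint[of _ "(real n + m)\<^sup>2"]) (use ym in \<open>auto simp: abs_le_square_iff[symmetric]\<close>)
    have i3: "integrable N (\<lambda>x. (d x)\<^sup>2)"
      by (rule bint[of _ "(real m)\<^sup>2"]) (use dm d0 in \<open>auto simp: abs_le_square_iff[symmetric]\<close>)
    have i4: "integrable N (\<lambda>x. d x * v x)" "integrable N (\<lambda>x. d x * w x)"
      by (rule bint[of _ "m * real n"], use d0 dm v0 vn in \<open>auto simp: abs_mult intro!: mult_mono\<close>)
         (rule bint[of _ "m * real m"], use d0 dm w0 wm in \<open>auto simp: abs_mult intro!: mult_mono\<close>)
    define X where "X = (\<integral>x. d x * y x \<partial>N)"
    define Q where "Q = (\<integral>x. (y x)\<^sup>2 \<partial>N)"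
    have Q0: "0 \<le> Q" unfolding Q_def by (intro integral_nonneg_AE) auto
    assume "\<not> (\<integral>x. d x * v x \<partial>N) \<le> (\<integral>x. d x * w x \<partial>N)"
    then have X0: "0 < X" unfolding X_def y_def using i4 by (simp add: right_diff_distrib)
    \<comment> \<open>Moving from \<open>w\<close> towards \<open>v\<close> by the fraction \<open>l\<close> does not decrease the distance to \<open>h'\<close>.\<close>
    have key: "2 * X \<le> l * Q" if l: "0 < l" "l \<le> 1" for l
    proof -
      have "(\<lambda>x. l * v x + (1 - l) * w x) \<in> B"
        using c v w l unfolding convex_ball_def by auto
      from order_trans[OF Fw DF[OF this]] have "F w \<le> F (\<lambda>x. l * v x + (1 - l) * w x)" .
      moreover have "F w = ennreal (\<integral>x. (d x)\<^sup>2 \<partial>N)"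
        unfolding F_def d_def[symmetric] by (rule nn_integral_eq_integral) (use i3 in auto)
      moreover have "F (\<lambda>x. l * v x + (1 - l) * w x) = ennreal (\<integral>x. (d x)\<^sup>2 - 2 * l * (d x * y x)
          + l\<^sup>2 * (y x)\<^sup>2 \<partial>N)"
      proof -
        have e: "(h' x - (l * v x + (1 - l) * w x))\<^sup>2 = (d x)\<^sup>2 - 2 * l * (d x * y x) + l\<^sup>2
            * (y x)\<^sup>2" for x
          by (simp add: d_def y_def power2_eq_square algebra_simps)
        have "0 \<le> (d x)\<^sup>2 - 2 * l * (d x * y x) + l\<^sup>2 * (y x)\<^sup>2" for x
          unfolding e[symmetric] by simp
        then show ?thesis
          unfolding F_def e using i1 i2 i3 by (intro nn_integral_eq_integral) auto
      qed
      moreover have "(\<integral>x. (d x)\<^sup>2 - 2 * l * (d x * y x) + l\<^sup>2 * (y x)\<^sup>2 \<partial>N) = (\<integral>x. (d x)\<^sup>2 \<partial>N) - 2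
          * l * X + l\<^sup>2 * Q"
        using i1 i2 i3 by (simp add: X_def Q_def)
      ultimately have "ennreal (\<integral>x. (d x)\<^sup>2 \<partial>N) \<le> ennreal ((\<integral>x. (d x)\<^sup>2 \<partial>N) - 2 * l * X + l\<^sup>2 * Q)"
        by simp
      moreover have "0 \<le> (\<integral>x. (d x)\<^sup>2 \<partial>N) - 2 * l * X + l\<^sup>2 * Q"
      proof -
        have e: "(d x)\<^sup>2 - 2 * l * (d x * y x) + l\<^sup>2 * (y x)\<^sup>2 = (d x - l * y x)\<^sup>2" for x
          by (simp add: power2_eq_square algebra_simps)
        have "0 \<le> (\<integral>x. (d x)\<^sup>2 - 2 * l * (d x * y x) + l\<^sup>2 * (y x)\<^sup>2 \<partial>N)" unfolding e by simp
        then show ?thesis using i1 i2 i3 by (simp add: X_def Q_def)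
      qed
      ultimately have "2 * l * X \<le> l\<^sup>2 * Q" by simp
      then show ?thesis using l by (simp add: power2_eq_square)
    qed
    \<comment> \<open>For this \<open>l\<close> the linear term \<open>2 X\<close> beats the quadratic one.\<close>
    define l where "l = min 1 (X / (Q + 1))"
    have l: "0 < l" "l \<le> 1" "l * (Q + 1) \<le> X"
      using X0 Q0 by (auto simp: l_def pos_le_divide_eq[symmetric] simp del: distrib_left_numeral)
    have "l * Q \<le> X" using l Q0 by (simp add: distrib_left)
    with key[OF l(1,2)] X0 show False by linarith
  qed
  define g where "g x = d x * \<rho> x" for x
  have [measurable]: "g \<in> borel_measurable M" unfolding g_def[abs_def] by measurable
  have g0: "0 \<le> g x" for x using d0[of x] \<rho>0[of x] by (simp add: g_def)
  have nng: "(\<integral>\<^sup>+x. ennreal (v x * g x) \<partial>M) = (\<integral>\<^sup>+x. ennreal (d x * v x) \<partial>N)" if "v \<in> nnfun M" for v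
    using that[THEN nnfun_measurable] nnfun_nonneg[OF that] d0 less_imp_le[OF \<rho>0]
    by (subst intN) (auto simp: g_def ennreal_mult ac_simps intro!: nn_integral_cong)
  define k where "k = (\<integral>x. d x * w x \<partial>N)"
  have iw: "integrable N (\<lambda>x. d x * w x)" and id: "integrable N (\<lambda>x. (d x)\<^sup>2)"
    by (rule bint[of _ "m * real m"], use d0 dm w0 wm in \<open>auto simp: abs_mult intro!: mult_mono\<close>)
       (rule bint[of _ "(real m)\<^sup>2"], use dm d0 in \<open>auto simp: abs_le_square_iff[symmetric]\<close>)
  have k0: "0 \<le> k" unfolding k_def by (intro integral_nonneg_AE) (auto simp: d0 w0)
  have ug: "(\<integral>\<^sup>+x. ennreal (u x * g x) \<partial>M) \<le> ennreal k" if u: "u \<in> B" for u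
  proof -
    note [measurable] = meas[OF u]
    have u0: "0 \<le> u x" for x using nnfun_nonneg[OF Bn[OF u]] .
    have "(\<integral>\<^sup>+x. ennreal (d x * u x) \<partial>N) \<le> ennreal k"
    proof (rule nn_integral_le_of_tendsto[where f = "\<lambda>n x. ennreal (d x * min (u x) (real n))"])
      show "AE x in N. (\<lambda>n. ennreal (d x * min (u x) (real n))) \<longlonglongrightarrow> ennreal (d x * u x)"
      proof (rule AE_I2, rule tendsto_eventually)
        fix x obtain j :: nat where "u x \<le> j" using real_arch_simple by blast
        then show "\<forall>\<^sub>F n in sequentially. ennreal (d x * min (u x) (real n)) = ennreal (d x * u x)"
          by (intro eventually_sequentiallyI[of j]) auto
      qed
      fix n :: nat
      have mB: "(\<lambda>x. min (u x) (real n)) \<in> B"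
        by (rule solid_ball_solid[OF B u]) (auto simp: u0)
      have "integrable N (\<lambda>x. d x * min (u x) (real n))"
        by (rule bint[of _ "m * real n"]) (use d0 dm u0 in \<open>auto simp: abs_mult intro!: mult_mono\<close>)
      then have "(\<integral>\<^sup>+x. ennreal (d x * min (u x) (real n)) \<partial>N)
          = ennreal (\<integral>x. d x * min (u x) (real n) \<partial>N)"
        by (rule nn_integral_eq_integral) (auto simp: d0 u0)
      also have "\<dots> \<le> ennreal k" unfolding k_def by (intro ennreal_leI var[OF mB, where n = n]) simp
      finally show "(\<integral>\<^sup>+x. ennreal (d x * min (u x) (real n)) \<partial>N) \<le> ennreal k" .
    qed simp
    then show ?thesis using nng[OF Bn[OF u]] by simp
  qed
  have dn0: "\<not> (AE x in M. d x = 0)"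
  proof
    assume "AE x in M. d x = 0"
    then have "h' \<in> B" by (intro solid_ball_solid[OF B w h'(1)]) (auto simp: d_def)
    with h'(2) show False ..
  qed
  define A where "A = {x \<in> space M. d x \<noteq> 0}"
  have A [measurable]: "A \<in> sets M" unfolding A_def by measurable
  have "emeasure M A \<noteq> 0" using dn0 unfolding A_def
    by (subst AE_iff_measurable[symmetric, OF _ refl]) auto
  then obtain u where u: "u \<in> B" "\<not> (AE x in M. x \<in> A \<longrightarrow> u x = 0)"
    using solid_ball_saturated[OF B A] by (auto simp: zero_less_iff_neq_zero)
  \<comment> \<open>Otherwise every member of the ball vanishes where \<open>d > 0\<close>, against saturation.\<close>
  have "k \<noteq> 0"
  proof
    assume "k = 0"
    with ug[OF u(1)] have "(\<integral>\<^sup>+x. ennreal (u x * g x) \<partial>M) = 0" by simp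
    then have "AE x in M. u x * g x \<le> 0"
      using meas[OF u(1)] by (subst (asm) nn_integral_0_iff_AE) (auto simp: ennreal_eq_0_iff)
    then have "AE x in M. x \<in> A \<longrightarrow> u x = 0"
    proof eventually_elim
      case (elim x)
      then show ?case
        using nnfun_nonneg[OF Bn[OF u(1)], of x] \<rho>0[of x] d0[of x]
        by (auto simp: A_def g_def mult_le_0_iff)
    qed
    with u(2) show False ..
  qed
  with k0 have k: "0 < k" by simp
  have "(\<lambda>x. g x / k) \<in> polar M B"
  proof -
    have "(\<integral>\<^sup>+x. ennreal (u x * (g x / k)) \<partial>M) \<le> 1" if u: "u \<in> B" for u
    proof -
      note [measurable] = meas[OF u]
      have "(\<integral>\<^sup>+x. ennreal (u x * (g x / k)) \<partial>M) = (\<integral>\<^sup>+x. ennreal (1 / k) * ennreal (u x * g x) \<partial>M)"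
        using k by (intro nn_integral_cong) (auto simp: ennreal_mult''[symmetric]
            ennreal_mult'[symmetric])
      also have "\<dots> = ennreal (1 / k) * (\<integral>\<^sup>+x. ennreal (u x * g x) \<partial>M)"
        by (simp add: nn_integral_cmult)
      also have "\<dots> \<le> ennreal (1 / k) * ennreal k" by (intro mult_left_mono ug u) simp
      also have "\<dots> = 1" using k by (simp flip: ennreal_mult)
      finally show ?thesis .
    qed
    then show ?thesis using k g0 by (auto simp: polar_def)
  qed
  from pol[OF this] have le1: "(\<integral>\<^sup>+x. ennreal (h x * (g x / k)) \<partial>M) \<le> 1" .
  have "(\<integral>\<^sup>+x. ennreal (h' x * g x) \<partial>M) \<le> (\<integral>\<^sup>+x. ennreal k * ennreal (h x * (g x / k)) \<partial>M)"
    using k g0 h'h by (intro nn_integral_mono) (auto simp: ennreal_mult'[symmetric]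
        intro!: ennreal_leI mult_right_mono)
  also have "\<dots> = ennreal k * (\<integral>\<^sup>+x. ennreal (h x * (g x / k)) \<partial>M)" by (simp add: nn_integral_cmult)
  also have "\<dots> \<le> ennreal k" using le1 mult_left_mono[OF le1, of "ennreal k"] by simp
  finally have up: "(\<integral>\<^sup>+x. ennreal (h' x * g x) \<partial>M) \<le> ennreal k" .
  have "(\<integral>\<^sup>+x. ennreal (h' x * g x) \<partial>M) = (\<integral>\<^sup>+x. ennreal ((d x)\<^sup>2 + d x * w x) \<partial>N)"
    unfolding nng[OF h'(1)] by (intro nn_integral_cong) (simp add: d_def power2_eq_square
        algebra_simps)
  also have "\<dots> = ennreal ((\<integral>x. (d x)\<^sup>2 \<partial>N) + k)"
    using iw id d0 w0 by (subst nn_integral_eq_integral) (auto simp: k_def)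
  finally have "(\<integral>x. (d x)\<^sup>2 \<partial>N) \<le> 0" using up k0 by (simp add: ennreal_le_iff)
  moreover have "0 \<le> (\<integral>x. (d x)\<^sup>2 \<partial>N)" by simp
  ultimately have "(\<integral>x. (d x)\<^sup>2 \<partial>N) = 0" by linarith
  then have "AE x in N. (d x)\<^sup>2 = 0" using id by (subst (asm) integral_nonneg_eq_0_iff_AE) auto
  then show False using dn0 by (simp add: AEN)
qed

section \<open>Weak units, polars and powers\<close>

text \<open>
  Exhaustion: a dyadic sum of members whose positivity sets nearly maximize a finite measure has a
  positivity set of maximal measure, and by saturation the complement of that set is null.
\<close>

lemma (in sigma_finite_measure) weak_unit_exists:
  assumes B: "solid_ball M B" and c: "convex_ball B"
  shows "\<exists>e\<in>B. AE x in M. 0 < e x"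
proof -
  obtain N and \<rho> :: "'a \<Rightarrow> real" where "finite_measure N" and sN [measurable_cong]: "sets N = sets M"
    and AEN: "\<And>P. (AE x in N. P x) \<longleftrightarrow> (AE x in M. P x)"
    by (rule obtain_equivalent_finite_measure) (rule that)
  interpret N: finite_measure N by fact
  have spN: "space N = space M" using sN by (rule sets_eq_imp_space_eq)
  have Bn: "u \<in> nnfun M" if "u \<in> B" for u using solid_ball_nnfun[OF B that] .
  have meas [measurable_dest]: "u \<in> borel_measurable M" if "u \<in> B" for u
    using nnfun_measurable[OF Bn[OF that]] .
  define \<mu> where "\<mu> u = measure N {x \<in> space M. 0 < u x}" for u :: "'a \<Rightarrow> real"
  have bdd: "bdd_above (\<mu> ` B)"
    by (rule bdd_aboveI2[of _ _ "measure N (space N)"]) (simp add: \<mu>_def N.bounded_measure)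
  define s where "s = (SUP u\<in>B. \<mu> u)"
  have neB: "B \<noteq> {}" using solid_ball_zero[OF B] by blast
  have "\<exists>u\<in>B. s - 1 / (real n + 1) < \<mu> u" for n
    using less_cSUP_iff[OF neB bdd, of "s - 1 / (real n + 1)"] by (simp add: s_def)
  then have "\<forall>n. \<exists>u. u \<in> B \<and> s - 1 / (real n + 1) < \<mu> u" by blast
  from choice[OF this] obtain U where U: "\<And>n. U n \<in> B" "\<And>n. s - 1 / (real n + 1) < \<mu> (U n)" by blast
  obtain e where e: "e \<in> B" "AE x in M. (\<lambda>k. U k x / 2 ^ Suc k) sums e x"
    using dyadic_sum_mem[OF B c, of U] U(1) by blast
  note [measurable] = meas[OF e(1)] meas[OF U(1)]
  have "s - 1 / (real n + 1) < \<mu> e" for n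
  proof -
    have "AE x in M. 0 < U n x \<longrightarrow> 0 < e x"
      using e(2)
    proof eventually_elim
      case (elim x)
      have "U n x / 2 ^ Suc n \<le> (\<Sum>k. U k x / 2 ^ Suc k)"
        using elim sum_le_suminf[of "\<lambda>k. U k x / 2 ^ Suc k" "{n}"] nnfun_nonneg[OF Bn[OF U(1)]]
        by (auto simp: sums_iff)
      then have "U n x / 2 ^ Suc n \<le> e x" using elim by (simp add: sums_iff)
      then show ?case by (smt (verit) divide_pos_pos zero_less_power)
    qed
    then have "AE x in N. x \<in> {x \<in> space M. 0 < U n x} \<longrightarrow> x \<in> {x \<in> space M. 0 < e x}"
      unfolding AEN by eventually_elim auto
    then have "\<mu> (U n) \<le> \<mu> e" unfolding \<mu>_def by (intro N.finite_measure_mono_AE) auto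
    with U(2)[of n] show ?thesis by linarith
  qed
  note * = this
  have "s \<le> \<mu> e"
  proof (rule field_le_epsilon)
    fix \<epsilon> :: real assume "0 < \<epsilon>"
    obtain n where "1 / (real n + 1) < \<epsilon>" using \<open>0 < \<epsilon>\<close>
      by (metis nat_approx_posE of_nat_Suc add.commute)
    with *[of n] show "s \<le> \<mu> e + \<epsilon>" by linarith
  qed
  have "AE x in M. 0 < e x"
  proof (rule ccontr)
    assume nAE: "\<not> (AE x in M. 0 < e x)"
    define A where "A = {x \<in> space M. \<not> 0 < e x}"
    have A [measurable]: "A \<in> sets M" unfolding A_def by measurable
    have "emeasure M A \<noteq> 0" using nAE unfolding A_def
      by (subst AE_iff_measurable[symmetric, OF _ refl]) auto
    then obtain u where u: "u \<in> B" "\<not> (AE x in M. x \<in> A \<longrightarrow> u x = 0)"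
      using solid_ball_saturated[OF B A] by (auto simp: zero_less_iff_neq_zero)
    note [measurable] = meas[OF u(1)]
    define v where "v x = 1/2 * e x + (1 - 1/2) * u x" for x
    have v: "v \<in> B" unfolding v_def[abs_def]
      by (rule c[unfolded convex_ball_def, rule_format, OF e(1) u(1)]) auto
    note [measurable] = meas[OF v]
    have vpos: "0 < v x \<longleftrightarrow> 0 < e x \<or> 0 < u x" for x
      using nnfun_nonneg[OF Bn[OF e(1)], of x] nnfun_nonneg[OF Bn[OF u(1)], of x]
      by (auto simp: v_def)
    have "measure N {x \<in> space M. x \<in> A \<and> 0 < u x} \<noteq> 0"
    proof
      assume "measure N {x \<in> space M. x \<in> A \<and> 0 < u x} = 0"
      then have "emeasure N {x \<in> space N. \<not> (x \<in> A \<longrightarrow> u x \<le> 0)} = 0"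
        by (simp add: N.emeasure_eq_measure spN not_le)
      then have "AE x in N. x \<in> A \<longrightarrow> u x \<le> 0"
        by (subst AE_iff_measurable[OF _ refl]) auto
      then have "AE x in M. x \<in> A \<longrightarrow> u x = 0"
        unfolding AEN by eventually_elim (auto intro: antisym nnfun_nonneg[OF Bn[OF u(1)]])
      with u(2) show False ..
    qed
    then have pos: "0 < measure N {x \<in> space M. x \<in> A \<and> 0 < u x}"
      using measure_nonneg[of N "{x \<in> space M. x \<in> A \<and> 0 < u x}"] by linarith
    have "\<mu> v = measure N ({x \<in> space M. 0 < e x} \<union> {x \<in> space M. x \<in> A \<and> 0 < u x})"
      unfolding \<mu>_def vpos by (intro arg_cong[where f = "measure N"]) (auto simp: A_def)
    also have "\<dots> = \<mu> e + measure N {x \<in> space M. x \<in> A \<and> 0 < u x}"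
      unfolding \<mu>_def by (intro N.finite_measure_Union) (auto simp: A_def)
    finally have "s < \<mu> v" using pos \<open>s \<le> \<mu> e\<close> by linarith
    moreover have "\<mu> v \<le> s" unfolding s_def by (intro cSUP_upper v bdd)
    ultimately show False by linarith
  qed
  with e(1) show ?thesis by blast
qed

text \<open>
  With \<open>h\<close> a convex combination of \<open>f\<close> and \<open>g\<close> this yields convexity of polars, and with \<open>h\<close> a weighted
  geometric mean it yields Hoelder's inequality.
\<close>

lemma nn_integral_convex_combination_le:
  fixes f g :: "'a \<Rightarrow> real"
  assumes [measurable]: "f \<in> borel_measurable M" "g \<in> borel_measurable M"
    and nn: "\<And>x. 0 \<le> f x" "\<And>x. 0 \<le> g x" "0 \<le> c" "0 \<le> d" "c + d \<le> 1"
    and le: "(\<integral>\<^sup>+x. ennreal (f x) \<partial>M) \<le> 1" "(\<integral>\<^sup>+x. ennreal (g x) \<partial>M) \<le> 1"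
    and h: "AE x in M. h x \<le> c * f x + d * g x"
  shows "(\<integral>\<^sup>+x. ennreal (h x) \<partial>M) \<le> 1"
proof -
  have "(\<integral>\<^sup>+x. ennreal (h x) \<partial>M) \<le> (\<integral>\<^sup>+x. ennreal c * ennreal (f x) + ennreal d * ennreal (g x) \<partial>M)"
    by (rule nn_integral_mono_AE) (use h in \<open>eventually_elim, auto
        intro!: ennreal_le_linear_combination nn\<close>)
  also have "\<dots> = ennreal c * (\<integral>\<^sup>+x. ennreal (f x) \<partial>M) + ennreal d * (\<integral>\<^sup>+x. ennreal (g x) \<partial>M)"
    by (subst nn_integral_add) (auto simp: nn_integral_cmult)
  also have "\<dots> \<le> ennreal c * 1 + ennreal d * 1" by (intro add_mono mult_left_mono le) auto
  also have "\<dots> = ennreal (c + d)" using nn by simp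
  also have "\<dots> \<le> 1" using nn by (simp add: ennreal_le_1 del: ennreal_plus)
  finally show ?thesis .
qed

lemma polar_convex:
  assumes B: "B \<subseteq> nnfun M"
  shows "convex_ball (polar M B)"
  unfolding convex_ball_def
proof (intro ballI allI impI)
  fix g g' and c :: real assume g: "g \<in> polar M B" "g' \<in> polar M B" and c: "0 \<le> c" "c \<le> 1"
  have gn: "g \<in> nnfun M" "g' \<in> nnfun M" using g by (auto simp: polar_nnfun)
  note [measurable] = gn[THEN nnfun_measurable]
  have "(\<integral>\<^sup>+x. ennreal (u x * (c * g x + (1 - c) * g' x)) \<partial>M) \<le> 1" if u: "u \<in> B" for u
  proof (rule nn_integral_convex_combination_le)
    have un: "u \<in> nnfun M" using u B by auto
    note [measurable] = nnfun_measurable[OF un]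
    show "(\<lambda>x. u x * g x) \<in> borel_measurable M" "(\<lambda>x. u x * g' x) \<in> borel_measurable M" by measurable
    show "0 \<le> u x * g x" "0 \<le> u x * g' x" for x
      using nnfun_nonneg[OF un] nnfun_nonneg[OF gn(1)] nnfun_nonneg[OF gn(2)] by auto
    show "AE x in M. u x * (c * g x + (1 - c) * g' x) \<le> c * (u x * g x) + (1 - c) * (u x * g' x)"
      by (simp add: algebra_simps)
  qed (use c polarD[OF g(1) u] polarD[OF g(2) u] in auto)
  then show "(\<lambda>x. c * g x + (1 - c) * g' x) \<in> polar M B"
    using gn c nnfun_nonneg[OF gn(1)] nnfun_nonneg[OF gn(2)] by (auto simp: polar_def intro!: nnfunI)
qed

lemma AE_zero_from_integral:
  assumes [measurable]: "e \<in> borel_measurable M" "u \<in> borel_measurable M"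
    and e: "AE x in M. 0 < e x" and u: "\<And>x. 0 \<le> u x"
    and le: "\<And>n::nat. (\<integral>\<^sup>+x. ennreal (real n * (u x * e x)) \<partial>M) \<le> 1"
  shows "AE x in M. u x = (0::real)"
proof -
  let ?I = "\<integral>\<^sup>+x. ennreal (u x * e x) \<partial>M"
  have n: "of_nat n * ?I \<le> 1" for n :: nat
  proof -
    have "of_nat n * ?I = (\<integral>\<^sup>+x. of_nat n * ennreal (u x * e x) \<partial>M)" by (simp add: nn_integral_cmult)
    also have "\<dots> = (\<integral>\<^sup>+x. ennreal (real n * (u x * e x)) \<partial>M)"
      by (rule nn_integral_cong_AE) (use e in \<open>eventually_elim, auto
          simp: ennreal_mult u ennreal_of_nat_eq_real_of_nat\<close>)
    finally show ?thesis using le[of n] by simp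
  qed
  have "?I = 0"
  proof (rule ccontr)
    assume "?I \<noteq> 0"
    moreover have "?I \<noteq> \<infinity>" using n[of 1] by (auto simp: top_unique)
    ultimately obtain r where r: "?I = ennreal r" "0 < r"
      by (metis ennreal_cases ennreal_0 infinity_ennreal_def less_eq_real_def)
    obtain n :: nat where "1 / r < n" using reals_Archimedean2 by blast
    then have "1 < real n * r" using r by (simp add: field_simps)
    moreover have "ennreal (real n * r) \<le> 1"
      using n[of n] r by (simp add: ennreal_mult ennreal_of_nat_eq_real_of_nat)
    ultimately show False by (simp add: ennreal_le_1)
  qed
  then have "AE x in M. u x * e x \<le> 0" by (subst (asm) nn_integral_0_iff_AE) (auto
      simp: ennreal_eq_0_iff)
  with e show ?thesis by eventually_elim (use u in \<open>auto simp: mult_le_0_iff intro: antisym\<close>)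
qed

text \<open>
  Saturation rests on the bipolar theorem: if all of the polar vanishes on \<open>A\<close>, then
  every multiple of \<open>u 1\<^sub>A\<close>, \<open>u\<close> in \<open>B\<close>, is in \<open>B\<close>, hence \<open>u 1\<^sub>A = 0\<close>, and \<open>B\<close> is not saturated
  unless \<open>A\<close> is null.
\<close>

lemma (in sigma_finite_measure) polar_solid_ball:
  assumes B: "solid_ball M B" and c: "convex_ball B"
  shows "solid_ball M (polar M B)"
  unfolding solid_ball_def
proof (intro conjI ballI allI impI)
  have Bn: "u \<in> nnfun M" if "u \<in> B" for u using solid_ball_nnfun[OF B that] .
  have meas [measurable_dest]: "u \<in> borel_measurable M" if "u \<in> B" for u
    using nnfun_measurable[OF Bn[OF that]] .
  show "polar M B \<subseteq> nnfun M" by (auto simp: polar_def)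
  show "(\<lambda>x. 0) \<in> polar M B" by (auto simp: polar_def)
  show "v \<in> polar M B" if g: "g \<in> polar M B" and v: "v \<in> nnfun M" and vg: "AE x in M. v x \<le> g x"
    for g v
  proof -
    have "(\<integral>\<^sup>+x. ennreal (u x * v x) \<partial>M) \<le> 1" if u: "u \<in> B" for u
    proof -
      have "(\<integral>\<^sup>+x. ennreal (u x * v x) \<partial>M) \<le> (\<integral>\<^sup>+x. ennreal (u x * g x) \<partial>M)"
        by (rule nn_integral_mono_AE) (use vg in \<open>eventually_elim, auto
            intro!: ennreal_leI mult_left_mono nnfun_nonneg[OF Bn[OF u]]\<close>)
      also have "\<dots> \<le> 1" by (rule polarD[OF g u])
      finally show ?thesis .
    qed
    with v show ?thesis by (auto simp: polar_def)
  qed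
  show "v \<in> polar M B"
    if v: "v \<in> nnfun M" and *: "(\<forall>n. U n \<in> polar M B) \<and> (AE x in M. incseq (\<lambda>n. U n x)
        \<and> (\<lambda>n. U n x) \<longlonglongrightarrow> v x)" for U v
  proof -
    have U: "U n \<in> polar M B" for n using * by blast
    note [measurable] = nnfun_measurable[OF polar_nnfun[OF U]]
    have "(\<integral>\<^sup>+x. ennreal (u x * v x) \<partial>M) \<le> 1" if u: "u \<in> B" for u
    proof (rule nn_integral_le_of_tendsto)
      show "AE x in M. (\<lambda>n. ennreal (u x * U n x)) \<longlonglongrightarrow> ennreal (u x * v x)"
        using *[THEN conjunct2] by eventually_elim (intro tendsto_intros, auto)
      show "(\<integral>\<^sup>+x. ennreal (u x * U n x) \<partial>M) \<le> 1" for n by (rule polarD[OF U u])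
      show "(\<lambda>x. ennreal (u x * U n x)) \<in> borel_measurable M" for n
        using meas[OF u] by measurable
    qed
    with v show ?thesis by (auto simp: polar_def)
  qed
  show "\<exists>g\<in>polar M B. \<not> (AE x in M. x \<in> A \<longrightarrow> g x = 0)" if A [measurable]: "A \<in> sets M" and A0: "0
      < emeasure M A" for A
  proof (rule ccontr)
    assume "\<not> (\<exists>g\<in>polar M B. \<not> (AE x in M. x \<in> A \<longrightarrow> g x = 0))"
    then have z: "AE x in M. x \<in> A \<longrightarrow> g x = 0" if "g \<in> polar M B" for g using that by blast
    obtain u where u: "u \<in> B" "\<not> (AE x in M. x \<in> A \<longrightarrow> u x = 0)"
      using solid_ball_saturated[OF B A A0] by blast
    note [measurable] = meas[OF u(1)]
    have un: "0 \<le> u x" for x using nnfun_nonneg[OF Bn[OF u(1)]] .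
    have "(\<lambda>x. real n * (u x * indicator A x)) \<in> B" for n
    proof (rule bipolar[OF B c])
      show "(\<lambda>x. real n * (u x * indicator A x)) \<in> nnfun M" by (rule nnfunI) (auto simp: un)
      fix g assume g: "g \<in> polar M B"
      have "(\<integral>\<^sup>+x. ennreal (real n * (u x * indicator A x) * g x) \<partial>M) = (\<integral>\<^sup>+x. 0 \<partial>M)"
        by (rule nn_integral_cong_AE) (use z[OF g] in \<open>eventually_elim, auto simp: indicator_def\<close>)
      then show "(\<integral>\<^sup>+x. ennreal (real n * (u x * indicator A x) * g x) \<partial>M) \<le> 1" by simp
    qed
    then have "AE x in M. u x * indicator A x = 0"
      by (intro solid_ball_bounded[OF B]) (auto simp: un)
    then have "AE x in M. x \<in> A \<longrightarrow> u x = 0" by eventually_elim (auto simp: indicator_def)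
    with u(2) show False ..
  qed
  show "AE x in M. g x = 0" if g: "g \<in> nnfun M" and n: "\<forall>n::nat. (\<lambda>x. real n * g x) \<in> polar M B" for g
  proof -
    obtain e where e: "e \<in> B" "AE x in M. 0 < e x" using weak_unit_exists[OF B c] by blast
    show ?thesis
    proof (rule AE_zero_from_integral[of e])
      show "(\<integral>\<^sup>+x. ennreal (real n * (g x * e x)) \<partial>M) \<le> 1" for n
        using polarD[OF n[rule_format, of n] e(1)] by (simp add: ac_simps)
    qed (use e meas nnfun_measurable[OF g] nnfun_nonneg[OF g] in auto)
  qed
qed

lemma power_ball_solid:
  assumes B: "solid_ball M B" and p: "0 < p"
  shows "solid_ball M (power_ball M p B)"
  unfolding solid_ball_def
proof (intro conjI ballI allI impI)
  have Bn: "u \<in> nnfun M" if "u \<in> B" for u using solid_ball_nnfun[OF B that] .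
  show "power_ball M p B \<subseteq> nnfun M" by (auto simp: power_ball_def)
  show "(\<lambda>x. 0) \<in> power_ball M p B" using solid_ball_zero[OF B] by (auto simp: power_ball_def)
  show "v \<in> power_ball M p B"
    if u: "u \<in> power_ball M p B" and v: "v \<in> nnfun M" and vu: "AE x in M. v x \<le> u x" for u v
  proof -
    have "(\<lambda>x. v x powr (1 / p)) \<in> B"
    proof (rule solid_ball_solid[OF B])
      show "(\<lambda>x. u x powr (1 / p)) \<in> B" using u by (auto simp: power_ball_def)
      show "(\<lambda>x. v x powr (1 / p)) \<in> nnfun M" using v by (auto simp: nnfun_def)
      show "AE x in M. v x powr (1 / p) \<le> u x powr (1 / p)"
        using vu by eventually_elim (use p nnfun_nonneg[OF v] in \<open>auto intro: powr_mono2\<close>)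
    qed
    with v show ?thesis by (auto simp: power_ball_def)
  qed
  show "v \<in> power_ball M p B"
    if v: "v \<in> nnfun M" and *: "(\<forall>n. U n \<in> power_ball M p B) \<and> (AE x in M. incseq (\<lambda>n. U n x)
        \<and> (\<lambda>n. U n x) \<longlonglongrightarrow> v x)" for U v
  proof -
    have U: "U n \<in> nnfun M" "(\<lambda>x. U n x powr (1 / p)) \<in> B" for n using *
      by (auto simp: power_ball_def)
    have "(\<lambda>x. v x powr (1 / p)) \<in> B"
    proof (rule solid_ball_limit[OF B U(2)])
      show "(\<lambda>x. v x powr (1 / p)) \<in> nnfun M" using v by (auto simp: nnfun_def)
      show "AE x in M. (\<lambda>n. U n x powr (1 / p)) \<longlonglongrightarrow> v x powr (1 / p)"
        using *[THEN conjunct2] by eventually_elim (use p nnfun_nonneg[OF U(1)] in \<open>auto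
            intro!: tendsto_powr'\<close>)
    qed
    with v show ?thesis by (auto simp: power_ball_def)
  qed
  show "\<exists>g\<in>power_ball M p B. \<not> (AE x in M. x \<in> A \<longrightarrow> g x = 0)" if A: "A \<in> sets M" and A0: "0
      < emeasure M A" for A
  proof -
    obtain u where u: "u \<in> B" "\<not> (AE x in M. x \<in> A \<longrightarrow> u x = 0)"
      using solid_ball_saturated[OF B A A0] by blast
    have "(\<lambda>x. u x powr p) \<in> power_ball M p B"
      using Bn[OF u(1)] u(1) p nnfun_nonneg[OF Bn[OF u(1)]]
      by (auto simp: power_ball_def powr_powr nnfun_def)
    with u(2) show ?thesis by (intro bexI[of _ "\<lambda>x. u x powr p"]) auto
  qed
  show "AE x in M. u x = 0" if u: "u \<in> nnfun M" and n: "\<forall>n::nat. (\<lambda>x. real n * u x)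
      \<in> power_ball M p B" for u
  proof -
    have "AE x in M. u x powr (1 / p) = 0"
    proof (rule solid_ball_bounded[OF B])
      show un: "(\<lambda>x. u x powr (1 / p)) \<in> nnfun M" using u by (auto simp: nnfun_def)
      fix k :: nat
      \<comment> \<open>Multiples by \<open>k\<close> after taking powers come from multiples by \<open>n \<ge> k\<^sup>p\<close> before.\<close>
      obtain n where n': "real k powr p \<le> real n" using real_arch_simple by blast
      have k: "real k \<le> real n powr (1 / p)"
        using powr_mono2[OF _ _ n', of "1/p"] p by (simp add: powr_powr)
      show "(\<lambda>x. real k * u x powr (1 / p)) \<in> B"
      proof (rule solid_ball_solid[OF B])
        show "(\<lambda>x. (real n * u x) powr (1 / p)) \<in> B" using n by (auto simp: power_ball_def)
        show "(\<lambda>x. real k * u x powr (1 / p)) \<in> nnfun M" using un by (auto simp: nnfun_def)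
        show "AE x in M. real k * u x powr (1 / p) \<le> (real n * u x) powr (1 / p)"
          using k by (simp add: powr_mult mult_right_mono)
      qed
    qed
    then show ?thesis by simp
  qed
qed

section \<open>Lozanovskii factorization\<close>

lemma weighted_am_gm:
  fixes x y \<theta> :: real
  assumes "0 \<le> x" "0 \<le> y" "0 \<le> \<theta>" "\<theta> \<le> 1"
  shows "x powr \<theta> * y powr (1 - \<theta>) \<le> \<theta> * x + (1 - \<theta>) * y"
proof (cases "x = 0 \<or> y = 0")
  case False
  then have xy: "0 < x" "0 < y" using assms by auto
  have cv: "convex_on UNIV (exp :: real \<Rightarrow> real)"
    by (intro convex_on_realI[where f' = exp]) (auto intro!: derivative_eq_intros)
  have "exp ((1 - \<theta>) *\<^sub>R ln y + \<theta> *\<^sub>R ln x) \<le> (1 - \<theta>) * exp (ln y) + \<theta> * exp (ln x)"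
    by (rule convex_onD[OF cv]) (use assms in auto)
  moreover have "(1 - \<theta>) *\<^sub>R ln y + \<theta> *\<^sub>R ln x = \<theta> * ln x + (1 - \<theta>) * ln y" by simp
  ultimately have "exp (\<theta> * ln x + (1 - \<theta>) * ln y) \<le> (1 - \<theta>) * y + \<theta> * x"
    using xy by (simp add: add.commute)
  with xy show ?thesis unfolding exp_add by (simp add: powr_def)
qed (use assms in auto)

text \<open>
  By homogeneity one may divide by the mean values \<open>X\<close> and \<open>Y\<close>, after which the claim is the average
  of two instances of the weighted inequality of arithmetic and geometric means.
\<close>

lemma powr_geometric_mean_concave:
  fixes x y x' y' c \<theta> :: real
  assumes "0 \<le> x" "0 \<le> y" "0 \<le> x'" "0 \<le> y'" "0 \<le> c" "c \<le> 1" "0 < \<theta>" "\<theta> < 1"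
  shows "c * (x powr \<theta> * y powr (1 - \<theta>)) + (1 - c) * (x' powr \<theta> * y' powr (1 - \<theta>))
       \<le> (c * x + (1 - c) * x') powr \<theta> * (c * y + (1 - c) * y') powr (1 - \<theta>)"
proof -
  define X Y where "X = c * x + (1 - c) * x'" and "Y = c * y + (1 - c) * y'"
  have XY: "0 \<le> X" "0 \<le> Y" using assms by (auto simp: X_def Y_def)
  show ?thesis
  proof (cases "X = 0 \<or> Y = 0")
    case True
    then have "(c * x = 0 \<and> (1 - c) * x' = 0) \<or> (c * y = 0 \<and> (1 - c) * y' = 0)"
      using assms by (auto simp: X_def Y_def add_nonneg_eq_0_iff)
    then have "c * (x powr \<theta> * y powr (1 - \<theta>)) + (1 - c) * (x' powr \<theta> * y' powr (1 - \<theta>)) = 0"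
      by auto
    then show ?thesis by simp
  next
    case False
    then have XY: "0 < X" "0 < Y" using XY by auto
    have S: "a powr \<theta> * b powr (1 - \<theta>) \<le> (X powr \<theta> * Y powr (1 - \<theta>)) * (\<theta> * (a / X) + (1 - \<theta>)
        * (b / Y))"
      if "0 \<le> a" "0 \<le> b" for a b
    proof -
      have "(a / X) powr \<theta> * (b / Y) powr (1 - \<theta>) \<le> \<theta> * (a / X) + (1 - \<theta>) * (b / Y)"
        using that assms XY by (intro weighted_am_gm) auto
      then have "(X powr \<theta> * Y powr (1 - \<theta>)) * ((a / X) powr \<theta> * (b / Y) powr (1 - \<theta>))
          \<le> (X powr \<theta> * Y powr (1 - \<theta>)) * (\<theta> * (a / X) + (1 - \<theta>) * (b / Y))"
        by (intro mult_left_mono) auto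
      moreover have "(X powr \<theta> * Y powr (1 - \<theta>)) * ((a / X) powr \<theta> * (b / Y) powr (1 - \<theta>))
          = a powr \<theta> * b powr (1 - \<theta>)"
        using XY by (simp add: powr_divide)
      ultimately show ?thesis by simp
    qed
    have "c * (x powr \<theta> * y powr (1 - \<theta>)) + (1 - c) * (x' powr \<theta> * y' powr (1 - \<theta>))
      \<le> c * ((X powr \<theta> * Y powr (1 - \<theta>)) * (\<theta> * (x / X) + (1 - \<theta>) * (y / Y)))
        + (1 - c) * ((X powr \<theta> * Y powr (1 - \<theta>)) * (\<theta> * (x' / X) + (1 - \<theta>) * (y' / Y)))"
      using assms by (intro add_mono mult_left_mono S) auto
    also have "\<dots> = (X powr \<theta> * Y powr (1 - \<theta>)) * (\<theta> * (X / X) + (1 - \<theta>) * (Y / Y))"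
    proof -
      have "X / X = c * (x / X) + (1 - c) * (x' / X)" "Y / Y = c * (y / Y) + (1 - c) * (y' / Y)"
        unfolding X_def Y_def by (metis add_divide_distrib times_divide_eq_right)+
      then show ?thesis by (simp only:) (simp add: algebra_simps)
    qed
    also have "\<dots> = X powr \<theta> * Y powr (1 - \<theta>)" using XY by simp
    finally show ?thesis unfolding X_def Y_def .
  qed
qed

lemma nn_integral_geometric_mean_le:
  fixes f g :: "'a \<Rightarrow> real"
  assumes "f \<in> borel_measurable M" "g \<in> borel_measurable M"
    and "\<And>x. 0 \<le> f x" "\<And>x. 0 \<le> g x" and "0 \<le> \<theta>" "\<theta> \<le> 1"
    and "(\<integral>\<^sup>+x. ennreal (f x) \<partial>M) \<le> 1" "(\<integral>\<^sup>+x. ennreal (g x) \<partial>M) \<le> 1"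
    and h: "AE x in M. h x \<le> f x powr \<theta> * g x powr (1 - \<theta>)"
  shows "(\<integral>\<^sup>+x. ennreal (h x) \<partial>M) \<le> 1"
proof (rule nn_integral_convex_combination_le[of f M g \<theta> "1 - \<theta>"])
  show "AE x in M. h x \<le> \<theta> * f x + (1 - \<theta>) * g x"
    using h by eventually_elim (use weighted_am_gm assms in \<open>blast intro: order_trans\<close>)
qed (use assms in auto)

text \<open>
  With \<open>B\<close> the unit ball of \<open>E\<close>, \<open>P\<close> is the unit ball of the power \<open>(E')\<^bsup>1/\<theta>\<^esup>\<close>, and the claim is that \<open>E\<close> is
  contained in the Calderon product of \<open>P'\<close> and $L^1$.  The set \<open>Q\<close> of all functions below a product
  \<open>H\<^sup>\<theta> k\<^bsup>1-\<theta>\<^esup>\<close> is convex since the geometric mean is concave, and closed since pairs \<open>(H, k)\<close> of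
  factors can be extracted from nested families.  If \<open>g\<close> is in the polar of \<open>Q\<close>, then testing it on
  the best choice \<open>k = H g\<^bsup>1/\<theta>\<^esup> / \<integral> H g\<^bsup>1/\<theta>\<^esup>\<close> gives \<open>\<integral> H g\<^bsup>1/\<theta>\<^esup> \<le> 1\<close> for every \<open>H\<close> in the polar of \<open>P\<close>, so
  \<open>g\<^bsup>1/\<theta>\<^esup>\<close> is in \<open>P\<close> by the bipolar theorem, that is, \<open>g\<close> is in the polar of \<open>B\<close>.  Thus the polar of \<open>Q\<close>
  is contained in that of \<open>B\<close>, and \<open>B\<close> in the bipolar \<open>Q\<close> of \<open>Q\<close>.
\<close>

theorem (in sigma_finite_measure) lozanovskii_factorization:
  assumes B: "solid_ball M B" and cB: "convex_ball B" and \<theta>: "0 < \<theta>" "\<theta> < 1"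
    and P: "P = power_ball M (1 / \<theta>) (polar M B)" and cP: "convex_ball P"
    and u: "u \<in> B"
  shows "\<exists>H\<in>polar M P. \<exists>k\<in>nnfun M. (\<integral>\<^sup>+x. ennreal (k x) \<partial>M) \<le> 1 \<and>
           (AE x in M. u x \<le> H x powr \<theta> * k x powr (1 - \<theta>))"
proof -
  define L where "L = {k \<in> nnfun M. (\<integral>\<^sup>+x. ennreal (k x) \<partial>M) \<le> 1}"
  define Q where "Q = {u \<in> nnfun M. \<exists>H\<in>polar M P. \<exists>k\<in>L. AE x in M. u x
      \<le> H x powr \<theta> * k x powr (1 - \<theta>)}"
  have pB: "solid_ball M (polar M B)" by (rule polar_solid_ball[OF B cB])
  have sP: "solid_ball M P" unfolding P by (rule power_ball_solid[OF pB]) (use \<theta> in auto)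
  have pP: "solid_ball M (polar M P)" by (rule polar_solid_ball[OF sP cP])
  have Pn: "G \<in> nnfun M" if "G \<in> P" for G using solid_ball_nnfun[OF sP that] .
  have cpP: "convex_ball (polar M P)" by (rule polar_convex) (use Pn in auto)
  have Hn: "H \<in> nnfun M" if "H \<in> polar M P" for H using polar_nnfun[OF that] .
  have Ln: "k \<in> nnfun M" if "k \<in> L" for k using that by (auto simp: L_def)
  obtain e where e: "e \<in> P" "AE x in M. 0 < e x" using weak_unit_exists[OF sP cP] by blast
  obtain H0 where H0: "H0 \<in> polar M P" "AE x in M. 0 < H0 x" using weak_unit_exists[OF pP cpP]
    by blast
  obtain k0 :: "'a \<Rightarrow> real" where k0m [measurable]: "k0 \<in> borel_measurable M"
    and k0p: "\<And>x. 0 < k0 x" and k0i: "(\<integral>\<^sup>+x. ennreal (k0 x) \<partial>M) \<le> 1"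
    using obtain_positive_integrable by blast
  have k0: "k0 \<in> L" using k0i less_imp_le[OF k0p] by (auto simp: L_def)
  \<comment> \<open>The inequality of arithmetic and geometric means, applied to \<open>G H\<close> and \<open>k\<close>.\<close>
  have QP: "(\<integral>\<^sup>+x. ennreal (v x * G x powr \<theta>) \<partial>M) \<le> 1" if vQ: "v \<in> Q" and GP: "G \<in> P" for v G
  proof -
    obtain H k where H: "H \<in> polar M P" and k: "k \<in> L" and le: "AE x in M. v x
        \<le> H x powr \<theta> * k x powr (1 - \<theta>)"
      using vQ by (auto simp: Q_def)
    have G: "G \<in> nnfun M" using Pn[OF GP] .
    show ?thesis
    proof (rule nn_integral_geometric_mean_le[of "\<lambda>x. G x * H x" M k \<theta>])
      show "AE x in M. v x * G x powr \<theta> \<le> (G x * H x) powr \<theta> * k x powr (1 - \<theta>)"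
        using le
      proof eventually_elim
        case (elim x)
        have "v x * G x powr \<theta> \<le> (H x powr \<theta> * k x powr (1 - \<theta>)) * G x powr \<theta>"
          by (rule mult_right_mono[OF elim]) simp
        then show ?case by (simp add: powr_mult ac_simps)
      qed
      show "(\<integral>\<^sup>+x. ennreal (G x * H x) \<partial>M) \<le> 1" by (rule polarD[OF H GP])
      show "(\<integral>\<^sup>+x. ennreal (k x) \<partial>M) \<le> 1" using k by (simp add: L_def)
    qed (use \<theta> G Hn[OF H] Ln[OF k] in \<open>auto simp: nnfun_def\<close>)
  qed
  have mean: "\<exists>H''\<in>polar M P. \<exists>k''\<in>L. (\<forall>x. H'' x = c * H x + (1 - c) * H' x)
      \<and> (\<forall>x. k'' x = c * k x + (1 - c) * k' x)"
    if "H \<in> polar M P" "H' \<in> polar M P" "k \<in> L" "k' \<in> L" "0 \<le> c" "c \<le> 1" for H H' k k' c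
  proof -
    have a: "(\<lambda>x. c * H x + (1 - c) * H' x) \<in> polar M P" by (rule convex_ballD[OF cpP]) fact+
    have "(\<integral>\<^sup>+x. ennreal (c * k x + (1 - c) * k' x) \<partial>M) \<le> 1"
      by (rule nn_integral_convex_combination_le[of k M k' c "1 - c"])
         (use that in \<open>auto simp: L_def nnfun_def\<close>)
    then have b: "(\<lambda>x. c * k x + (1 - c) * k' x) \<in> L"
      using that nnfun_nonneg[OF Ln[OF that(3)]] nnfun_nonneg[OF Ln[OF that(4)]]
      by (auto simp: L_def nnfun_def)
    show ?thesis by (rule bexI[OF _ a], rule bexI[OF _ b]) simp
  qed
  have cQ: "convex_ball Q"
    unfolding convex_ball_def
  proof (intro ballI allI impI)
    fix v v' and c :: real assume v: "v \<in> Q" "v' \<in> Q" and c: "0 \<le> c" "c \<le> 1"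
    obtain H k where H: "H \<in> polar M P" and k: "k \<in> L" and le: "AE x in M. v x
        \<le> H x powr \<theta> * k x powr (1 - \<theta>)"
      using v(1) by (auto simp: Q_def)
    obtain H' k' where H': "H' \<in> polar M P" and k': "k' \<in> L" and le': "AE x in M. v' x
        \<le> H' x powr \<theta> * k' x powr (1 - \<theta>)"
      using v(2) by (auto simp: Q_def)
    obtain H2 k2 where 2: "H2 \<in> polar M P" "k2 \<in> L" "\<And>x. H2 x = c * H x + (1 - c) * H' x" "\<And>x. k2 x
        = c * k x + (1 - c) * k' x"
      using mean[OF H H' k k' c] by blast
    have le2: "AE x in M. c * v x + (1 - c) * v' x \<le> H2 x powr \<theta> * k2 x powr (1 - \<theta>)"
      using le le'
    proof eventually_elim
      case (elim x)
      have "c * v x + (1 - c) * v' x \<le> c * (H x powr \<theta> * k x powr (1 - \<theta>)) + (1 - c) * (H' x powr \<theta>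
          * k' x powr (1 - \<theta>))"
        using elim c by (intro add_mono mult_left_mono) auto
      also have "\<dots> \<le> H2 x powr \<theta> * k2 x powr (1 - \<theta>)"
        unfolding 2 using c \<theta> Hn[OF H] Hn[OF H'] Ln[OF k] Ln[OF k']
        by (intro powr_geometric_mean_concave) (auto simp: nnfun_def)
      finally show ?case .
    qed
    have "(\<lambda>x. c * v x + (1 - c) * v' x) \<in> nnfun M" using v c by (auto simp: Q_def nnfun_def)
    then show "(\<lambda>x. c * v x + (1 - c) * v' x) \<in> Q"
      unfolding Q_def mem_Collect_eq using 2(1,2) le2 by blast
  qed
  have sQ: "solid_ball M Q"
    unfolding solid_ball_def
  proof (intro conjI ballI allI impI)
    show "Q \<subseteq> nnfun M" by (auto simp: Q_def)
    show "(\<lambda>x. 0) \<in> Q" using H0 k0 by (auto simp: Q_def intro!: nnfunI)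
    show "v' \<in> Q" if vQ: "v \<in> Q" and v': "v' \<in> nnfun M" "AE x in M. v' x \<le> v x" for v v'
    proof -
      obtain H k where H: "H \<in> polar M P" and k: "k \<in> L" and le: "AE x in M. v x
          \<le> H x powr \<theta> * k x powr (1 - \<theta>)"
        using vQ by (auto simp: Q_def)
      have "AE x in M. v' x \<le> H x powr \<theta> * k x powr (1 - \<theta>)"
        using le v'(2) by eventually_elim simp
      with v'(1) H k show ?thesis by (auto simp: Q_def)
    qed
    show "\<exists>v\<in>Q. \<not> (AE x in M. x \<in> A \<longrightarrow> v x = 0)" if A [measurable]: "A \<in> sets M" and A0: "0
        < emeasure M A" for A
    proof (intro bexI notI)
      show "(\<lambda>x. H0 x powr \<theta> * k0 x powr (1 - \<theta>)) \<in> Q"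
        using H0 k0 Hn[OF H0(1)] Ln[OF k0] by (auto simp: Q_def nnfun_def)
      assume "AE x in M. x \<in> A \<longrightarrow> H0 x powr \<theta> * k0 x powr (1 - \<theta>) = 0"
      with H0(2) have "AE x in M. x \<notin> A"
      proof eventually_elim
        case (elim x)
        then show ?case using k0p[of x] by auto
      qed
      then have "A \<in> null_sets M" by (simp add: AE_iff_null_sets)
      then have "emeasure M A = 0" by (simp add: null_sets_def)
      with A0 show False by simp
    qed
    show "AE x in M. v x = 0" if v: "v \<in> nnfun M" and n: "\<forall>n::nat. (\<lambda>x. real n * v x) \<in> Q" for v
    proof (rule AE_zero_from_integral[of "\<lambda>x. e x powr \<theta>"])
      show "(\<integral>\<^sup>+x. ennreal (real n * (v x * e x powr \<theta>)) \<partial>M) \<le> 1" for n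
        using QP[OF n[rule_format, of n] e(1)] by (simp add: ac_simps)
      show "AE x in M. 0 < e x powr \<theta>" using e(2) by eventually_elim simp
    qed (use v Pn[OF e(1)] in \<open>auto simp: nnfun_def\<close>)
    show "v \<in> Q" if v: "v \<in> nnfun M" and *: "(\<forall>n::nat. U n \<in> Q) \<and> (AE x in M. incseq (\<lambda>n. U n x)
        \<and> (\<lambda>n. U n x) \<longlonglongrightarrow> v x)" for U v
    proof -
      define C where "C n = {(H, k). H \<in> polar M P \<and> k \<in> L \<and> (AE x in M. U n x
          \<le> H x powr \<theta> * k x powr (1 - \<theta>))}" for n
      have "\<exists>H k. \<forall>n. (H, k) \<in> C n"
      proof (rule nested_pairs_Int_nonempty[where \<eta> = "\<lambda>x. min (e x) 1" and K = 1])
        show "C n \<subseteq> nnfun M \<times> nnfun M" for n using Hn Ln by (auto simp: C_def)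
        show "C n \<noteq> {}" for n
        proof -
          have "U n \<in> Q" using * by blast
          then obtain H k where "H \<in> polar M P" "k \<in> L" "AE x in M. U n x
              \<le> H x powr \<theta> * k x powr (1 - \<theta>)"
            unfolding Q_def by blast
          then have "(H, k) \<in> C n" by (simp add: C_def)
          then show ?thesis by blast
        qed
        show "decseq C"
          unfolding decseq_def
        proof (intro allI impI subsetI)
          fix i j :: nat and z assume ij: "i \<le> j" and "z \<in> C j"
          then obtain H k where z: "z = (H, k)" "H \<in> polar M P" "k \<in> L" "AE x in M. U j x
              \<le> H x powr \<theta> * k x powr (1 - \<theta>)"
            by (auto simp: C_def)
          have "AE x in M. U i x \<le> H x powr \<theta> * k x powr (1 - \<theta>)"
            using *[THEN conjunct2] z(4) by eventually_elim (use ij in \<open>auto simp: incseq_def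
                intro: order_trans\<close>)
          with z show "z \<in> C i" by (auto simp: C_def)
        qed
        show "((\<lambda>x. (H x + H' x) / 2), (\<lambda>x. (k x + k' x) / 2)) \<in> C n"
          if "(H, k) \<in> C n" "(H', k') \<in> C n" for n H k H' k'
        proof -
          have H: "H \<in> polar M P" "H' \<in> polar M P" and k: "k \<in> L" "k' \<in> L"
            and le: "AE x in M. U n x \<le> H x powr \<theta> * k x powr (1 - \<theta>)" "AE x in M. U n x
                \<le> H' x powr \<theta> * k' x powr (1 - \<theta>)"
            using that by (auto simp: C_def)
          obtain H2 k2 where 2: "H2 \<in> polar M P" "k2 \<in> L" "\<And>x. H2 x = 1/2 * H x + (1 - 1/2) * H' x"
              "\<And>x. k2 x = 1/2 * k x + (1 - 1/2) * k' x"
            using mean[OF H k, of "1/2"] by auto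
          have e: "H2 = (\<lambda>x. (H x + H' x) / 2)" "k2 = (\<lambda>x. (k x + k' x) / 2)" unfolding 2
            by (auto simp: fun_eq_iff 2(3,4) add_divide_distrib)
          have "AE x in M. U n x \<le> H2 x powr \<theta> * k2 x powr (1 - \<theta>)"
            using le
          proof eventually_elim
            case (elim x)
            have "U n x = 1/2 * U n x + (1 - 1/2) * U n x" by simp
            also have "\<dots> \<le> 1/2 * (H x powr \<theta> * k x powr (1 - \<theta>)) + (1 - 1/2) * (H' x powr \<theta>
                * k' x powr (1 - \<theta>))"
              using elim by (intro add_mono mult_left_mono) auto
            also have "\<dots> \<le> H2 x powr \<theta> * k2 x powr (1 - \<theta>)"
              unfolding 2 using \<theta> Hn[OF H(1)] Hn[OF H(2)] Ln[OF k(1)] Ln[OF k(2)]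
              by (intro powr_geometric_mean_concave) (auto simp: nnfun_def)
            finally show ?case .
          qed
          with 2(1,2) show ?thesis unfolding e by (auto simp: C_def)
        qed
        show "(H, k) \<in> C n" if HK: "\<And>j::nat. (HH j, KK j) \<in> C n" and H: "H \<in> nnfun M"
            and k: "k \<in> nnfun M"
          and lim: "AE x in M. (\<lambda>j. HH j x) \<longlonglongrightarrow> H x" "AE x in M. (\<lambda>j. KK j x) \<longlonglongrightarrow> k x"
          for n HH KK H k
        proof -
          have HH: "HH j \<in> polar M P" and KK: "KK j \<in> L" and le: "AE x in M. U n x
              \<le> HH j x powr \<theta> * KK j x powr (1 - \<theta>)" for j
            using HK[of j] by (auto simp: C_def)
          have "H \<in> polar M P" by (rule solid_ball_limit[OF pP HH H lim(1)])
          moreover have "(\<integral>\<^sup>+x. ennreal (k x) \<partial>M) \<le> 1"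
          proof (rule nn_integral_le_of_tendsto)
            show "AE x in M. (\<lambda>j. ennreal (KK j x)) \<longlonglongrightarrow> ennreal (k x)"
              using lim(2) by eventually_elim (intro tendsto_intros)
          qed (use KK in \<open>auto simp: L_def nnfun_def\<close>)
          moreover have "AE x in M. \<forall>j. U n x \<le> HH j x powr \<theta> * KK j x powr (1 - \<theta>)"
            using le by (simp add: AE_all_countable)
          with lim have "AE x in M. U n x \<le> H x powr \<theta> * k x powr (1 - \<theta>)"
          proof eventually_elim
            case (elim x)
            have "(\<lambda>j. HH j x powr \<theta> * KK j x powr (1 - \<theta>)) \<longlonglongrightarrow> H x powr \<theta> * k x powr (1 - \<theta>)"
              using elim \<theta> nnfun_nonneg[OF Hn[OF HH]] nnfun_nonneg[OF Ln[OF KK]]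
              by (intro tendsto_mult tendsto_powr' tendsto_const disjI2 conjI always_eventually
                  allI) auto
            then show ?case by (rule LIMSEQ_le_const) (use elim in auto)
          qed
          ultimately show ?thesis using k by (simp add: C_def L_def)
        qed
        show "(\<lambda>x. min (e x) 1) \<in> borel_measurable M" using Pn[OF e(1)] by (auto simp: nnfun_def)
        show "AE x in M. 0 < min (e x) 1" using e(2) by eventually_elim simp
        show "(\<integral>\<^sup>+x. ennreal (H x * min (e x) 1) \<partial>M) \<le> 1" if "(H, k) \<in> C 0" for H k
        proof -
          have H: "H \<in> polar M P" using that by (simp add: C_def)
          have "(\<integral>\<^sup>+x. ennreal (H x * min (e x) 1) \<partial>M) \<le> (\<integral>\<^sup>+x. ennreal (e x * H x) \<partial>M)"
            using nnfun_nonneg[OF Hn[OF H]] by (intro nn_integral_mono ennreal_leI)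
                (simp add: mult.commute[of "e _"] mult_left_mono)
          with polarD[OF H e(1)] show ?thesis by (rule order_trans[rotated])
        qed
        show "(\<integral>\<^sup>+x. ennreal (k x * min (e x) 1) \<partial>M) \<le> 1" if "(H, k) \<in> C 0" for H k
        proof -
          have k: "k \<in> L" using that by (simp add: C_def)
          have "(\<integral>\<^sup>+x. ennreal (k x * min (e x) 1) \<partial>M) \<le> (\<integral>\<^sup>+x. ennreal (k x) \<partial>M)"
            using nnfun_nonneg[OF Ln[OF k]] by (intro nn_integral_mono ennreal_leI)
                (simp add: mult_left_le)
          also have "\<dots> \<le> 1" using k by (simp add: L_def)
          finally show ?thesis .
        qed
      qed auto
      then obtain H k where HC: "\<And>n. (H, k) \<in> C n" by blast
      have "AE x in M. \<forall>n. U n x \<le> H x powr \<theta> * k x powr (1 - \<theta>)"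
        using HC by (simp add: AE_all_countable C_def)
      with *[THEN conjunct2] have "AE x in M. v x \<le> H x powr \<theta> * k x powr (1 - \<theta>)"
        by eventually_elim (auto intro: LIMSEQ_le_const2)
      then show ?thesis using HC[of 0] v by (auto simp: Q_def C_def)
    qed
  qed
  have "u \<in> Q"
  proof (rule bipolar[OF sQ cQ])
    show "u \<in> nnfun M" by (rule solid_ball_nnfun[OF B u])
    fix g assume g: "g \<in> polar M Q"
    have gn: "g \<in> nnfun M" using polar_nnfun[OF g] .
    note [measurable] = gn[THEN nnfun_measurable] and g0 = gn[THEN nnfun_nonneg]
    define G where "G x = g x powr (1 / \<theta>)" for x
    have G0: "0 \<le> G x" for x by (simp add: G_def)
    have [measurable]: "G \<in> borel_measurable M" unfolding G_def[abs_def] by measurable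
    have "G \<in> P"
    proof (rule bipolar[OF sP cP])
      show "G \<in> nnfun M" using G0 by auto
      fix H assume H: "H \<in> polar M P"
      note [measurable] = Hn[OF H, THEN nnfun_measurable] and HH0 = Hn[OF H, THEN nnfun_nonneg]
      \<comment> \<open>Restricting \<open>H\<close> to these sets makes the normalizing integral finite, and they exhaust the space.\<close>
      define A where "A n = {x \<in> space M. H x * G x \<le> real n * k0 x}" for n :: nat
      have [measurable]: "A n \<in> sets M" for n unfolding A_def by measurable
      define HA where "HA n x = H x * indicator (A n) x" for n x
      have HA0: "0 \<le> HA n x" for n x using HH0 by (simp add: HA_def)
      have HA: "HA n \<in> polar M P" for n
        by (rule solid_ball_solid[OF pP H]) (auto simp: HA_def[abs_def] HH0 indicator_def
            intro!: nnfunI)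
      note [measurable] = Hn[OF HA, THEN nnfun_measurable]
      have le1: "(\<integral>\<^sup>+x. ennreal (HA n x * G x) \<partial>M) \<le> 1" for n
      proof -
        have "(\<integral>\<^sup>+x. ennreal (HA n x * G x) \<partial>M) \<le> (\<integral>\<^sup>+x. ennreal (real n) * ennreal (k0 x) \<partial>M)"
          using less_imp_le[OF k0p]
          by (intro nn_integral_mono)
             (auto simp: HA_def A_def indicator_def ennreal_mult[symmetric] intro!: ennreal_leI)
        also have "\<dots> \<le> ennreal (real n) * 1"
          unfolding nn_integral_cmult[OF measurable_compose[OF k0m measurable_ennreal]]
          by (intro mult_left_mono k0i) simp
        also have "\<dots> < \<infinity>" by (simp add: ennreal_mult_less_top)
        finally obtain I where I: "0 \<le> I" "(\<integral>\<^sup>+x. ennreal (HA n x * G x) \<partial>M) = ennreal I"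
          by (metis ennreal_cases less_irrefl infinity_ennreal_def)
        show ?thesis
        proof (cases "I = 0")
          case False
          with I have Ip: "0 < I" by simp
          \<comment> \<open>The choice of \<open>k\<close> for which Hoelder's inequality is an equality.\<close>
          define k where "k x = HA n x * G x / I" for x
          have "(\<integral>\<^sup>+x. ennreal (k x) \<partial>M) = (\<integral>\<^sup>+x. ennreal (1 / I) * ennreal (HA n x * G x) \<partial>M)"
            using Ip HA0 G0 by (intro nn_integral_cong) (simp add: k_def ennreal_mult[symmetric])
          also have "\<dots> = ennreal (1 / I) * ennreal I" by (simp add: nn_integral_cmult I)
          also have "\<dots> = 1" using Ip by (simp add: ennreal_mult[symmetric])
          finally have k: "k \<in> L" using Ip HA0 G0 unfolding L_def k_def[abs_def]
            by (auto intro!: nnfunI)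
          define v where "v x = HA n x powr \<theta> * k x powr (1 - \<theta>)" for x
          have "v \<in> Q" using HA[of n] k Ln[OF k] unfolding Q_def v_def by (auto simp: nnfun_def)
          then have "(\<integral>\<^sup>+x. ennreal (v x * g x) \<partial>M) \<le> 1" by (rule polarD[OF g])
          moreover have "v x * g x = I powr (\<theta> - 1) * (HA n x * G x)" for x
          proof -
            have gG: "g x = G x powr \<theta>" using \<theta> g0[of x] by (simp add: G_def powr_powr)
            have y: "y powr \<theta> * y powr (1 - \<theta>) = y" if "0 \<le> y" for y :: real
              using that by (simp add: powr_add[symmetric])
            have "I powr (\<theta> - 1) = 1 / I powr (1 - \<theta>)" by (simp add: powr_minus_divide[symmetric])
            moreover have "v x * g x = (HA n x powr \<theta> * HA n x powr (1 - \<theta>)) * (G x powr \<theta>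
                * G x powr (1 - \<theta>)) / I powr (1 - \<theta>)"
              by (simp add: gG v_def k_def powr_mult powr_divide)
            ultimately show ?thesis using y[OF HA0] y[OF G0] by simp
          qed
          ultimately have "(\<integral>\<^sup>+x. ennreal (I powr (\<theta> - 1)) * ennreal (HA n x * G x) \<partial>M) \<le> 1"
            using HA0 G0 by (simp add: ennreal_mult)
          then have "ennreal (I powr (\<theta> - 1)) * ennreal I \<le> 1" by (simp add: nn_integral_cmult I)
          then have "I powr (\<theta> - 1) * I \<le> 1" using I
            by (simp add: ennreal_mult[symmetric] ennreal_le_1)
          moreover have "I powr (\<theta> - 1) * I = I powr \<theta>" using Ip by (simp add: powr_diff)
          ultimately have "I \<le> 1" using \<theta> Ip
            by (metis linorder_not_le powr_less_cancel_iff powr_one_eq_one zero_less_one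
                powr_less_mono2 less_imp_le)
          with I show ?thesis by (simp add: ennreal_le_1)
        qed (simp add: I)
      qed
      show "(\<integral>\<^sup>+x. ennreal (G x * H x) \<partial>M) \<le> 1"
      proof (rule nn_integral_le_of_tendsto[where f = "\<lambda>n x. ennreal (HA n x * G x)"])
        show "AE x in M. (\<lambda>n. ennreal (HA n x * G x)) \<longlonglongrightarrow> ennreal (G x * H x)"
        proof (rule AE_I2, rule tendsto_eventually)
          fix x assume x: "x \<in> space M"
          obtain j :: nat where "H x * G x / k0 x \<le> j" using real_arch_simple by blast
          then have j: "H x * G x \<le> j * k0 x" using k0p[of x] by (simp add: field_simps)
          have "x \<in> A n" if "j \<le> n" for n
          proof -
            have "real j * k0 x \<le> real n * k0 x" using that k0p[of x] by (intro mult_right_mono) auto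
            with j x show ?thesis by (simp add: A_def)
          qed
          then show "\<forall>\<^sub>F n in sequentially. ennreal (HA n x * G x) = ennreal (G x * H x)"
            by (intro eventually_sequentiallyI[of j]) (simp add: HA_def mult.commute)
        qed
      qed (use le1 in auto)
    qed
    then have "(\<lambda>x. G x powr \<theta>) \<in> polar M B" by (simp add: P power_ball_def)
    then have "(\<integral>\<^sup>+x. ennreal (u x * G x powr \<theta>) \<partial>M) \<le> 1" by (rule polarD[OF _ u])
    moreover have "G x powr \<theta> = g x" for x using \<theta> g0[of x] by (simp add: G_def powr_powr)
    ultimately show "(\<integral>\<^sup>+x. ennreal (u x * g x) \<partial>M) \<le> 1" by simp
  qed
  then show ?thesis by (auto simp: Q_def L_def)
qed

text \<open>
  For \<open>\<theta> = 1\<close> the factor \<open>k\<close> is raised to the power zero and is chosen positive, as \<open>0 powr 0 = 0\<close>.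
\<close>

lemma (in sigma_finite_measure) lozanovskii_factorization_positive:
  assumes B: "solid_ball M B" and cB: "convex_ball B" and \<theta>: "0 < \<theta>" "\<theta> \<le> 1"
    and P: "P = power_ball M (1 / \<theta>) (polar M B)" and cP: "convex_ball P"
    and u: "u \<in> B" "AE x in M. 0 < u x"
  obtains H k where "H \<in> polar M P" "k \<in> nnfun M" "(\<integral>\<^sup>+x. ennreal (k x) \<partial>M) \<le> 1"
    "AE x in M. u x \<le> H x powr \<theta> * k x powr (1 - \<theta>)" "AE x in M. 0 < H x"
proof (cases "\<theta> = 1")
  case True
  obtain k :: "'a \<Rightarrow> real" where k: "k \<in> borel_measurable M" "\<And>x. 0 < k x" "(\<integral>\<^sup>+x. ennreal (k x) \<partial>M)
      \<le> 1"
    using obtain_positive_integrable by blast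
  have un: "u \<in> nnfun M" by (rule solid_ball_nnfun[OF B u(1)])
  show ?thesis
  proof (rule that[of u k])
    have "(\<integral>\<^sup>+x. ennreal (G x * u x) \<partial>M) \<le> 1" if G: "G \<in> P" for G
    proof -
      have g: "(\<lambda>x. G x powr 1) \<in> polar M B" and Gn: "G \<in> nnfun M" using G True
        by (auto simp: P power_ball_def)
      show ?thesis using polarD[OF g u(1)] nnfun_nonneg[OF Gn] by (simp add: mult.commute)
    qed
    then show "u \<in> polar M P" using un by (auto simp: polar_def)
    show "k \<in> nnfun M" using k(1) less_imp_le[OF k(2)] by auto
    show "AE x in M. u x \<le> u x powr \<theta> * k x powr (1 - \<theta>)"
      using True less_imp_neq[OF k(2)] nnfun_nonneg[OF un] by (auto simp: powr_def[of _ 0])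
  qed (use k u in auto)
next
  case False
  with \<theta> have \<theta>: "0 < \<theta>" "\<theta> < 1" by auto
  obtain H k where H: "H \<in> polar M P" and k: "k \<in> nnfun M" "(\<integral>\<^sup>+x. ennreal (k x) \<partial>M) \<le> 1"
    and le: "AE x in M. u x \<le> H x powr \<theta> * k x powr (1 - \<theta>)"
    using lozanovskii_factorization[OF B cB \<theta> P cP u(1)] by blast
  have "AE x in M. 0 < H x"
    using le u(2)
  proof eventually_elim
    case (elim x)
    then have "H x \<noteq> 0" by auto
    with nnfun_nonneg[OF polar_nnfun[OF H], of x] show ?case by simp
  qed
  with H k le show ?thesis by (rule that[of H k])
qed

section \<open>Convexity of powers of a polar\<close>

text \<open>
  Holds pointwise, as the power function with exponent \<open>\<theta>\<close> is convex.  This covers the negative values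
  of \<open>1/s\<close>, where \<open>\<theta> = 1 - r/s > 1\<close>.
\<close>

lemma power_ball_convex_of_ge_1:
  assumes B: "solid_ball M B" and c: "convex_ball B" and \<theta>: "1 \<le> \<theta>"
  shows "convex_ball (power_ball M (1 / \<theta>) B)"
  unfolding convex_ball_def
proof (intro ballI allI impI)
  fix u v and c :: real
  assume u: "u \<in> power_ball M (1 / \<theta>) B" and v: "v \<in> power_ball M (1 / \<theta>) B" and cc: "0 \<le> c" "c \<le> 1"
  have uv: "u \<in> nnfun M" "v \<in> nnfun M" "(\<lambda>x. u x powr \<theta>) \<in> B" "(\<lambda>x. v x powr \<theta>) \<in> B"
    using u v by (auto simp: power_ball_def)
  have w: "(\<lambda>x. c * u x + (1 - c) * v x) \<in> nnfun M"
    using uv cc nnfun_nonneg[OF uv(1)] nnfun_nonneg[OF uv(2)] by (auto simp: nnfun_def)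
  have "(\<lambda>x. (c * u x + (1 - c) * v x) powr \<theta>) \<in> B"
  proof (rule solid_ball_solid[OF B convex_ballD[OF c uv(3,4) cc]])
    show "(\<lambda>x. (c * u x + (1 - c) * v x) powr \<theta>) \<in> nnfun M" using w by (auto simp: nnfun_def)
    have "(c * u x + (1 - c) * v x) powr \<theta> \<le> c * u x powr \<theta> + (1 - c) * v x powr \<theta>" for x
    proof -
      \<comment> \<open>Convexity of the power function is available on the open half-line; the endpoint is a limit.\<close>
      have e: "e > 0 \<Longrightarrow> (c * (u x + e) + (1 - c) * (v x + e)) powr \<theta> \<le> c * (u x + e) powr \<theta> + (1 - c)
          * (v x + e) powr \<theta>" for e
        using convex_onD[OF powr_convex[OF \<theta>], of c "v x + e" "u x + e"] cc nnfun_nonneg[OF uv(1),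
            of x] nnfun_nonneg[OF uv(2), of x]
        by (simp add: add.commute add_nonneg_pos)
      have t1: "((\<lambda>e. (c * (u x + e) + (1 - c) * (v x + e)) powr \<theta>) \<longlongrightarrow> (c * (u x + 0) + (1 - c)
          * (v x + 0)) powr \<theta>) (at_right 0)"
        using \<theta> cc nnfun_nonneg[OF uv(1), of x] nnfun_nonneg[OF uv(2), of x]
        by (intro tendsto_powr' tendsto_intros disjI2 conjI eventually_at_rightI[of 0 1]) auto
      have t2: "((\<lambda>e. c * (u x + e) powr \<theta> + (1 - c) * (v x + e) powr \<theta>) \<longlongrightarrow> c * (u x + 0) powr \<theta>
          + (1 - c) * (v x + 0) powr \<theta>) (at_right 0)"
        using \<theta> nnfun_nonneg[OF uv(1), of x] nnfun_nonneg[OF uv(2), of x]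
        by (intro tendsto_add tendsto_mult tendsto_const tendsto_powr' tendsto_ident_at disjI2 conjI
            eventually_at_rightI[of 0 1]) auto
      have "(c * (u x + 0) + (1 - c) * (v x + 0)) powr \<theta> \<le> c * (u x + 0) powr \<theta> + (1 - c)
          * (v x + 0) powr \<theta>"
        by (rule tendsto_le[OF _ t2 t1]) (auto intro!: eventually_at_rightI[of 0 1] e)
      then show ?thesis by simp
    qed
    then show "AE x in M. (c * u x + (1 - c) * v x) powr \<theta> \<le> c * u x powr \<theta> + (1 - c) * v x powr \<theta>"
      by simp
  qed
  with w show "(\<lambda>x. c * u x + (1 - c) * v x) \<in> power_ball M (1 / \<theta>) B" by (auto simp: power_ball_def)
qed

text \<open>
  For \<open>\<theta> < 1\<close>, convexity of the power of the polar is dual to concavity of the space with ball \<open>B\<close>.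
  The hypothesis \<open>conc\<close> expresses this concavity: when \<open>u\<close> is split as \<open>u m\<^bsup>1-\<theta>\<^esup>\<close> and
  \<open>u (1-m)\<^bsup>1-\<theta>\<^esup>\<close>, the norms of the parts are at most \<open>a\<^bsup>1-\<theta>\<^esup>\<close> and \<open>b\<^bsup>1-\<theta>\<^esup>\<close> with \<open>a + b \<le> 1\<close>.  Given
  \<open>D = c G\<^sub>1 + (1-c) G\<^sub>2\<close>, the proportion \<open>m = c G\<^sub>1 / D\<close> distributes \<open>u D\<^sup>\<theta>\<close> over \<open>G\<^sub>1\<^sup>\<theta>\<close> and \<open>G\<^sub>2\<^sup>\<theta>\<close>.
\<close>

lemma power_polar_convex_of_concave:
  assumes B: "B \<subseteq> nnfun M" and \<theta>: "0 < \<theta>" "\<theta> < 1"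
    and conc: "\<And>u m. u \<in> B \<Longrightarrow> m \<in> nnfun M \<Longrightarrow> (\<And>x. m x \<le> 1) \<Longrightarrow>
      \<exists>a b. 0 \<le> a \<and> 0 \<le> b \<and> a + b \<le> (1::real) \<and>
        (\<forall>g\<in>polar M B. (\<integral>\<^sup>+x. ennreal (u x * m x powr (1 - \<theta>) * g x) \<partial>M) \<le> ennreal (a powr (1 - \<theta>)) \<and>
           (\<integral>\<^sup>+x. ennreal (u x * (1 - m x) powr (1 - \<theta>) * g x) \<partial>M) \<le> ennreal (b powr (1 - \<theta>)))"
  shows "convex_ball (power_ball M (1 / \<theta>) (polar M B))"
  unfolding convex_ball_def
proof (intro ballI allI impI)
  fix G1 G2 and c :: real
  assume G: "G1 \<in> power_ball M (1 / \<theta>) (polar M B)" "G2 \<in> power_ball M (1 / \<theta>) (polar M B)"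
      and c: "0 \<le> c" "c \<le> 1"
  have nn: "G1 \<in> nnfun M" "G2 \<in> nnfun M" and g: "(\<lambda>x. G1 x powr \<theta>) \<in> polar M B"
      "(\<lambda>x. G2 x powr \<theta>) \<in> polar M B"
    using G by (auto simp: power_ball_def)
  note [measurable] = nn[THEN nnfun_measurable]
  note G0 = nn(1)[THEN nnfun_nonneg] nn(2)[THEN nnfun_nonneg]
  define D where "D x = c * G1 x + (1 - c) * G2 x" for x
  define m where "m x = (if D x = 0 then 1 else c * G1 x / D x)" for x
  have D0: "0 \<le> D x" for x using G0 c by (auto simp: D_def)
  have [measurable]: "D \<in> borel_measurable M" unfolding D_def[abs_def] by measurable
  have [measurable]: "m \<in> borel_measurable M" unfolding m_def[abs_def] by measurable
  have m0: "0 \<le> m x" and m1: "m x \<le> 1" for x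
  proof -
    show "0 \<le> m x" using D0[of x] G0(1)[of x] c by (auto simp: m_def)
    have "c * G1 x \<le> D x" using G0(2)[of x] c by (auto simp: D_def)
    then show "m x \<le> 1" using D0[of x] by (auto simp: m_def divide_le_eq_1)
  qed
  have mn: "m \<in> nnfun M" using m0 by auto
  have key: "D x powr \<theta> = c powr \<theta> * (m x powr (1 - \<theta>) * G1 x powr \<theta>) + (1 - c) powr \<theta>
      * ((1 - m x) powr (1 - \<theta>) * G2 x powr \<theta>)" for x
  proof (cases "D x = 0")
    case True
    then have "c * G1 x = 0" "(1 - c) * G2 x = 0"
      using G0[of x] c by (auto simp: D_def add_nonneg_eq_0_iff)
    then show ?thesis using True by auto
  next
    case False
    have [simp]: "(y / D x) powr (1 - \<theta>) * y powr \<theta> = y / D x * D x powr \<theta>" if "0 \<le> y" for y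
    proof -
      have "(y / D x) powr (1 - \<theta>) * y powr \<theta> = (y / D x) powr (1 - \<theta>) * (y / D x * D x) powr \<theta>"
        using False by simp
      also have "\<dots> = ((y / D x) powr (1 - \<theta>) * (y / D x) powr \<theta>) * D x powr \<theta>"
        by (simp only: powr_mult ac_simps)
      also have "(y / D x) powr (1 - \<theta>) * (y / D x) powr \<theta> = y / D x"
        using that D0[of x] by (simp add: powr_add[symmetric])
      finally show ?thesis .
    qed
    have "1 - m x = (1 - c) * G2 x / D x" using False by (simp add: m_def D_def field_simps)
    then have "c powr \<theta> * (m x powr (1 - \<theta>) * G1 x powr \<theta>) + (1 - c) powr \<theta>
        * ((1 - m x) powr (1 - \<theta>) * G2 x powr \<theta>)
      = (c * G1 x / D x) powr (1 - \<theta>) * (c * G1 x) powr \<theta> + ((1 - c) * G2 x / D x) powr (1 - \<theta>) *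
          ((1 - c) * G2 x) powr \<theta>"
      using False by (simp add: m_def powr_mult ac_simps)
    also have "\<dots> = c * G1 x / D x * D x powr \<theta> + (1 - c) * G2 x / D x * D x powr \<theta>"
      using c G0 by simp
    also have "\<dots> = (c * G1 x + (1 - c) * G2 x) / D x * D x powr \<theta>"
      by (simp add: add_divide_distrib distrib_right)
    also have "\<dots> = D x powr \<theta>" using False by (simp flip: D_def)
    finally show ?thesis by simp
  qed
  have "(\<integral>\<^sup>+x. ennreal (u x * D x powr \<theta>) \<partial>M) \<le> 1" if u: "u \<in> B" for u
  proof -
    have un: "u \<in> nnfun M" using u B by auto
    note [measurable] = un[THEN nnfun_measurable] and u0 = un[THEN nnfun_nonneg]
    obtain a b where ab: "0 \<le> a" "0 \<le> b" "a + b \<le> 1"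
      "\<And>g. g \<in> polar M B \<Longrightarrow> (\<integral>\<^sup>+x. ennreal (u x * m x powr (1 - \<theta>) * g x) \<partial>M)
          \<le> ennreal (a powr (1 - \<theta>))"
      "\<And>g. g \<in> polar M B \<Longrightarrow> (\<integral>\<^sup>+x. ennreal (u x * (1 - m x) powr (1 - \<theta>) * g x) \<partial>M)
          \<le> ennreal (b powr (1 - \<theta>))"
      using conc[OF u mn m1] by blast
    let ?f1 = "\<lambda>x. u x * m x powr (1 - \<theta>) * G1 x powr \<theta>" and ?f2 = "\<lambda>x. u x * (1 - m x) powr (1 - \<theta>)
        * G2 x powr \<theta>"
    have "(\<integral>\<^sup>+x. ennreal (u x * D x powr \<theta>) \<partial>M) \<le> (\<integral>\<^sup>+x. ennreal (c powr \<theta>) * ennreal (?f1 x)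
        + ennreal ((1 - c) powr \<theta>) * ennreal (?f2 x) \<partial>M)"
      by (intro nn_integral_mono ennreal_le_linear_combination) (auto simp: key u0 algebra_simps)
    also have "\<dots> = ennreal (c powr \<theta>) * (\<integral>\<^sup>+x. ennreal (?f1 x) \<partial>M) + ennreal ((1 - c) powr \<theta>)
        * (\<integral>\<^sup>+x. ennreal (?f2 x) \<partial>M)"
      by (subst nn_integral_add) (auto simp: nn_integral_cmult)
    also have "\<dots> \<le> ennreal (c powr \<theta>) * ennreal (a powr (1 - \<theta>)) + ennreal ((1 - c) powr \<theta>)
        * ennreal (b powr (1 - \<theta>))"
      using ab(4)[OF g(1)] ab(5)[OF g(2)] by (intro add_mono mult_left_mono) auto
    also have "\<dots> = ennreal (c powr \<theta> * a powr (1 - \<theta>) + (1 - c) powr \<theta> * b powr (1 - \<theta>))"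
      by (simp add: ennreal_mult)
    also have "\<dots> \<le> ennreal 1"
    proof (rule ennreal_leI)
      have "c powr \<theta> * a powr (1 - \<theta>) + (1 - c) powr \<theta> * b powr (1 - \<theta>) \<le> (\<theta> * c + (1 - \<theta>) * a)
          + (\<theta> * (1 - c) + (1 - \<theta>) * b)"
        using ab c \<theta> by (intro add_mono weighted_am_gm) auto
      also have "\<dots> = \<theta> + (1 - \<theta>) * (a + b)" by (simp add: algebra_simps)
      also have "\<dots> \<le> \<theta> + (1 - \<theta>) * 1" using \<theta> ab by (intro add_left_mono mult_left_mono) auto
      finally show "c powr \<theta> * a powr (1 - \<theta>) + (1 - c) powr \<theta> * b powr (1 - \<theta>) \<le> 1" by simp
    qed
    finally show ?thesis by simp
  qed
  then show "(\<lambda>x. c * G1 x + (1 - c) * G2 x) \<in> power_ball M (1 / \<theta>) (polar M B)"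
    using D0 by (auto simp: power_ball_def polar_def D_def[symmetric] intro!: nnfunI)
qed

section \<open>Function spaces and their unit balls\<close>

text \<open>
  \<open>B\<close> is the set of moduli of the members of the unit ball of \<open>E\<close>.  The norm is recovered from \<open>B\<close> as
  its gauge; stating this as an equivalence for all levels \<open>c > 0\<close> also determines norms that are zero.
\<close>

definition represents ::
  "'a measure \<Rightarrow> ('a, 'k::{real_normed_field, euclidean_space}) fspace \<Rightarrow> ('a \<Rightarrow> real) set \<Rightarrow> bool" where
  "represents M E B \<longleftrightarrow>
     carr E = {f \<in> borel_measurable M. \<exists>c>0. (\<lambda>x. norm (f x) / c) \<in> B} \<and>
     (\<forall>f\<in>carr E. 0 \<le> nrm E f \<and> (\<forall>c>0. nrm E f \<le> c \<longleftrightarrow> (\<lambda>x. norm (f x) / c) \<in> B))"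

definition ball_of :: "'a measure \<Rightarrow> ('a, 'k::{real_normed_field, euclidean_space}) fspace \<Rightarrow>
    ('a \<Rightarrow> real) set" where
  "ball_of M X = {u \<in> nnfun M. (\<lambda>x. of_real (u x)) \<in> carr X \<and> nrm X (\<lambda>x. of_real (u x)) \<le> 1}"

lemma quasi_BFS_zero: "quasi_BFS M X \<Longrightarrow> (\<lambda>x. 0) \<in> carr X"
  and quasi_BFS_add: "quasi_BFS M X \<Longrightarrow> f \<in> carr X \<Longrightarrow> g \<in> carr X \<Longrightarrow> (\<lambda>x. f x + g x) \<in> carr X"
  and quasi_BFS_scale: "quasi_BFS M X \<Longrightarrow> f \<in> carr X \<Longrightarrow> (\<lambda>x. c * f x) \<in> carr X"
  and quasi_BFS_nrm_nonneg: "quasi_BFS M X \<Longrightarrow> f \<in> carr X \<Longrightarrow> 0 \<le> nrm X f"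
  and quasi_BFS_nrm_zero: "quasi_BFS M X \<Longrightarrow> f \<in> carr X \<Longrightarrow> nrm X f = 0 \<longleftrightarrow> (AE x in M. f x = 0)"
  and quasi_BFS_nrm_scale: "quasi_BFS M X \<Longrightarrow> f \<in> carr X \<Longrightarrow> nrm X (\<lambda>x. c * f x) = norm c * nrm X f"
  and quasi_BFS_meas: "quasi_BFS M X \<Longrightarrow> f \<in> carr X \<Longrightarrow> f \<in> borel_measurable M"
  and quasi_BFS_ideal: "quasi_BFS M X \<Longrightarrow> f \<in> carr X \<Longrightarrow> g \<in> borel_measurable M \<Longrightarrow>
    (AE x in M. norm (g x) \<le> norm (f x)) \<Longrightarrow> g \<in> carr X \<and> nrm X g \<le> nrm X f"
  unfolding quasi_BFS_def quasi_normed_space_def ideal_property_def by blast+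

lemma quasi_BFS_norm:
  fixes X :: "('a, 'k::{real_normed_field, euclidean_space}) fspace"
  assumes X: "quasi_BFS M X" and f: "f \<in> carr X"
  shows "(\<lambda>x. of_real (norm (f x))) \<in> carr X" "nrm X (\<lambda>x. of_real (norm (f x))) = nrm X f"
proof -
  note [measurable] = quasi_BFS_meas[OF X f]
  have m: "(\<lambda>x. of_real (norm (f x)) :: 'k) \<in> borel_measurable M" by measurable
  have 1: "(\<lambda>x. of_real (norm (f x))) \<in> carr X \<and> nrm X (\<lambda>x. of_real (norm (f x))) \<le> nrm X f"
    by (rule quasi_BFS_ideal[OF X f m]) simp
  moreover have "f \<in> carr X \<and> nrm X f \<le> nrm X (\<lambda>x. of_real (norm (f x)))"
    by (rule quasi_BFS_ideal[OF X conjunct1[OF 1]]) auto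
  ultimately show "(\<lambda>x. of_real (norm (f x))) \<in> carr X" "nrm X (\<lambda>x. of_real (norm (f x))) = nrm X f"
    by auto
qed

lemma ball_of_solid:
  fixes X :: "('a, 'k::{real_normed_field, euclidean_space}) fspace"
  assumes X: "quasi_BFS M X"
  shows "solid_ball M (ball_of M X)"
  unfolding solid_ball_def
proof (intro conjI ballI allI impI)
  show "ball_of M X \<subseteq> nnfun M" by (auto simp: ball_of_def)
  have "nrm X (\<lambda>x. 0) = 0" using quasi_BFS_nrm_zero[OF X quasi_BFS_zero[OF X]] by simp
  then show "(\<lambda>x. 0) \<in> ball_of M X" using quasi_BFS_zero[OF X] by (auto simp: ball_of_def)
  show "v \<in> ball_of M X" if u: "u \<in> ball_of M X" and v: "v \<in> nnfun M" and vu: "AE x in M. v x \<le> u x"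
    for u v
  proof -
    have "(\<lambda>x. of_real (v x)) \<in> carr X \<and> nrm X (\<lambda>x. of_real (v x)) \<le> nrm X (\<lambda>x. of_real (u x))"
    proof (rule quasi_BFS_ideal[OF X])
      show "(\<lambda>x. of_real (u x)) \<in> carr X" using u by (simp add: ball_of_def)
      show "(\<lambda>x. of_real (v x) :: 'k) \<in> borel_measurable M" using v by (auto simp: nnfun_def)
      show "AE x in M. norm (of_real (v x) :: 'k) \<le> norm (of_real (u x) :: 'k)"
        using vu by eventually_elim (use nnfun_nonneg[OF v] in auto)
    qed
    with u v show ?thesis by (auto simp: ball_of_def)
  qed
  show "v \<in> ball_of M X"
    if v: "v \<in> nnfun M" and *: "(\<forall>n::nat. U n \<in> ball_of M X) \<and> (AE x in M. incseq (\<lambda>n. U n x)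
        \<and> (\<lambda>n. U n x) \<longlonglongrightarrow> v x)" for U v
  proof -
    have U: "U n \<in> nnfun M" "(\<lambda>x. of_real (U n x)) \<in> carr X" "nrm X (\<lambda>x. of_real (U n x)) \<le> 1" for n
      using * by (auto simp: ball_of_def)
    have "(\<lambda>x. of_real (v x)) \<in> carr X \<and> nrm X (\<lambda>x. of_real (v x))
        = (SUP n. nrm X (\<lambda>x. of_real (U n x)))"
    proof (rule X[unfolded quasi_BFS_def fatou_property_def, THEN conjunct2, THEN conjunct2, THEN
        conjunct1, rule_format], intro conjI allI)
      show "bdd_above (range (\<lambda>n. nrm X (\<lambda>x. of_real (U n x))))" using U(3) by (intro bdd_aboveI2)
      show "v \<in> borel_measurable M" using v by (simp add: nnfun_def)
      show "AE x in M. (\<forall>n. 0 \<le> U n x) \<and> incseq (\<lambda>n. U n x) \<and> (\<lambda>n. U n x) \<longlonglongrightarrow> v x"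
        using *[THEN conjunct2] by eventually_elim (simp add: nnfun_nonneg[OF U(1)])
    qed (rule U)
    moreover have "(SUP n. nrm X (\<lambda>x. of_real (U n x))) \<le> 1" by (rule cSUP_least) (auto simp: U)
    ultimately show ?thesis using v by (auto simp: ball_of_def)
  qed
  show "\<exists>u\<in>ball_of M X. \<not> (AE x in M. x \<in> A \<longrightarrow> u x = 0)" if A: "A \<in> sets M" and A0: "0
      < emeasure M A" for A
  proof -
    obtain F where F: "F \<in> sets M" "F \<subseteq> A" "0 < emeasure M F" "indicator F \<in> carr X"
      using X A A0 unfolding quasi_BFS_def saturation_property_def by blast
    define c where "c = nrm X (indicator F)"
    have c: "0 \<le> c" unfolding c_def by (rule quasi_BFS_nrm_nonneg[OF X F(4)])
    define u where "u x = indicator F x / (c + 1)" for x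
    have e: "(\<lambda>x. of_real (u x)) = (\<lambda>x. of_real (1 / (c + 1)) * indicator F x :: 'k)"
      by (auto simp: u_def fun_eq_iff indicator_def)
    have n: "norm (of_real (1 / (c + 1)) :: 'k) = 1 / (c + 1)" using c by (simp only: norm_of_real)
        simp
    have "nrm X (\<lambda>x. of_real (u x)) = c / (c + 1)"
      unfolding e quasi_BFS_nrm_scale[OF X F(4)] n by (simp add: c_def)
    moreover have "(\<lambda>x. of_real (u x)) \<in> carr X" unfolding e by (rule quasi_BFS_scale[OF X F(4)])
    moreover have "u \<in> nnfun M" using F(1) c unfolding u_def[abs_def] by (auto intro!: nnfunI)
    ultimately have "u \<in> ball_of M X" using c by (simp add: ball_of_def)
    moreover have "\<not> (AE x in M. x \<in> A \<longrightarrow> u x = 0)"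
    proof
      assume "AE x in M. x \<in> A \<longrightarrow> u x = 0"
      then have "AE x in M. x \<notin> F" by eventually_elim (use F(2) c in \<open>auto simp: u_def\<close>)
      then have "F \<in> null_sets M" using F(1) by (simp add: AE_iff_null_sets)
      with F(3) show False by (simp add: null_sets_def)
    qed
    ultimately show ?thesis by blast
  qed
  show "AE x in M. u x = 0" if u: "u \<in> nnfun M" and n: "\<forall>n::nat. (\<lambda>x. real n * u x) \<in> ball_of M X"
    for u
  proof -
    have uX: "(\<lambda>x. of_real (u x)) \<in> carr X" using n[rule_format, of 1] by (simp add: ball_of_def)
    have le: "real n * nrm X (\<lambda>x. of_real (u x)) \<le> 1" for n
      using n[rule_format, of n] quasi_BFS_nrm_scale[OF X uX, of "of_nat n"]
      by (simp add: ball_of_def)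
    have "nrm X (\<lambda>x. of_real (u x)) = 0"
    proof (rule ccontr)
      assume "nrm X (\<lambda>x. of_real (u x)) \<noteq> 0"
      then have p: "0 < nrm X (\<lambda>x. of_real (u x))" using quasi_BFS_nrm_nonneg[OF X uX] by linarith
      obtain n :: nat where "1 / nrm X (\<lambda>x. of_real (u x)) < n" using reals_Archimedean2 by blast
      with le[of n] p show False by (simp add: field_simps)
    qed
    with quasi_BFS_nrm_zero[OF X uX] show ?thesis by simp
  qed
qed

text \<open>
  Homogeneity of the quasi-norm, and its dependence on the modulus, make it the gauge of the ball.
\<close>

lemma ball_of_represents:
  fixes X :: "('a, 'k::{real_normed_field, euclidean_space}) fspace"
  assumes X: "quasi_BFS M X"
  shows "represents M X (ball_of M X)"
proof -
  have scale: "(\<lambda>x. norm (f x) / c) \<in> ball_of M X \<longleftrightarrow> nrm X f \<le> c" if f: "f \<in> carr X" and c: "0 < c"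
    for f c
  proof -
    note n = quasi_BFS_norm[OF X f]
    have e: "(\<lambda>x. of_real (norm (f x) / c)) = (\<lambda>x. of_real (1 / c) * of_real (norm (f x)) :: 'k)"
      by (simp add: fun_eq_iff)
    have nc: "norm (of_real (1 / c) :: 'k) = 1 / c" using c by (simp only: norm_of_real) simp
    have 1: "(\<lambda>x. of_real (norm (f x) / c)) \<in> carr X" unfolding e by (rule quasi_BFS_scale[OF X n(1)])
    have 2: "nrm X (\<lambda>x. of_real (norm (f x) / c)) = nrm X f / c"
      unfolding e quasi_BFS_nrm_scale[OF X n(1)] n(2) nc by simp
    have "(\<lambda>x. norm (f x) / c) \<in> nnfun M" using quasi_BFS_meas[OF X f] c by (auto intro!: nnfunI)
    then show ?thesis using 1 2 c by (simp add: ball_of_def)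
  qed
  have "carr X = {f \<in> borel_measurable M. \<exists>c>0. (\<lambda>x. norm (f x) / c) \<in> ball_of M X}"
  proof (intro equalityI subsetI CollectI conjI)
    fix f assume f: "f \<in> carr X"
    show "f \<in> borel_measurable M" by (rule quasi_BFS_meas[OF X f])
    have "0 < nrm X f + 1" using quasi_BFS_nrm_nonneg[OF X f] by simp
    with scale[OF f this] show "\<exists>c>0. (\<lambda>x. norm (f x) / c) \<in> ball_of M X"
      by (intro exI[of _ "nrm X f + 1"]) simp
  next
    fix f :: "'a \<Rightarrow> 'k" assume "f \<in> {f \<in> borel_measurable M. \<exists>c>0. (\<lambda>x. norm (f x) / c) \<in> ball_of M X}"
    then obtain c where f: "f \<in> borel_measurable M" and c: "0 < c" "(\<lambda>x. of_real (norm (f x) / c))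
        \<in> carr X"
      by (auto simp: ball_of_def)
    from quasi_BFS_scale[OF X c(2), of "of_real c"]
    have "(\<lambda>x. of_real (norm (f x))) \<in> carr X" using c(1) by simp
    from quasi_BFS_ideal[OF X this f] show "f \<in> carr X" by simp
  qed
  then show ?thesis unfolding represents_def using scale quasi_BFS_nrm_nonneg[OF X] by blast
qed

lemma representsD:
  assumes "represents M E B"
  shows "f \<in> carr E \<Longrightarrow> f \<in> borel_measurable M"
    and "f \<in> carr E \<Longrightarrow> \<exists>c>0. (\<lambda>x. norm (f x) / c) \<in> B"
    and "f \<in> borel_measurable M \<Longrightarrow> 0 < c \<Longrightarrow> (\<lambda>x. norm (f x) / c) \<in> B \<Longrightarrow> f \<in> carr E"
    and "f \<in> carr E \<Longrightarrow> 0 \<le> nrm E f"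
    and "f \<in> carr E \<Longrightarrow> 0 < c \<Longrightarrow> nrm E f \<le> c \<longleftrightarrow> (\<lambda>x. norm (f x) / c) \<in> B"
  using assms unfolding represents_def by blast+

lemma represents_of_real:
  fixes E :: "('a, 'k::{real_normed_field, euclidean_space}) fspace"
  assumes E: "represents M E B" and B: "B \<subseteq> nnfun M" and u: "u \<in> B"
  shows "(\<lambda>x. of_real (u x)) \<in> carr E" "nrm E (\<lambda>x. of_real (u x)) \<le> 1"
proof -
  have un: "u \<in> nnfun M" using u B by blast
  have e: "(\<lambda>x. norm (of_real (u x) :: 'k) / 1) = u" using nnfun_nonneg[OF un] by auto
  have m: "(\<lambda>x. of_real (u x) :: 'k) \<in> borel_measurable M" using nnfun_measurable[OF un] by measurable
  show c: "(\<lambda>x. of_real (u x)) \<in> carr E"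
    by (rule representsD(3)[OF E m, of 1]) (use u e in auto)
  show "nrm E (\<lambda>x. of_real (u x)) \<le> 1"
    using representsD(5)[OF E c, of 1] u e by simp
qed

lemma represents_unique:
  fixes E F :: "('a, 'k::{real_normed_field, euclidean_space}) fspace"
  assumes E: "represents M E B" "B \<subseteq> nnfun M" and F: "represents M F C" "C \<subseteq> nnfun M"
      and eq: "fspace_eq E F"
  shows "B = C"
proof -
  have "B \<subseteq> C" if E: "represents M E B" "B \<subseteq> nnfun M" and F: "represents M F C"
      and eq: "fspace_eq E F"
    for E F :: "('a, 'k) fspace" and B C
  proof
    fix u assume u: "u \<in> B"
    then have un: "u \<in> nnfun M" using E by blast
    have e: "(\<lambda>x. norm (of_real (u x) :: 'k) / 1) = u" using nnfun_nonneg[OF un] by auto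
    have 1: "(\<lambda>x. of_real (u x)) \<in> carr F" "nrm F (\<lambda>x. of_real (u x)) \<le> 1"
      using represents_of_real[OF E u] eq by (auto simp: fspace_eq_def)
    show "u \<in> C" using representsD(5)[OF F 1(1), of 1] 1(2) unfolding e by simp
  qed
  from this[OF E F(1) eq] this[OF F E(1)] eq show ?thesis by (auto simp: fspace_eq_def)
qed

lemma represents_scale:
  fixes E :: "('a, 'k::{real_normed_field, euclidean_space}) fspace"
  assumes E: "represents M E B" and B: "solid_ball M B" and f: "f \<in> carr E"
  shows "(\<lambda>x. c * f x) \<in> carr E"
proof -
  obtain d where d: "0 < d" "(\<lambda>x. norm (f x) / d) \<in> B" using representsD(2)[OF E f] by blast
  note [measurable] = representsD(1)[OF E f]
  have m: "(\<lambda>x. c * f x) \<in> borel_measurable M" by measurable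
  have p: "0 < d * (norm c + 1)" using d by (simp add: add_nonneg_pos)
  have "norm (c * f x) / (d * (norm c + 1)) \<le> norm (f x) / d" for x
  proof -
    have "norm (c * f x) / (d * (norm c + 1)) = norm (f x) / d * (norm c / (norm c + 1))"
      by (simp add: norm_mult)
    also have "\<dots> \<le> norm (f x) / d * 1" using d by (intro mult_left_mono) (auto
        simp: divide_le_eq_1 add_nonneg_pos)
    finally show ?thesis by simp
  qed
  then have "(\<lambda>x. norm (c * f x) / (d * (norm c + 1))) \<in> B"
    by (intro solid_ball_solid[OF B d(2)]) (use p in \<open>auto intro!: nnfunI\<close>)
  then show ?thesis by (rule representsD(3)[OF E m p])
qed

lemma represents_add:
  fixes E :: "('a, 'k::{real_normed_field, euclidean_space}) fspace"
  assumes E: "represents M E B" and B: "solid_ball M B" "convex_ball B" and f: "f \<in> carr E"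
      and g: "g \<in> carr E"
  shows "(\<lambda>x. f x + g x) \<in> carr E"
proof -
  obtain d where d: "0 < d" "(\<lambda>x. norm (f x) / d) \<in> B" using representsD(2)[OF E f] by blast
  obtain e where e: "0 < e" "(\<lambda>x. norm (g x) / e) \<in> B" using representsD(2)[OF E g] by blast
  note [measurable] = representsD(1)[OF E f] representsD(1)[OF E g]
  have m: "(\<lambda>x. f x + g x) \<in> borel_measurable M" by measurable
  have p: "0 < d + e" using d e by simp
  have *: "(\<lambda>x. d / (d + e) * (norm (f x) / d) + (1 - d / (d + e)) * (norm (g x) / e)) \<in> B"
    by (rule convex_ballD[OF B(2) d(2) e(2)]) (use d e in auto)
  have "norm (f x + g x) / (d + e) \<le> d / (d + e) * (norm (f x) / d) + (1 - d / (d + e))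
      * (norm (g x) / e)" for x
  proof -
    have "1 - d / (d + e) = e / (d + e)" using p by (simp add: field_simps)
    then have "d / (d + e) * (norm (f x) / d) + (1 - d / (d + e)) * (norm (g x) / e)
        = (norm (f x) + norm (g x)) / (d + e)"
      using d e by (simp add: add_divide_distrib)
    then show ?thesis using p by (simp add: divide_right_mono norm_triangle_ineq)
  qed
  then have "(\<lambda>x. norm (f x + g x) / (d + e)) \<in> B"
    by (intro solid_ball_solid[OF B(1) *]) (use p in \<open>auto intro!: nnfunI\<close>)
  then show ?thesis by (rule representsD(3)[OF E m p])
qed

lemma represents_nrm_zero:
  fixes E :: "('a, 'k::{real_normed_field, euclidean_space}) fspace"
  assumes E: "represents M E B" and B: "solid_ball M B" and f: "f \<in> carr E"
  shows "nrm E f = 0 \<longleftrightarrow> (AE x in M. f x = 0)"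
proof
  have fm: "f \<in> borel_measurable M" by (rule representsD(1)[OF E f])
  have nf: "(\<lambda>x. norm (f x)) \<in> nnfun M" using fm by auto
  show "AE x in M. f x = 0" if z: "nrm E f = 0"
  proof -
    have "AE x in M. norm (f x) = 0"
    proof (rule solid_ball_bounded[OF B nf])
      fix n :: nat
      have "(\<lambda>x. norm (f x) / (1 / real (Suc n))) \<in> B" using representsD(5)[OF E f,
          of "1 / real (Suc n)"] z by simp
      then show "(\<lambda>x. real n * norm (f x)) \<in> B"
        by (rule solid_ball_solid[OF B]) (use fm in \<open>auto simp: algebra_simps intro!: nnfunI\<close>)
    qed
    then show ?thesis by simp
  qed
  show "nrm E f = 0" if z: "AE x in M. f x = 0"
  proof -
    have "nrm E f \<le> c" if "0 < c" for c
    proof -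
      have "(\<lambda>x. norm (f x) / c) \<in> B"
        by (rule solid_ball_solid[OF B solid_ball_zero[OF B]]) (use fm z that in \<open>auto
            intro!: nnfunI\<close>)
      then show ?thesis using representsD(5)[OF E f that] by simp
    qed
    then have "nrm E f \<le> 0" by (metis dense_ge)
    with representsD(4)[OF E f] show ?thesis by simp
  qed
qed

lemma represents_power_space:
  fixes E :: "('a, 'k::{real_normed_field, euclidean_space}) fspace"
  assumes E: "represents M E B" and p: "0 < p"
  shows "represents M (power_space M p E) (power_ball M p B)"
proof -
  let ?q = "\<lambda>f x. of_real (norm (f x) powr (1 / p)) :: 'k"
  have qm: "?q f \<in> borel_measurable M" if "f \<in> borel_measurable M" for f :: "'a \<Rightarrow> 'k" using that
    by measurable
  have mem: "(\<lambda>x. norm (f x) / c) \<in> power_ball M p B \<longleftrightarrow> (\<lambda>x. norm (?q f x) / c powr (1 / p)) \<in> B"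
    if "f \<in> borel_measurable M" "0 < c" for f :: "'a \<Rightarrow> 'k" and c
    using that by (auto simp: power_ball_def powr_divide intro!: nnfunI)
  have carr: "carr (power_space M p E) = {f \<in> borel_measurable M. ?q f \<in> carr E}"
    and nrm: "nrm (power_space M p E) f = nrm E (?q f) powr p" for f
    by (simp_all add: power_space_def)
  show ?thesis
    unfolding represents_def
  proof (intro conjI ballI allI impI)
    have "?q f \<in> carr E \<longleftrightarrow> (\<exists>c>0. (\<lambda>x. norm (f x) / c) \<in> power_ball M p B)"
      if f: "f \<in> borel_measurable M" for f :: "'a \<Rightarrow> 'k"
    proof
      assume "?q f \<in> carr E"
      then obtain c where c: "0 < c" "(\<lambda>x. norm (?q f x) / c) \<in> B" using representsD(2)[OF E] by blast
      then show "\<exists>c>0. (\<lambda>x. norm (f x) / c) \<in> power_ball M p B"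
        using mem[OF f, of "c powr p"] p by (intro exI[of _ "c powr p"]) (simp add: powr_powr)
    next
      assume "\<exists>c>0. (\<lambda>x. norm (f x) / c) \<in> power_ball M p B"
      then obtain c where c: "0 < c" "(\<lambda>x. norm (f x) / c) \<in> power_ball M p B" by blast
      with mem[OF f c(1)] show "?q f \<in> carr E"
        by (intro representsD(3)[OF E qm[OF f], of "c powr (1 / p)"]) auto
    qed
    then show "carr (power_space M p E) = {f \<in> borel_measurable M. \<exists>c>0. (\<lambda>x. norm (f x) / c)
        \<in> power_ball M p B}"
      unfolding carr by blast
  next
    fix f assume "f \<in> carr (power_space M p E)"
    then have f: "f \<in> borel_measurable M" and qf: "?q f \<in> carr E" by (auto simp: carr)
    show "0 \<le> nrm (power_space M p E) f" by (simp add: nrm)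
    fix c :: real assume c: "0 < c"
    have n0: "0 \<le> nrm E (?q f)" by (rule representsD(4)[OF E qf])
    have "nrm E (?q f) powr p \<le> c \<longleftrightarrow> nrm E (?q f) \<le> c powr (1 / p)"
    proof
      assume "nrm E (?q f) powr p \<le> c"
      then have "(nrm E (?q f) powr p) powr (1 / p) \<le> c powr (1 / p)" using p
        by (intro powr_mono2) auto
      then show "nrm E (?q f) \<le> c powr (1 / p)" using p n0 by (simp add: powr_powr)
    next
      assume "nrm E (?q f) \<le> c powr (1 / p)"
      then have "nrm E (?q f) powr p \<le> (c powr (1 / p)) powr p" using p n0 by (intro powr_mono2) auto
      then show "nrm E (?q f) powr p \<le> c" using p c by (simp add: powr_powr)
    qed
    then show "nrm (power_space M p E) f \<le> c \<longleftrightarrow> (\<lambda>x. norm (f x) / c) \<in> power_ball M p B"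
      unfolding nrm mem[OF f c] using representsD(5)[OF E qf, of "c powr (1 / p)"] c by simp
  qed
qed

text \<open>
  Two facts hide in this statement.  Elements of the Koethe dual are bounded functionals: otherwise
  there are \<open>u\<^sub>n\<close> in \<open>B\<close> with \<open>\<integral> u\<^sub>n |g| \<ge> 4\<^bsup>n+1\<^esup>\<close>, and their dyadic sum is not integrable against \<open>g\<close>.
  And the supremum over the unit sphere, which defines the dual norm, equals the supremum over the
  unit ball, since members of norm zero vanish a.e. and the others can be normalized.
\<close>

lemma represents_koethe_dual:
  fixes E :: "('a, 'k::{real_normed_field, euclidean_space}) fspace"
  assumes E: "represents M E B" and B: "solid_ball M B" and cB: "convex_ball B"
  shows "represents M (koethe_dual M E) (polar M B)"
proof -
  have Bn: "B \<subseteq> nnfun M" using B by (auto simp: solid_ball_def)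
  let ?D = "koethe_dual M E"
  let ?S = "\<lambda>g. SUP f\<in>{f \<in> carr E. nrm E f = 1}. \<integral>\<^sup>+x. ennreal (norm (f x * g x)) \<partial>M"
  have carr: "carr ?D = {g \<in> borel_measurable M. \<forall>f\<in>carr E. integrable M (\<lambda>x. f x * g x)}"
    and nrm: "nrm ?D g = enn2real (?S g)" for g by (simp_all add: koethe_dual_def)
  have pair: "(\<integral>\<^sup>+x. ennreal (norm (f x * g x)) \<partial>M) \<le> ennreal (c * d)"
    if "f \<in> borel_measurable M" "g \<in> borel_measurable M"
      "(\<lambda>x. norm (f x) / d) \<in> B" "(\<lambda>x. norm (g x) / c) \<in> polar M B" "0 < c"
          "0 < d" for f g :: "'a \<Rightarrow> 'k" and c d
  proof -
    note [measurable] = that(1,2)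
    have "(\<integral>\<^sup>+x. ennreal (norm (f x * g x)) \<partial>M) = (\<integral>\<^sup>+x. ennreal (c * d) * ennreal (norm (f x) / d
        * (norm (g x) / c)) \<partial>M)"
      using that(5,6) by (intro nn_integral_cong) (simp add: ennreal_mult[symmetric] norm_mult)
    also have "\<dots> = ennreal (c * d) * (\<integral>\<^sup>+x. ennreal (norm (f x) / d * (norm (g x) / c)) \<partial>M)"
      by (simp add: nn_integral_cmult)
    also have "\<dots> \<le> ennreal (c * d) * 1" by (intro mult_left_mono polarD[OF that(4,3)]) simp
    finally show ?thesis by simp
  qed
  \<comment> \<open>A gliding hump: unboundedness on the ball yields a member of \<open>E\<close> whose product with \<open>g\<close> is not integrable.\<close>
  have fwd: "\<exists>c>0. (\<lambda>x. norm (g x) / c) \<in> polar M B" if g: "g \<in> carr ?D" for g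
  proof (rule ccontr)
    assume no: "\<not> ?thesis"
    have gm [measurable]: "g \<in> borel_measurable M" using g by (simp add: carr)
    have "\<exists>u. u \<in> B \<and> ennreal (4 ^ Suc n) \<le> (\<integral>\<^sup>+x. ennreal (u x * norm (g x)) \<partial>M)" for n :: nat
    proof -
      have "(\<lambda>x. norm (g x) / 4 ^ Suc n) \<notin> polar M B" using no by auto
      moreover have "(\<lambda>x. norm (g x) / 4 ^ Suc n) \<in> nnfun M" by (rule nnfunI) auto
      ultimately obtain u where u: "u \<in> B" "\<not> (\<integral>\<^sup>+x. ennreal (u x * (norm (g x) / 4 ^ Suc n)) \<partial>M) \<le> 1"
        by (auto simp: polar_def)
      have un: "u \<in> nnfun M" using u Bn by blast
      note [measurable] = nnfun_measurable[OF un]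
      have "ennreal (4 ^ Suc n) * 1 \<le> ennreal (4 ^ Suc n)
          * (\<integral>\<^sup>+x. ennreal (u x * (norm (g x) / 4 ^ Suc n)) \<partial>M)"
        using u(2) by (intro mult_left_mono) auto
      also have "\<dots> = (\<integral>\<^sup>+x. ennreal (u x * norm (g x)) \<partial>M)"
        using nnfun_nonneg[OF un]
        by (subst nn_integral_cmult[symmetric]) (auto simp: ennreal_mult[symmetric]
            simp del: power_Suc ennreal_power intro!: nn_integral_cong)
      finally show ?thesis using u(1) by auto
    qed
    then have "\<forall>n. \<exists>u. u \<in> B \<and> ennreal (4 ^ Suc n) \<le> (\<integral>\<^sup>+x. ennreal (u x * norm (g x)) \<partial>M)" by blast
    from choice[OF this] obtain U where U: "\<And>n. U n \<in> B" "\<And>n. ennreal (4 ^ Suc n)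
        \<le> (\<integral>\<^sup>+x. ennreal (U n x * norm (g x)) \<partial>M)" by blast
    have U0: "0 \<le> U n x" and [measurable]: "U n \<in> borel_measurable M" for n x using U(1)[of n] Bn
      by (auto simp: nnfun_def)
    obtain v where v: "v \<in> B" "AE x in M. (\<lambda>k. U k x / 2 ^ Suc k) sums v x"
      using dyadic_sum_mem[OF B cB, of U] U(1) by blast
    have vn: "v \<in> nnfun M" using v Bn by blast
    have "integrable M (\<lambda>x. of_real (v x) * g x)" using g represents_of_real(1)[OF E Bn v(1)]
      by (simp add: carr)
    then have "(\<integral>\<^sup>+x. ennreal (norm (of_real (v x) * g x)) \<partial>M) < \<infinity>"
      by (simp add: integrable_iff_bounded)
    moreover have "norm (of_real (v x) * g x) = v x * norm (g x)" for x using nnfun_nonneg[OF vn]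
      by (simp add: norm_mult)
    ultimately have "(\<integral>\<^sup>+x. ennreal (v x * norm (g x)) \<partial>M) < \<infinity>" by simp
    then obtain R where R: "0 \<le> R" "(\<integral>\<^sup>+x. ennreal (v x * norm (g x)) \<partial>M) = ennreal R"
      by (metis ennreal_cases less_irrefl infinity_ennreal_def)
    have "2 ^ Suc n \<le> R" for n
    proof -
      have "ennreal (4 ^ Suc n) \<le> (\<integral>\<^sup>+x. ennreal (2 ^ Suc n) * ennreal (v x * norm (g x)) \<partial>M)"
      proof (rule order_trans[OF U(2) nn_integral_mono_AE])
        show "AE x in M. ennreal (U n x * norm (g x)) \<le> ennreal (2 ^ Suc n) * ennreal (v x
            * norm (g x))"
          using v(2)
        proof eventually_elim
          case (elim x)
          have "U n x / 2 ^ Suc n \<le> (\<Sum>k. U k x / 2 ^ Suc k)"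
            using elim sum_le_suminf[of "\<lambda>k. U k x / 2 ^ Suc k" "{n}"] U0 by (auto simp: sums_iff)
          then have "U n x / 2 ^ Suc n \<le> v x" using elim by (simp add: sums_iff)
          then have "U n x \<le> 2 ^ Suc n * v x" by (simp add: field_simps)
          then have "U n x * norm (g x) \<le> 2 ^ Suc n * (v x * norm (g x))"
            by (metis mult.assoc mult_right_mono norm_ge_zero)
          then show ?case using nnfun_nonneg[OF vn, of x]
            by (subst ennreal_mult[symmetric]) (auto intro: ennreal_leI simp del: power_Suc)
        qed
      qed
      also have "\<dots> = ennreal (2 ^ Suc n) * ennreal R" using nnfun_measurable[OF vn]
        by (subst nn_integral_cmult) (auto simp: R)
      also have "\<dots> = ennreal (2 ^ Suc n * R)" using R by (subst ennreal_mult) auto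
      finally have "4 ^ Suc n \<le> 2 ^ Suc n * R" using R by (simp add: ennreal_le_iff
          del: power_Suc ennreal_power)
      moreover have "(4::real) ^ Suc n = 2 ^ Suc n * 2 ^ Suc n" by (simp flip: power_mult_distrib)
      ultimately show ?thesis by (metis mult_le_cancel_left_pos zero_less_numeral zero_less_power)
    qed
    moreover obtain n where "R < 2 ^ n" using real_arch_pow[of 2 R] by auto
    ultimately show False using power_increasing[of n "Suc n" "2::real"]
      by (metis le_SucI order_refl not_le order_trans one_le_numeral)
  qed
  have bwd: "g \<in> carr ?D" if gm: "g \<in> borel_measurable M" and c: "0 < c"
      "(\<lambda>x. norm (g x) / c) \<in> polar M B" for g :: "'a \<Rightarrow> 'k" and c
  proof -
    have "integrable M (\<lambda>x. f x * g x)" if f: "f \<in> carr E" for f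
    proof (rule integrableI_bounded)
      have fm: "f \<in> borel_measurable M" by (rule representsD(1)[OF E f])
      show "(\<lambda>x. f x * g x) \<in> borel_measurable M" using fm gm by measurable
      obtain d where d: "0 < d" "(\<lambda>x. norm (f x) / d) \<in> B" using representsD(2)[OF E f] by blast
      show "(\<integral>\<^sup>+x. ennreal (norm (f x * g x)) \<partial>M) < \<infinity>"
        by (rule order.strict_trans1[OF pair[OF fm gm d(2) c(2) c(1) d(1)]]) simp
    qed
    with gm show ?thesis by (simp add: carr)
  qed
  have sup: "?S g \<le> ennreal c \<longleftrightarrow> (\<lambda>x. norm (g x) / c) \<in> polar M B" if gm: "g \<in> borel_measurable M"
      and c: "0 < c" for g c
  proof
    assume gp: "(\<lambda>x. norm (g x) / c) \<in> polar M B"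
    show "?S g \<le> ennreal c"
    proof (rule SUP_least)
      fix f assume "f \<in> {f \<in> carr E. nrm E f = 1}"
      then have f: "f \<in> carr E" and n: "nrm E f = 1" by auto
      have "(\<lambda>x. norm (f x) / 1) \<in> B" using representsD(5)[OF E f, of 1] n by simp
      from pair[OF representsD(1)[OF E f] gm this gp c] show "(\<integral>\<^sup>+x. ennreal (norm (f x * g x)) \<partial>M)
          \<le> ennreal c" by simp
    qed
  next
    assume S: "?S g \<le> ennreal c"
    note [measurable] = gm
    have "(\<integral>\<^sup>+x. ennreal (u x * (norm (g x) / c)) \<partial>M) \<le> 1" if u: "u \<in> B" for u
    proof -
      have un: "u \<in> nnfun M" using u Bn by blast
      note [measurable] = nnfun_measurable[OF un] and u0 = nnfun_nonneg[OF un]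
      let ?f = "\<lambda>x. of_real (u x) :: 'k"
      note f = represents_of_real[OF E Bn u]
      define n where "n = nrm E ?f"
      have n0: "0 \<le> n" "n \<le> 1" using f representsD(4)[OF E f(1)] by (auto simp: n_def)
      show ?thesis
      proof (cases "n = 0")
        case True
        then have "AE x in M. u x = 0" using represents_nrm_zero[OF E B f(1)] by (simp add: n_def)
        then have "(\<integral>\<^sup>+x. ennreal (u x * (norm (g x) / c)) \<partial>M) = (\<integral>\<^sup>+x. 0 \<partial>M)"
          by (intro nn_integral_cong_AE) auto
        then show ?thesis by simp
      next
        case False
        with n0 have np: "0 < n" by simp
        let ?h = "\<lambda>x. of_real (u x / n) :: 'k"
        have hm: "?h \<in> borel_measurable M" by measurable
        have hB: "(\<lambda>x. norm (?h x) / d) \<in> B \<longleftrightarrow> (\<lambda>x. norm (?f x) / (n * d)) \<in> B" for d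
          unfolding norm_of_real by (simp add: abs_divide less_imp_le[OF np] abs_of_nonneg n0)
        have h: "?h \<in> carr E"
          using representsD(5)[OF E f(1) np] hB[of 1] by (intro representsD(3)[OF E hm, of 1]) (auto
              simp: n_def)
        have hle: "nrm E ?h \<le> d \<longleftrightarrow> 1 \<le> d" if d: "0 < d" for d
          using representsD(5)[OF E h d] representsD(5)[OF E f(1), of "n * d"] hB[of d] np d
          by (simp add: n_def[symmetric])
        have "nrm E ?h = 1"
        proof (rule antisym)
          show "nrm E ?h \<le> 1" using hle[of 1] by simp
          show "1 \<le> nrm E ?h"
          proof -
            have "0 < max (nrm E ?h) (1/2)" by (simp add: less_max_iff_disj)
            from hle[OF this] have "1 \<le> max (nrm E ?h) (1/2)" by (metis max.cobounded1)
            then show ?thesis unfolding le_max_iff_disj by simp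
          qed
        qed
        with h have "(\<integral>\<^sup>+x. ennreal (norm (?h x * g x)) \<partial>M) \<le> ?S g" by (intro SUP_upper) auto
        with S have le: "(\<integral>\<^sup>+x. ennreal (norm (?h x * g x)) \<partial>M) \<le> ennreal c"
          by (rule order_trans[rotated])
        have "(\<integral>\<^sup>+x. ennreal (u x * (norm (g x) / c)) \<partial>M)
            = (\<integral>\<^sup>+x. ennreal (n / c) * ennreal (norm (?h x * g x)) \<partial>M)"
        proof (intro nn_integral_cong)
          fix x
          have "norm (?h x * g x) = u x / n * norm (g x)" unfolding norm_mult norm_of_real
            using u0[of x] np by simp
          then show "ennreal (u x * (norm (g x) / c)) = ennreal (n / c) * ennreal (norm (?h x * g x))"
            using u0[of x] np c by (simp add: ennreal_mult[symmetric])
        qed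
        also have "\<dots> = ennreal (n / c) * (\<integral>\<^sup>+x. ennreal (norm (?h x * g x)) \<partial>M)"
          by (simp add: nn_integral_cmult)
        also have "\<dots> \<le> ennreal (n / c) * ennreal c" by (intro mult_left_mono le) simp
        also have "\<dots> = ennreal n" using c np by (simp add: ennreal_mult[symmetric])
        also have "\<dots> \<le> 1" using n0 by (simp add: ennreal_le_1)
        finally show ?thesis .
      qed
    qed
    then show "(\<lambda>x. norm (g x) / c) \<in> polar M B" using c by (auto simp: polar_def intro!: nnfunI)
  qed
  show ?thesis
    unfolding represents_def
  proof (intro conjI ballI allI impI)
    show "carr ?D = {f \<in> borel_measurable M. \<exists>c>0. (\<lambda>x. norm (f x) / c) \<in> polar M B}"
      using fwd bwd by (auto simp: carr)
    fix g assume g: "g \<in> carr ?D"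
    then have gm: "g \<in> borel_measurable M" by (simp add: carr)
    show "0 \<le> nrm ?D g" by (simp add: nrm)
    fix c :: real assume c: "0 < c"
    obtain c0 where c0: "0 < c0" "(\<lambda>x. norm (g x) / c0) \<in> polar M B" using fwd[OF g] by blast
    then have "?S g \<le> ennreal c0" using sup[OF gm] by blast
    then have "?S g < \<infinity>" by (rule order.strict_trans1) simp
    then have S: "ennreal (enn2real (?S g)) = ?S g" by (intro ennreal_enn2real) simp
    have "enn2real (?S g) \<le> c \<longleftrightarrow> ?S g \<le> ennreal c"
      using ennreal_le_iff[OF less_imp_le[OF c], of "enn2real (?S g)"] unfolding S by blast
    then show "nrm ?D g \<le> c \<longleftrightarrow> (\<lambda>x. norm (g x) / c) \<in> polar M B"
      unfolding nrm using sup[OF gm c] by blast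
  qed
qed

section \<open>Convex and concave spaces\<close>

text \<open>
  The \<open>r\<close>-convexity of \<open>X\<close> is the triangle inequality in \<open>X\<^sup>r\<close>.
\<close>

lemma power_ball_convex_of_fs_convex:
  fixes X :: "('a, 'k::{real_normed_field, euclidean_space}) fspace"
  assumes X: "quasi_BFS M X" and r: "0 < r" and conv: "fs_convex r X"
  shows "convex_ball (power_ball M r (ball_of M X))"
  unfolding convex_ball_def
proof (intro ballI allI impI)
  fix u v and c :: real
  assume u: "u \<in> power_ball M r (ball_of M X)" and v: "v \<in> power_ball M r (ball_of M X)" and c: "0
      \<le> c" "c \<le> 1"
  have un: "u \<in> nnfun M" "v \<in> nnfun M" using u v by (auto simp: power_ball_def)
  note u0 = un(1)[THEN nnfun_nonneg] and v0 = un(2)[THEN nnfun_nonneg]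
  note [measurable] = un[THEN nnfun_measurable]
  let ?U = "\<lambda>x. of_real (u x powr (1 / r)) :: 'k" and ?V = "\<lambda>x. of_real (v x powr (1 / r)) :: 'k"
  have UV: "?U \<in> carr X" "nrm X ?U \<le> 1" "?V \<in> carr X" "nrm X ?V \<le> 1"
    using u v by (auto simp: power_ball_def ball_of_def)
  define f where "f x = of_real (c powr (1 / r)) * ?U x" for x
  define g where "g x = of_real ((1 - c) powr (1 / r)) * ?V x" for x
  have f: "f \<in> carr X" and g: "g \<in> carr X" unfolding f_def g_def by (rule quasi_BFS_scale[OF X] UV)+
  have nf: "nrm X f \<le> c powr (1 / r)" and ng: "nrm X g \<le> (1 - c) powr (1 / r)"
    unfolding f_def g_def quasi_BFS_nrm_scale[OF X UV(1)] quasi_BFS_nrm_scale[OF X UV(3)]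
    using mult_left_le[OF UV(2), of "c powr (1 / r)"] mult_left_le[OF UV(4),
        of "(1 - c) powr (1 / r)"] by auto
  have nfx: "norm (f x) powr r = c * u x" and ngx: "norm (g x) powr r = (1 - c) * v x" for x
    using c r u0[of x] v0[of x] by (auto simp: f_def g_def norm_mult powr_mult powr_powr)
  define w where "w x = (c * u x + (1 - c) * v x) powr (1 / r)" for x
  have w: "w \<in> nnfun M" unfolding w_def[abs_def] by (auto intro!: nnfunI)
  have ew: "(\<lambda>x. of_real ((norm (f x) powr r + norm (g x) powr r) powr (1 / r)))
      = (\<lambda>x. of_real (w x) :: 'k)"
    by (simp add: nfx ngx w_def)
  have "nrm X (\<lambda>x. of_real (w x)) \<le> (nrm X f powr r + nrm X g powr r) powr (1 / r)"
    using conv f g unfolding fs_convex_def ew[symmetric] by blast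
  also have "\<dots> \<le> (c + (1 - c)) powr (1 / r)"
  proof (intro powr_mono2 add_mono)
    show "nrm X f powr r \<le> c" "nrm X g powr r \<le> 1 - c"
      using powr_mono2[OF less_imp_le[OF r] quasi_BFS_nrm_nonneg[OF X f] nf]
        powr_mono2[OF less_imp_le[OF r] quasi_BFS_nrm_nonneg[OF X g] ng] r c by (auto simp: powr_powr)
  qed (use r in auto)
  finally have "nrm X (\<lambda>x. of_real (w x)) \<le> 1" by simp
  moreover have "(\<lambda>x. of_real (w x)) \<in> carr X"
  proof -
    let ?K = "2 powr (1 / r)"
    have s: "(\<lambda>x. of_real ?K * (of_real (norm (f x)) + of_real (norm (g x)))) \<in> carr X"
      by (intro quasi_BFS_scale[OF X] quasi_BFS_add[OF X] quasi_BFS_norm[OF X] f g)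
    have "w x \<le> ?K * (norm (f x) + norm (g x))" for x
    proof -
      have "w x = (norm (f x) powr r + norm (g x) powr r) powr (1 / r)" by (simp add: w_def nfx ngx)
      also have "\<dots> \<le> (2 * (norm (f x) + norm (g x)) powr r) powr (1 / r)"
        using r powr_mono2[of r "norm (f x)" "norm (f x) + norm (g x)"] powr_mono2[of r "norm (g x)"
            "norm (f x) + norm (g x)"]
        by (intro powr_mono2) auto
      also have "\<dots> = ?K * (norm (f x) + norm (g x))" using r by (simp add: powr_mult powr_powr)
      finally show ?thesis .
    qed
    then have "AE x in M. norm (of_real (w x) :: 'k)
        \<le> norm (of_real ?K * (of_real (norm (f x)) + of_real (norm (g x))) :: 'k)"
      using nnfun_nonneg[OF w] by (auto simp: norm_mult simp flip: of_real_add)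
    moreover have "(\<lambda>x. of_real (w x) :: 'k) \<in> borel_measurable M" using nnfun_measurable[OF w]
      by measurable
    ultimately show ?thesis using quasi_BFS_ideal[OF X s] by blast
  qed
  ultimately have "w \<in> ball_of M X" using w by (simp add: ball_of_def)
  then show "(\<lambda>x. c * u x + (1 - c) * v x) \<in> power_ball M r (ball_of M X)"
    using c u0 v0 by (auto simp: power_ball_def w_def[abs_def] intro!: nnfunI)
qed

text \<open>
  The duality pairing of \<open>X\<^sup>r\<close> in homogeneous form.
\<close>

lemma polar_power_ball_estimate:
  fixes X :: "('a, 'k::{real_normed_field, euclidean_space}) fspace"
  assumes X: "quasi_BFS M X" and r: "0 < r" and v: "v \<in> nnfun M" "(\<lambda>x. of_real (v x)) \<in> carr X"
    and g: "g \<in> polar M (power_ball M r (ball_of M X))"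
  shows "(\<integral>\<^sup>+x. ennreal (v x powr r * g x) \<partial>M) \<le> ennreal (nrm X (\<lambda>x. of_real (v x)) powr r)"
proof (cases "nrm X (\<lambda>x. of_real (v x)) = 0")
  case True
  then have "AE x in M. v x = 0" using quasi_BFS_nrm_zero[OF X v(2)] by simp
  then have "(\<integral>\<^sup>+x. ennreal (v x powr r * g x) \<partial>M) = (\<integral>\<^sup>+x. 0 \<partial>M)"
    by (intro nn_integral_cong_AE) (auto simp: r)
  then show ?thesis by simp
next
  case False
  define c where "c = nrm X (\<lambda>x. of_real (v x))"
  have c: "0 < c" using False quasi_BFS_nrm_nonneg[OF X v(2)] by (simp add: c_def)
  have gn: "g \<in> nnfun M" by (rule polar_nnfun[OF g])
  note v0 = nnfun_nonneg[OF v(1)] and [measurable] = nnfun_measurable[OF v(1)] nnfun_measurable[OF gn]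
  have "(\<lambda>x. norm (of_real (v x) :: 'k) / c) \<in> ball_of M X"
    using ball_of_represents[OF X] v(2) c unfolding represents_def by (metis c_def order_refl)
  then have vb: "(\<lambda>x. v x / c) \<in> ball_of M X" using v0 by simp
  have "(\<lambda>x. (v x / c) powr r) \<in> power_ball M r (ball_of M X)"
    using vb r c v0 by (auto simp: power_ball_def powr_powr intro!: nnfunI)
  from polarD[OF g this] have "(\<integral>\<^sup>+x. ennreal ((v x / c) powr r * g x) \<partial>M) \<le> 1" .
  then have "ennreal (c powr r) * (\<integral>\<^sup>+x. ennreal ((v x / c) powr r * g x) \<partial>M) \<le> ennreal (c powr r)"
    using mult_left_mono[of _ 1 "ennreal (c powr r)"] by simp
  moreover have "ennreal (c powr r) * (\<integral>\<^sup>+x. ennreal ((v x / c) powr r * g x) \<partial>M)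
      = (\<integral>\<^sup>+x. ennreal (v x powr r * g x) \<partial>M)"
    using c nnfun_nonneg[OF gn] by (subst nn_integral_cmult[symmetric]) (auto
        simp: ennreal_mult[symmetric] powr_divide intro!: nn_integral_cong)
  ultimately show ?thesis by (simp add: c_def)
qed

text \<open>
  For \<open>t = 1/s > 0\<close>, concavity of \<open>X\<close> enters through \<open>power_polar_convex_of_concave\<close>: the two parts
  \<open>u m\<^bsup>rt\<^esup>\<close> and \<open>u (1-m)\<^bsup>rt\<^esup>\<close> of a function \<open>u = v\<^sup>r\<close> are the \<open>r\<close>-th powers of \<open>v m\<^sup>t\<close> and \<open>v (1-m)\<^sup>t\<close>, whose
  moduli to the power \<open>1/t\<close> add up to that of \<open>v\<close>.
\<close>

lemma pre_ball_convex:
  fixes X :: "('a, 'k::{real_normed_field, euclidean_space}) fspace"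
  assumes M: "sigma_finite_measure M" and X: "quasi_BFS M X" and r: "0 < r" and t: "r * t < 1"
    and conv: "fs_convex r X" and conc: "fs_concave t X"
  shows "convex_ball (power_ball M (1 / (1 - r * t)) (polar M (power_ball M r (ball_of M X))))"
proof -
  interpret sigma_finite_measure M by fact
  let ?B = "power_ball M r (ball_of M X)"
  have sB: "solid_ball M ?B" by (rule power_ball_solid[OF ball_of_solid[OF X] r])
  have cB: "convex_ball ?B" by (rule power_ball_convex_of_fs_convex[OF X r conv])
  have Bn: "?B \<subseteq> nnfun M" by (auto simp: power_ball_def)
  show ?thesis
  proof (cases "t \<le> 0")
    case True
    then have "1 \<le> 1 - r * t" using r by (simp add: mult_le_0_iff)
    then show ?thesis
      by (rule power_ball_convex_of_ge_1[OF polar_solid_ball[OF sB cB] polar_convex[OF Bn]])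
  next
    case False
    then have t0: "0 < t" by simp
    show ?thesis
    proof (rule power_polar_convex_of_concave[OF Bn])
      show "0 < 1 - r * t" "1 - r * t < 1" using t t0 r by auto
      fix u m assume u: "u \<in> ?B" and m: "m \<in> nnfun M" and m1: "\<And>x. m x \<le> 1"
      have un: "u \<in> nnfun M" and ub: "(\<lambda>x. of_real (u x powr (1 / r))) \<in> carr X"
          "nrm X (\<lambda>x. of_real (u x powr (1 / r))) \<le> 1"
        using u by (auto simp: power_ball_def ball_of_def)
      note [measurable] = nnfun_measurable[OF un] nnfun_measurable[OF m]
      note u0 = nnfun_nonneg[OF un] and m0 = nnfun_nonneg[OF m]
      define v where "v k x = u x powr (1 / r) * k x powr t" for k :: "'a \<Rightarrow> real" and x
      have v: "v k \<in> nnfun M" "(\<lambda>x. of_real (v k x)) \<in> carr X" if [measurable]: "k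
          \<in> borel_measurable M" and k: "\<And>x. 0 \<le> k x" "\<And>x. k x \<le> 1" for k
      proof -
        show vn: "v k \<in> nnfun M" unfolding v_def[abs_def] by (auto intro!: nnfunI)
        have "k x powr t \<le> 1" for x using k[of x] t0 powr_mono2[of t "k x" 1] by simp
        then have "AE x in M. norm (of_real (v k x) :: 'k) \<le> norm (of_real (u x powr (1 / r)) :: 'k)"
          unfolding norm_of_real by (simp add: v_def mult_left_le abs_mult)
        moreover have "(\<lambda>x. of_real (v k x) :: 'k) \<in> borel_measurable M"
          using nnfun_measurable[OF vn] by measurable
        ultimately show "(\<lambda>x. of_real (v k x)) \<in> carr X" using quasi_BFS_ideal[OF X ub(1)] by blast
      qed
      have est: "(\<integral>\<^sup>+x. ennreal (u x * k x powr (1 - (1 - r * t)) * g x) \<partial>M)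
          \<le> ennreal ((nrm X (\<lambda>x. of_real (v k x)) powr (1 / t)) powr (1 - (1 - r * t)))"
        if [measurable]: "k \<in> borel_measurable M" and k: "\<And>x. 0 \<le> k x" "\<And>x. k x \<le> 1"
            and g: "g \<in> polar M ?B" for k g
      proof -
        have "v k x powr r = u x * k x powr (1 - (1 - r * t))" for x
          using r u0[of x] by (simp add: v_def powr_mult powr_powr mult.commute)
        moreover have "(nrm X (\<lambda>x. of_real (v k x)) powr (1 / t)) powr (1 - (1 - r * t))
            = nrm X (\<lambda>x. of_real (v k x)) powr r"
          using t0 by (simp add: powr_powr)
        ultimately show ?thesis using polar_power_ball_estimate[OF X r v[of k] g] k by simp
      qed
      let ?n = "\<lambda>k. nrm X (\<lambda>x. of_real (v k x))"
      let ?m' = "\<lambda>x. 1 - m x"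
      have vm: "(\<lambda>x. of_real (v m x)) \<in> carr X" "(\<lambda>x. of_real (v ?m' x)) \<in> carr X"
        using v(2)[of m] v(2)[of ?m'] m0 m1 by auto
      have "(?n m powr (1 / t) + ?n ?m' powr (1 / t)) powr t
          \<le> nrm X (\<lambda>x. of_real ((norm (of_real (v m x) :: 'k) powr (1 / t) + norm (of_real (v ?m' x)
              :: 'k) powr (1 / t)) powr t))"
        using conc t0 vm unfolding fs_concave_def by blast
      also have "(\<lambda>x. of_real ((norm (of_real (v m x) :: 'k) powr (1 / t)
          + norm (of_real (v ?m' x) :: 'k) powr (1 / t)) powr t) :: 'k)
          = (\<lambda>x. of_real (u x powr (1 / r)))"
      proof (rule ext, rule arg_cong[where f = of_real])
        fix x
        have "norm (of_real (v k x) :: 'k) powr (1 / t) = u x powr (1 / (r * t)) * k x" if "0 \<le> k x"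
          for k
          unfolding norm_of_real using that t0 by (simp add: v_def powr_mult powr_powr abs_mult)
        then have "norm (of_real (v m x) :: 'k) powr (1 / t)
            + norm (of_real (v ?m' x) :: 'k) powr (1 / t) = u x powr (1 / (r * t)) * m x
            + u x powr (1 / (r * t)) * (1 - m x)"
          using m0[of x] m1[of x] by simp
        also have "\<dots> = u x powr (1 / (r * t))" by (simp add: algebra_simps)
        finally show "(norm (of_real (v m x) :: 'k) powr (1 / t)
            + norm (of_real (v ?m' x) :: 'k) powr (1 / t)) powr t = u x powr (1 / r)"
          using t0 by (simp add: powr_powr)
      qed
      finally have "(?n m powr (1 / t) + ?n ?m' powr (1 / t)) powr t \<le> 1" using ub(2) by linarith
      then have ab: "?n m powr (1 / t) + ?n ?m' powr (1 / t) \<le> 1"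
        using powr_less_mono2[of t 1 "?n m powr (1 / t) + ?n ?m' powr (1 / t)"] t0
        by (simp add: not_le[symmetric]) (meson not_le)
      show "\<exists>a b. 0 \<le> a \<and> 0 \<le> b \<and> a + b \<le> (1::real) \<and>
        (\<forall>g\<in>polar M ?B. (\<integral>\<^sup>+x. ennreal (u x * m x powr (1 - (1 - r * t)) * g x) \<partial>M) \<le> ennreal
            (a powr (1 - (1 - r * t))) \<and>
           (\<integral>\<^sup>+x. ennreal (u x * (1 - m x) powr (1 - (1 - r * t)) * g x) \<partial>M) \<le> ennreal
               (b powr (1 - (1 - r * t))))"
        using ab m0 m1 est[of m] est[of ?m']
        by (intro exI[of _ "?n m powr (1 / t)"] exI[of _ "?n ?m' powr (1 / t)"]) auto
    qed
  qed
qed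

text \<open>
  The unit ball of \<open>pre_XRS M r t X\<close>; its polar and bipolar are the unit balls of \<open>X\<^bsub>r,s\<^esub>\<close> and of its
  Koethe dual, as \<open>represents_XRS\<close> shows.
\<close>

abbreviation pre_ball :: "'a measure \<Rightarrow> real \<Rightarrow> real \<Rightarrow> ('a, 'k::{real_normed_field, euclidean_space})
    fspace \<Rightarrow> ('a \<Rightarrow> real) set" where
  "pre_ball M r t X \<equiv> power_ball M (1 / (1 - r * t)) (polar M (power_ball M r (ball_of M X)))"

lemma (in sigma_finite_measure) pre_ball_polars:
  fixes X :: "('a, 'k::{real_normed_field, euclidean_space}) fspace"
  assumes X: "quasi_BFS M X" and r: "0 < r" and t: "r * t < 1" and cc: "fs_convex r X"
      "fs_concave t X"
  shows "solid_ball M (pre_ball M r t X)" "convex_ball (pre_ball M r t X)"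
    and "solid_ball M (polar M (pre_ball M r t X))" "convex_ball (polar M (pre_ball M r t X))"
    and "solid_ball M (polar M (polar M (pre_ball M r t X)))"
        "convex_ball (polar M (polar M (pre_ball M r t X)))"
proof -
  show 1: "solid_ball M (pre_ball M r t X)"
    using X r t cc
    by (intro power_ball_solid polar_solid_ball ball_of_solid power_ball_convex_of_fs_convex) auto
  show 2: "convex_ball (pre_ball M r t X)" by (rule pre_ball_convex[OF sigma_finite_measure_axioms X
      r t cc])
  show 3: "solid_ball M (polar M (pre_ball M r t X))" by (rule polar_solid_ball[OF 1 2])
  show 4: "convex_ball (polar M (pre_ball M r t X))" by (rule polar_convex) (auto
      simp: power_ball_def)
  show "solid_ball M (polar M (polar M (pre_ball M r t X)))" by (rule polar_solid_ball[OF 3 4])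
  show "convex_ball (polar M (polar M (pre_ball M r t X)))" by (rule polar_convex) (auto
      simp: polar_def)
qed

lemma (in sigma_finite_measure) represents_XRS:
  fixes X :: "('a, 'k::{real_normed_field, euclidean_space}) fspace"
  assumes X: "quasi_BFS M X" and r: "0 < r" and t: "r * t < 1" and cc: "fs_convex r X"
      "fs_concave t X"
  shows "represents M (pre_XRS M r t X) (pre_ball M r t X)"
    and "represents M (XRS M r t X) (polar M (pre_ball M r t X))"
    and "represents M (koethe_dual M (XRS M r t X)) (polar M (polar M (pre_ball M r t X)))"
proof -
  note B = pre_ball_polars[OF X r t cc]
  show 1: "represents M (pre_XRS M r t X) (pre_ball M r t X)"
    unfolding pre_XRS_def using X r t cc
    by (intro represents_power_space represents_koethe_dual ball_of_represents power_ball_solid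
        ball_of_solid
        power_ball_convex_of_fs_convex) auto
  show 2: "represents M (XRS M r t X) (polar M (pre_ball M r t X))"
    unfolding XRS_def by (rule represents_koethe_dual[OF 1 B(1,2)])
  show "represents M (koethe_dual M (XRS M r t X)) (polar M (polar M (pre_ball M r t X)))"
    by (rule represents_koethe_dual[OF 2 B(3,4)])
qed

text \<open>
  The function to be factored is first enlarged by a small multiple of a weak unit, which makes \<open>H\<close>
  positive; this is the reason for the strict inequality between the norm of \<open>f\<close> and \<open>c\<close>.
\<close>

lemma (in sigma_finite_measure) function_factorization:
  fixes X :: "('a, 'k::{real_normed_field, euclidean_space}) fspace"
  assumes X: "quasi_BFS M X" and r: "0 < r" and t: "0 \<le> t" "r * t < 1"
    and conv: "fs_convex r X" and conc: "fs_concave t X" and f: "f \<in> carr X" and c: "nrm X f < c"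
  obtains H k where "H \<in> polar M (pre_ball M r t X)" "AE x in M. 0 < H x" "k \<in> nnfun M"
      "(\<integral>\<^sup>+x. ennreal (k x) \<partial>M) \<le> 1"
    "AE x in M. norm (f x) \<le> c * (H x powr (1 / r - t) * k x powr t)"
proof -
  let ?B = "power_ball M r (ball_of M X)"
  have sB: "solid_ball M ?B" by (rule power_ball_solid[OF ball_of_solid[OF X] r])
  have cB: "convex_ball ?B" by (rule power_ball_convex_of_fs_convex[OF X r conv])
  have cP: "convex_ball (pre_ball M r t X)"
    by (rule pre_ball_convex[OF sigma_finite_measure_axioms X r t(2) conv conc])
  obtain e where e: "e \<in> ?B" "AE x in M. 0 < e x" using weak_unit_exists[OF sB cB] by blast
  have en: "e \<in> nnfun M" by (rule solid_ball_nnfun[OF sB e(1)])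
  have n0: "0 \<le> nrm X f" by (rule quasi_BFS_nrm_nonneg[OF X f])
  note [measurable] = quasi_BFS_meas[OF X f]
  define c1 where "c1 = (nrm X f + c) / 2"
  have c1: "0 < c1" "c1 < c" "nrm X f \<le> c1" using c n0 by (auto simp: c1_def)
  have "(\<lambda>x. norm (f x) / c1) \<in> ball_of M X"
    using representsD(5)[OF ball_of_represents[OF X] f c1(1)] c1(3) by simp
  then have u0: "(\<lambda>x. (norm (f x) / c1) powr r) \<in> ?B"
    using r c1 by (auto simp: power_ball_def powr_powr intro!: nnfunI)
  \<comment> \<open>The share \<open>d\<close> of the convex combination is what the passage from \<open>c1\<close> to \<open>c\<close> leaves room for.\<close>
  define d where "d = (c1 / c) powr r"
  have d: "0 < d" "d < 1" using c1 r powr_less_mono2[of r "c1 / c" 1] by (auto simp: d_def)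
  define u where "u x = d * (norm (f x) / c1) powr r + (1 - d) * e x" for x
  have u: "u \<in> ?B" unfolding u_def[abs_def] by (rule convex_ballD[OF cB u0 e(1)]) (use d in auto)
  have up: "AE x in M. 0 < u x" using e(2) by eventually_elim (use d in \<open>auto
      simp: u_def add_nonneg_pos\<close>)
  define \<theta> where "\<theta> = 1 - r * t"
  have \<theta>: "0 < \<theta>" "\<theta> \<le> 1" using r t by (auto simp: \<theta>_def)
  obtain H k where H: "H \<in> polar M (pre_ball M r t X)" "k \<in> nnfun M" "(\<integral>\<^sup>+x. ennreal (k x) \<partial>M) \<le> 1"
    "AE x in M. u x \<le> H x powr \<theta> * k x powr (1 - \<theta>)" "AE x in M. 0 < H x"
    by (rule lozanovskii_factorization_positive[OF sB cB \<theta> refl cP[folded \<theta>_def] u up, folded \<theta>_def])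
        (rule that[folded \<theta>_def])
  show ?thesis
  proof (rule that[OF H(1,5,2,3)])
    show "AE x in M. norm (f x) \<le> c * (H x powr (1 / r - t) * k x powr t)"
      using H(4)
    proof eventually_elim
      case (elim x)
      have "(norm (f x) / c) powr r = d * (norm (f x) / c1) powr r"
        unfolding d_def powr_mult[symmetric] using c1 by simp
      also have "\<dots> \<le> u x" using d nnfun_nonneg[OF en, of x] by (simp add: u_def)
      also have "\<dots> \<le> H x powr \<theta> * k x powr (1 - \<theta>)" by (rule elim)
      finally have "((norm (f x) / c) powr r) powr (1 / r) \<le> (H x powr \<theta> * k x powr (1 - \<theta>)) powr (1
          / r)"
        using r by (intro powr_mono2) auto
      moreover have "((norm (f x) / c) powr r) powr (1 / r) = norm (f x) / c" using r c1
        by (simp add: powr_powr)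
      moreover have "(H x powr \<theta> * k x powr (1 - \<theta>)) powr (1 / r) = H x powr (1 / r - t) * k x powr t"
      proof -
        have "\<theta> * (1 / r) = 1 / r - t" "(1 - \<theta>) * (1 / r) = t" using r
          by (auto simp: \<theta>_def field_simps)
        then show ?thesis by (simp only: powr_mult powr_powr)
      qed
      ultimately have "norm (f x) / c \<le> H x powr (1 / r - t) * k x powr t" by simp
      then show ?case using c1 by (simp add: divide_le_eq mult.commute)
    qed
  qed
qed

section \<open>Exponents and Lebesgue norms\<close>

lemma recip_ennreal: "0 < q \<Longrightarrow> recip (ennreal q) = 1 / q"
  by (simp add: recip_def inverse_ennreal enn2real_ennreal divide_inverse)

lemma recip_top: "recip \<infinity> = 0" and recip_one: "recip 1 = 1"
  by (simp_all add: recip_def)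

lemma exponent_cases:
  assumes "0 < p"
  obtains "p = \<infinity>" "recip p = 0" | q where "0 < q" "p = ennreal q" "recip p = 1 / q"
proof (cases p)
  case (real q)
  then have "0 < q" using assms by (simp add: ennreal_less_zero_iff)
  then show ?thesis using real that(2)[of q] recip_ennreal by simp
next
  case top
  then show ?thesis using that(1) recip_top by simp
qed

lemma recip_inject: "0 < p \<Longrightarrow> 0 < p' \<Longrightarrow> recip p = recip p' \<Longrightarrow> p = p'"
  by (rule exponent_cases[of p]; rule exponent_cases[of p']) auto

lemma recip_nonneg: "0 \<le> recip p"
  by (simp add: recip_def)

lemma epowr_mono: "x \<le> y \<Longrightarrow> 0 \<le> a \<Longrightarrow> epowr x a \<le> epowr y a"
  by (cases y; cases x) (auto simp: epowr_def top_unique intro!: ennreal_leI powr_mono2)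

lemma epowr_one: "epowr x 1 = x"
  by (cases x) (auto simp: epowr_def)

lemma epowr_ennreal: "0 \<le> y \<Longrightarrow> epowr (ennreal y) a = ennreal (y powr a)"
  by (simp add: epowr_def)

lemma Lp_norm_ennreal:
  "0 < q \<Longrightarrow> Lp_norm M (ennreal q) f = epowr (\<integral>\<^sup>+x. ennreal (norm (f x) powr q) \<partial>M) (1 / q)"
  by (simp add: Lp_norm_def)

lemma Lp_norm_mono:
  fixes f :: "'a \<Rightarrow> 'b::real_normed_vector" and g :: "'a \<Rightarrow> 'c::real_normed_vector"
  assumes p: "0 < p" and [measurable]: "(\<lambda>x. norm (f x)) \<in> borel_measurable M"
      and le: "AE x in M. norm (f x) \<le> norm (g x)"
  shows "Lp_norm M p f \<le> Lp_norm M p g"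
  using p
proof (cases rule: exponent_cases)
  case 1
  have "AE x in M. ennreal (norm (f x)) \<le> ennreal (norm (g x))" using le
    by eventually_elim (rule ennreal_leI)
  then show ?thesis unfolding 1 Lp_norm_def by (auto intro!: esssup_AE_mono)
next
  case (2 q)
  have "(\<integral>\<^sup>+x. ennreal (norm (f x) powr q) \<partial>M) \<le> (\<integral>\<^sup>+x. ennreal (norm (g x) powr q) \<partial>M)"
    using le by (intro nn_integral_mono_AE) (auto elim!: eventually_mono
        intro!: ennreal_leI powr_mono2 less_imp_le[OF 2(1)])
  then show ?thesis unfolding 2 Lp_norm_ennreal[OF 2(1)] by (rule epowr_mono) (use 2 in simp)
qed

text \<open>
  Hoelder's inequality for exponents in \<open>(0,\<infinity>]\<close>, with the factor \<open>v\<close> normalized in $L^1$ and put to the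
  power \<open>a\<close>.  For \<open>a = 0\<close> the two exponents agree, and \<open>v\<close> may be any nonnegative function.
\<close>

lemma Lp_norm_le_of_Hoelder:
  fixes h :: "'a \<Rightarrow> 'b::real_normed_vector" and k :: "'a \<Rightarrow> 'c::real_normed_vector" and v :: "'a \<Rightarrow> real"
  assumes p: "0 < p" "0 < p'" and a: "0 \<le> a" "recip p' = recip p + a"
    and [measurable]: "(\<lambda>x. norm (h x)) \<in> borel_measurable M"
        "(\<lambda>x. norm (k x)) \<in> borel_measurable M" "v \<in> borel_measurable M"
    and v0: "\<And>x. 0 \<le> v x" and v1: "0 < a \<Longrightarrow> (\<integral>\<^sup>+x. ennreal (v x) \<partial>M) \<le> 1"
    and le: "AE x in M. norm (h x) \<le> v x powr a * norm (k x)"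
  shows "Lp_norm M p' h \<le> Lp_norm M p k"
proof (cases "a = 0")
  case True
  then have "p' = p" using recip_inject[OF p(2,1)] a by simp
  have "AE x in M. norm (h x) \<le> norm (k x)"
    using le by eventually_elim (use True in \<open>auto split: if_splits simp: powr_def\<close>)
  then show ?thesis unfolding \<open>p' = p\<close> using p by (intro Lp_norm_mono) auto
next
  case False
  with a have a0: "0 < a" by simp
  with v1 have v1: "(\<integral>\<^sup>+x. ennreal (v x) \<partial>M) \<le> 1" by blast
  obtain q' where q': "0 < q'" "p' = ennreal q'" "recip p' = 1 / q'"
    using exponent_cases[OF p(2)] a a0 recip_nonneg[of p]
    by (metis add_pos_nonneg add.commute less_irrefl)
  have main: "Lp_norm M p' h \<le> ennreal d" if d: "0 < d" and Dd: "Lp_norm M p k \<le> ennreal d" for d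
  proof -
    let ?f = "\<lambda>x. (norm (h x) / d) powr q'"
    have "(\<integral>\<^sup>+x. ennreal (?f x) \<partial>M) \<le> 1"
      using p(1)
    proof (cases rule: exponent_cases)
      case 1
      then have aq: "a * q' = 1" using a q' by (simp add: field_simps)
      have "AE x in M. ennreal (norm (k x)) \<le> ennreal d"
        using esssup_AE[of "\<lambda>x. ennreal (norm (k x))" M] Dd unfolding 1 Lp_norm_def
        by (auto elim!: eventually_mono intro: order_trans)
      with le have "AE x in M. ennreal (?f x) \<le> ennreal (v x)"
      proof eventually_elim
        case (elim x)
        then have "norm (k x) \<le> d" using d by simp
        then have "norm (h x) \<le> v x powr a * d" using elim(1)
          by (meson mult_left_mono order_trans powr_ge_zero)
        then have "norm (h x) / d \<le> v x powr a" using d by (simp add: field_simps)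
        then have "?f x \<le> (v x powr a) powr q'" using d q' by (intro powr_mono2) auto
        then show ?case using aq v0 by (simp add: powr_powr ennreal_leI)
      qed
      then have "(\<integral>\<^sup>+x. ennreal (?f x) \<partial>M) \<le> (\<integral>\<^sup>+x. ennreal (v x) \<partial>M)" by (rule nn_integral_mono_AE)
      with v1 show ?thesis by (rule order_trans[rotated])
    next
      case (2 q)
      have "a = 1 / q' - 1 / q" using a(2) q'(3) 2(3) by linarith
      then have aq: "a * q' = 1 - q' / q" using q'(1) by (simp add: left_diff_distrib)
      have aq01: "0 \<le> a * q'" "a * q' \<le> 1" using a0 q' 2 by (simp, simp add: aq)
      let ?g = "\<lambda>x. (norm (k x) / d) powr q"
      have I: "(\<integral>\<^sup>+x. ennreal (?g x) \<partial>M) \<le> 1"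
      proof -
        let ?K = "\<integral>\<^sup>+x. ennreal (norm (k x) powr q) \<partial>M"
        have "epowr ?K (1 / q) \<le> ennreal d" using Dd unfolding 2 Lp_norm_ennreal[OF 2(1)] .
        then have "epowr (epowr ?K (1 / q)) q \<le> epowr (ennreal d) q" by (rule epowr_mono) (use 2
            in simp)
        moreover have "epowr (epowr ?K (1 / q)) q = ?K" using 2 by (cases ?K) (auto
            simp: epowr_def powr_powr)
        ultimately have K: "?K \<le> ennreal (d powr q)" using d by (simp add: epowr_ennreal)
        have "(\<integral>\<^sup>+x. ennreal (?g x) \<partial>M) = (\<integral>\<^sup>+x. ennreal (1 / d powr q)
            * ennreal (norm (k x) powr q) \<partial>M)"
          using d by (intro nn_integral_cong) (simp add: powr_divide ennreal_mult[symmetric])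
        also have "\<dots> = ennreal (1 / d powr q) * ?K" by (simp add: nn_integral_cmult)
        also have "\<dots> \<le> ennreal (1 / d powr q) * ennreal (d powr q)" by (intro mult_left_mono K) simp
        also have "\<dots> = 1" using d by (simp add: ennreal_mult[symmetric])
        finally show ?thesis .
      qed
      show ?thesis
      proof (rule nn_integral_geometric_mean_le[of v M ?g "a * q'"])
        show "AE x in M. ?f x \<le> v x powr (a * q') * ?g x powr (1 - a * q')"
          using le
        proof eventually_elim
          case (elim x)
          have "norm (h x) / d \<le> v x powr a * (norm (k x) / d)" using elim d
            by (simp add: field_simps)
          then have "?f x \<le> (v x powr a * (norm (k x) / d)) powr q'" using d q'
            by (intro powr_mono2) auto
          also have "\<dots> = v x powr (a * q') * ?g x powr (1 - a * q')"
          proof -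
            have "(v x powr a * (norm (k x) / d)) powr q' = v x powr (a * q') * (norm (k x)
                / d) powr q'"
              by (simp only: powr_mult powr_powr)
            moreover have "?g x powr (1 - a * q') = (norm (k x) / d) powr q'"
              using 2 by (simp add: powr_powr aq)
            ultimately show ?thesis by simp
          qed
          finally show ?case .
        qed
      qed (use v0 v1 I aq01 in auto)
    qed
    moreover have "(\<integral>\<^sup>+x. ennreal (norm (h x) powr q') \<partial>M) = ennreal (d powr q')
        * (\<integral>\<^sup>+x. ennreal (?f x) \<partial>M)"
      using d by (subst nn_integral_cmult[symmetric]) (auto
          simp: powr_divide ennreal_mult[symmetric] intro!: nn_integral_cong)
    ultimately have "(\<integral>\<^sup>+x. ennreal (norm (h x) powr q') \<partial>M) \<le> ennreal (d powr q')"
      using mult_left_mono[of _ 1 "ennreal (d powr q')"] by simp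
    then have "Lp_norm M p' h \<le> epowr (ennreal (d powr q')) (1 / q')"
      unfolding q'(2) Lp_norm_ennreal[OF q'(1)] by (rule epowr_mono) (use q' in simp)
    also have "\<dots> = ennreal d" using d q' by (simp add: epowr_ennreal powr_powr)
    finally show ?thesis .
  qed
  show ?thesis
  proof (cases "Lp_norm M p k")
    case (real D)
    show ?thesis unfolding real(2)
    proof (rule ennreal_le_epsilon)
      fix e :: real assume "0 < e"
      then have "Lp_norm M p' h \<le> ennreal (D + e)" using real by (intro main) (auto
          intro!: ennreal_leI simp del: ennreal_plus)
      then show "Lp_norm M p' h \<le> ennreal D + ennreal e" using real \<open>0 < e\<close> by simp
    qed
  qed simp
qed

lemma Lp_norm_scale_le:
  fixes f :: "'a \<Rightarrow> 'b::real_normed_vector"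
  assumes p: "0 < p" and c: "0 \<le> c" and m [measurable]: "(\<lambda>x. norm (f x)) \<in> borel_measurable M"
  shows "Lp_norm M p (\<lambda>x. c *\<^sub>R f x) \<le> ennreal c * Lp_norm M p f"
  using p
proof (cases rule: exponent_cases)
  case 1
  have "AE x in M. ennreal (norm (c *\<^sub>R f x)) \<le> ennreal c * esssup M (\<lambda>x. ennreal (norm (f x)))"
    using esssup_AE[of "\<lambda>x. ennreal (norm (f x))" M]
    by eventually_elim (use c in \<open>auto simp: ennreal_mult intro: mult_left_mono\<close>)
  then show ?thesis unfolding 1 Lp_norm_def using c by (auto intro!: esssup_I)
next
  case (2 q)
  let ?I = "\<integral>\<^sup>+x. ennreal (norm (f x) powr q) \<partial>M"
  have "(\<integral>\<^sup>+x. ennreal (norm (c *\<^sub>R f x) powr q) \<partial>M)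
      = (\<integral>\<^sup>+x. ennreal (c powr q) * ennreal (norm (f x) powr q) \<partial>M)"
    using c by (intro nn_integral_cong) (simp add: powr_mult ennreal_mult[symmetric])
  also have "\<dots> = ennreal (c powr q) * ?I" by (simp add: nn_integral_cmult)
  finally have e: "(\<integral>\<^sup>+x. ennreal (norm (c *\<^sub>R f x) powr q) \<partial>M) = ennreal (c powr q) * ?I" .
  show ?thesis
  proof (cases "c = 0")
    case True
    then show ?thesis unfolding 2 Lp_norm_ennreal[OF 2(1)] by (simp add: epowr_def)
  next
    case False
    with c have c: "0 < c" by simp
    show ?thesis unfolding 2 Lp_norm_ennreal[OF 2(1)] e
      by (cases ?I) (use c 2 in \<open>auto simp: epowr_def ennreal_mult[symmetric] powr_mult powr_powr
          ennreal_mult_top\<close>)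
  qed
qed

section \<open>Averages and the weight constant\<close>

lemma avg_one:
  assumes "0 < emeasure M E" "emeasure M E < \<infinity>"
  shows "avg M 1 E f = ennreal (1 / measure M E) * (\<integral>\<^sup>+x. ennreal (norm (f x)) * indicator E x \<partial>M)"
proof -
  have m: "0 < measure M E" using assms by (simp add: measure_def enn2real_positive_iff)
  have "(\<integral>\<^sup>+x. ennreal (norm (indicator E x *\<^sub>R f x) powr 1) \<partial>M)
      = (\<integral>\<^sup>+x. ennreal (norm (f x)) * indicator E x \<partial>M)"
    by (intro nn_integral_cong) (auto simp: indicator_def)
  moreover have "measure M E powr - 1 = 1 / measure M E" using m by (simp add: powr_minus_divide)
  ultimately show ?thesis by (simp add: avg_def recip_one Lp_norm_def epowr_one)
qed

lemma avg_one_real: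
  fixes u :: "'a \<Rightarrow> real"
  assumes "0 < emeasure M E" "emeasure M E < \<infinity>" "u \<in> nnfun M"
  shows "avg M 1 E u = ennreal (1 / measure M E) * (\<integral>\<^sup>+x. ennreal (u x) * indicator E x \<partial>M)"
  using avg_one[OF assms(1,2), of u] nnfun_nonneg[OF assms(3)] by simp

lemma maximal_of_real: "maximal M \<E> (\<lambda>x. of_real (u x) :: 'k::{real_normed_field, euclidean_space})
    = maximal M \<E> u"
  by (simp add: maximal_def avg_def Lp_norm_def fun_eq_iff abs_mult)

lemma avg_le_maximal: "E \<in> \<E> \<Longrightarrow> x \<in> E \<Longrightarrow> avg M 1 E f \<le> maximal M \<E> f x"
  unfolding maximal_def by (rule SUP_upper2[of E]) auto

lemma basis_of_setsD:
  assumes "basis_of_sets M \<E>"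
  shows "E \<in> \<E> \<Longrightarrow> E \<in> sets M" "E \<in> \<E> \<Longrightarrow> 0 < emeasure M E" "E \<in> \<E> \<Longrightarrow> emeasure M E < \<infinity>"
    "x \<in> space M \<Longrightarrow> \<exists>E\<in>\<E>. x \<in> E"
proof -
  have *: "\<forall>E\<in>\<E>. E \<in> sets M \<and> 0 < emeasure M E \<and> emeasure M E < \<infinity>" and "\<Union>\<E> = space M"
    using assms by (simp_all add: basis_of_sets_def)
  then show "x \<in> space M \<Longrightarrow> \<exists>E\<in>\<E>. x \<in> E" by blast
  show "E \<in> \<E> \<Longrightarrow> E \<in> sets M" "E \<in> \<E> \<Longrightarrow> 0 < emeasure M E" "E \<in> \<E> \<Longrightarrow> emeasure M E < \<infinity>"
    using * by simp_all
qed

lemma avg_one_pos: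
  fixes u :: "'a \<Rightarrow> real"
  assumes E: "E \<in> sets M" "0 < emeasure M E" "emeasure M E < \<infinity>"
    and [measurable]: "u \<in> borel_measurable M" and pos: "AE x in M. 0 < u x"
  shows "0 < avg M 1 E u"
proof -
  note [measurable] = E(1)
  have m: "0 < measure M E" using E by (simp add: measure_def enn2real_positive_iff)
  have "(\<integral>\<^sup>+x. ennreal (norm (u x)) * indicator E x \<partial>M) \<noteq> 0"
  proof
    assume "(\<integral>\<^sup>+x. ennreal (norm (u x)) * indicator E x \<partial>M) = 0"
    then have "AE x in M. ennreal (norm (u x)) * indicator E x = 0"
      by (subst (asm) nn_integral_0_iff_AE) auto
    with pos have "AE x in M. x \<notin> E"
    proof eventually_elim
      case (elim x)
      then show ?case by (cases "x \<in> E") auto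
    qed
    then have "E \<in> null_sets M" by (simp add: AE_iff_null_sets)
    with E show False by (simp add: null_sets_def)
  qed
  then show ?thesis unfolding avg_one[OF E(2,3)] using m
    by (simp add: zero_less_iff_neq_zero ennreal_eq_0_iff not_le)
qed

text \<open>
  The maximal function of \<open>u\<close> is at most \<open>C v\<close>.  Since \<open>\<E>\<close> may be uncountable, it matters that the
  exceptional null set does not depend on \<open>E\<close>.
\<close>

definition maximal_dominated :: "'a measure \<Rightarrow> 'a set set \<Rightarrow> real \<Rightarrow> ('a \<Rightarrow> real) \<Rightarrow> ('a \<Rightarrow> real) \<Rightarrow> bool"
    where
  "maximal_dominated M \<E> C u v \<longleftrightarrow> (AE x in M. \<forall>E\<in>\<E>. x \<in> E \<longrightarrow> avg M 1 E u \<le> ennreal (C * v x))"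

text \<open>
  Each point lies in a set of the basis, over which a positive function has a positive average.
\<close>

lemma maximal_dominated_pos:
  fixes u v :: "'a \<Rightarrow> real"
  assumes basis: "basis_of_sets M \<E>" and "maximal_dominated M \<E> C u v" and "u \<in> borel_measurable M"
      and "AE x in M. 0 < u x"
    and C: "0 < C"
  shows "AE x in M. 0 < v x"
  using assms(2)[unfolded maximal_dominated_def] AE_space
proof eventually_elim
  case (elim x)
  then obtain E where E: "E \<in> \<E>" "x \<in> E" using basis_of_setsD(4)[OF basis] by blast
  have "0 < avg M 1 E u" by (rule avg_one_pos) (use assms basis_of_setsD(1-3)[OF basis E(1)] in auto)
  also have "\<dots> \<le> ennreal (C * v x)" using elim E by blast
  finally show ?case using C by (simp add: ennreal_less_zero_iff zero_less_mult_iff)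
qed

lemma maximal_dominated_one:
  assumes "basis_of_sets M \<E>"
  shows "maximal_dominated M \<E> 1 (\<lambda>x. 1) (\<lambda>x. 1)"
proof -
  have "avg M 1 E (\<lambda>x. 1::real) = 1" if E: "E \<in> \<E>" for E
  proof -
    note Es = basis_of_setsD(1-3)[OF assms E]
    have m: "0 < measure M E" using Es by (simp add: measure_def enn2real_positive_iff)
    have "emeasure M E = ennreal (measure M E)" using Es by (intro emeasure_eq_ennreal_measure) auto
    then show ?thesis using Es m by (simp add: avg_one ennreal_mult[symmetric])
  qed
  then show ?thesis by (auto simp: maximal_dominated_def)
qed

lemma avg_le_powr:
  fixes F v :: "'a \<Rightarrow> real"
  assumes E: "E \<in> sets M" "0 < emeasure M E" "emeasure M E < \<infinity>"
    and [measurable]: "F \<in> borel_measurable M" "v \<in> borel_measurable M" and v0: "\<And>x. 0 \<le> v x"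
    and le: "AE x in M. x \<in> E \<longrightarrow> \<bar>F x\<bar> \<le> c * v x powr a" and a: "0 \<le> a" and c: "0 \<le> c"
    and m: "avg M 1 E v \<le> ennreal m" "0 < m"
  shows "avg M (inverse (ennreal a)) E F \<le> ennreal (c * m powr a)"
proof -
  note [measurable] = E(1)
  define e where "e = measure M E"
  have e: "0 < e" using E by (simp add: measure_def enn2real_positive_iff e_def)
  show ?thesis
  proof (cases "a = 0")
    case True
    have "AE x in M. ennreal (norm (indicator E x *\<^sub>R F x)) \<le> ennreal c"
      using le
    proof eventually_elim
      case (elim x)
      have "v x powr a \<le> 1" using True by (simp add: powr_def)
      then have "c * v x powr a \<le> c" using c by (simp add: mult_left_le)
      with elim c show ?case by (auto simp: indicator_def intro!: ennreal_leI)
    qed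
    then have "esssup M (\<lambda>x. ennreal (norm (indicator E x *\<^sub>R F x))) \<le> ennreal c"
      by (intro esssup_I) auto
    then show ?thesis using True e m(2) by (simp add: avg_def recip_top[simplified] Lp_norm_def
        e_def[symmetric])
  next
    case False
    with a have a: "0 < a" by simp
    have inv: "inverse (ennreal a) = ennreal (1 / a)" using a
      by (simp add: inverse_ennreal divide_inverse)
    have "(\<integral>\<^sup>+x. ennreal (norm (indicator E x *\<^sub>R F x) powr (1 / a)) \<partial>M)
        \<le> (\<integral>\<^sup>+x. ennreal (c powr (1 / a)) * (ennreal (norm (v x)) * indicator E x) \<partial>M)"
    proof (rule nn_integral_mono_AE)
      show "AE x in M. ennreal (norm (indicator E x *\<^sub>R F x) powr (1 / a))
          \<le> ennreal (c powr (1 / a)) * (ennreal (norm (v x)) * indicator E x)"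
        using le
      proof eventually_elim
        case (elim x)
        show ?case
        proof (cases "x \<in> E")
          case True
          then have "\<bar>F x\<bar> powr (1 / a) \<le> (c * v x powr a) powr (1 / a)" using elim a
            by (intro powr_mono2) auto
          also have "\<dots> = c powr (1 / a) * v x" using a v0 by (simp add: powr_mult powr_powr)
          finally show ?thesis using True v0[of x] by (simp add: ennreal_mult[symmetric] ennreal_leI)
        qed simp
      qed
    qed
    also have "\<dots> = ennreal (c powr (1 / a)) * (\<integral>\<^sup>+x. ennreal (norm (v x)) * indicator E x \<partial>M)"
      by (simp add: nn_integral_cmult)
    also have "\<dots> \<le> ennreal (c powr (1 / a)) * ennreal (m * e)"
    proof (rule mult_left_mono)
      have "(\<integral>\<^sup>+x. ennreal (norm (v x)) * indicator E x \<partial>M) = ennreal e * avg M 1 E v"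
        unfolding avg_one[OF E(2,3)] e_def[symmetric] mult.assoc[symmetric] using e
        by (simp add: ennreal_mult[symmetric])
      also have "\<dots> \<le> ennreal e * ennreal m" by (intro mult_left_mono m) simp
      also have "\<dots> = ennreal (m * e)" using e m by (simp add: ennreal_mult[symmetric] mult.commute)
      finally show "(\<integral>\<^sup>+x. ennreal (norm (v x)) * indicator E x \<partial>M) \<le> ennreal (m * e)" .
    qed simp
    also have "\<dots> = ennreal (c powr (1 / a) * (m * e))" using m e
      by (simp add: ennreal_mult[symmetric])
    finally have "Lp_norm M (inverse (ennreal a)) (\<lambda>x. indicator E x *\<^sub>R F x)
        \<le> epowr (ennreal (c powr (1 / a) * (m * e))) a"
      unfolding inv using a by (subst Lp_norm_ennreal) (auto intro!: epowr_mono)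
    also have "\<dots> = ennreal (c * (m powr a * e powr a))"
      using a m e c by (simp add: epowr_ennreal powr_mult powr_powr)
    finally have "avg M (inverse (ennreal a)) E F \<le> ennreal (e powr - a)
        * ennreal (c * (m powr a * e powr a))"
      using recip_ennreal[of "1 / a"] a unfolding avg_def e_def[symmetric] inv
      by (simp add: mult_left_mono)
    also have "\<dots> = ennreal (c * m powr a)"
      using e c by (simp add: ennreal_mult[symmetric] powr_minus field_simps)
    finally show ?thesis .
  qed
qed

text \<open>
  On a set \<open>E\<close>, domination bounds \<open>G1\<close> from below by the average of \<open>G\<close> divided by \<open>D\<close>, so the
  average of the inverse of the first weight is that of \<open>H\<close> up to a constant; likewise for the second
  weight.  In the product, the averages of \<open>H\<close> and \<open>G\<close> cancel, leaving the powers of \<open>C\<close> and \<open>D\<close>.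
\<close>

lemma A_const_le:
  fixes H H2 G G1 :: "'a \<Rightarrow> real"
  assumes basis: "basis_of_sets M \<E>" and a: "0 \<le> 1 / r\<^sub>1 - recip p\<^sub>1" and b: "0 \<le> recip p\<^sub>2 - t\<^sub>2"
    and nn: "H \<in> nnfun M" "H2 \<in> nnfun M" "G \<in> nnfun M" "G1 \<in> nnfun M"
    and pos: "AE x in M. 0 < H x" "AE x in M. 0 < H2 x" "AE x in M. 0 < G x" "AE x in M. 0 < G1 x"
    and C: "0 < C" "0 < D" and dom: "maximal_dominated M \<E> C H H2" "maximal_dominated M \<E> D G G1"
  shows "A_const M \<E> p\<^sub>1 p\<^sub>2 r\<^sub>1 t\<^sub>2
      (\<lambda>x. H x powr - (1 / r\<^sub>1 - recip p\<^sub>1) * G1 x powr (recip p\<^sub>2 - t\<^sub>2))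
      (\<lambda>x. H2 x powr - (1 / r\<^sub>1 - recip p\<^sub>1) * G x powr (recip p\<^sub>2 - t\<^sub>2))
    \<le> ennreal (C powr (1 / r\<^sub>1 - recip p\<^sub>1) * D powr (recip p\<^sub>2 - t\<^sub>2))"
  unfolding A_const_def
proof (rule SUP_least)
  fix E assume E: "E \<in> \<E>"
  define a where "a = 1 / r\<^sub>1 - recip p\<^sub>1"
  define b where "b = recip p\<^sub>2 - t\<^sub>2"
  have ab: "0 \<le> a" "0 \<le> b" using assms(2,3) by (auto simp: a_def b_def)
  note Es = basis_of_setsD(1-3)[OF basis E]
  note [measurable] = Es(1) nn[THEN nnfun_measurable]
  have real_avg: "\<exists>h>0. avg M 1 E u = ennreal h"
    if u: "u \<in> nnfun M" "AE x in M. 0 < u x" and d: "maximal_dominated M \<E> K u v"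
      for u v :: "'a \<Rightarrow> real" and K
  proof -
    have "0 < avg M 1 E u" using avg_one_pos[OF Es nnfun_measurable[OF u(1)] u(2)] .
    moreover have "avg M 1 E u < \<infinity>"
    proof (rule ccontr)
      assume "\<not> avg M 1 E u < \<infinity>"
      then have top: "avg M 1 E u = \<infinity>" by (simp add: less_top[symmetric])
      have "AE x in M. x \<notin> E"
        using d[unfolded maximal_dominated_def] by eventually_elim (use E top in \<open>auto
            simp: top_unique\<close>)
      then have "E \<in> null_sets M" using Es(1) by (simp add: AE_iff_null_sets)
      with Es show False by (simp add: null_sets_def)
    qed
    ultimately show ?thesis
      by (cases "avg M 1 E u") (auto simp: ennreal_less_zero_iff)
  qed
  obtain h where h: "0 < h" "avg M 1 E H = ennreal h" using real_avg[OF nn(1) pos(1) dom(1)] by blast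
  obtain g where g: "0 < g" "avg M 1 E G = ennreal g" using real_avg[OF nn(3) pos(3) dom(2)] by blast
  have ge: "AE x in M. x \<in> E \<longrightarrow> l / K \<le> v x"
    if d: "maximal_dominated M \<E> K u v" and l: "avg M 1 E u = ennreal l" "0 < l" and K: "0 < K"
      for u v :: "'a \<Rightarrow> real" and K l
    using d[unfolded maximal_dominated_def]
  proof eventually_elim
    case (elim x)
    show ?case
    proof
      assume "x \<in> E"
      then have "ennreal l \<le> ennreal (K * v x)" using elim E l(1) by metis
      then have "l \<le> K * v x" using l(2) by (simp add: ennreal_le_iff2)
      then show "l / K \<le> v x" using K by (simp add: field_simps)
    qed
  qed
  have 1: "avg M (inverse (ennreal a)) E (\<lambda>x. inverse (H x powr - a * G1 x powr b))
      \<le> ennreal ((g / D) powr - b * h powr a)"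
  proof (rule avg_le_powr[OF Es, where v = H])
    show "AE x in M. x \<in> E \<longrightarrow> \<bar>inverse (H x powr - a * G1 x powr b)\<bar> \<le> (g / D) powr - b * H x powr a"
      using ge[OF dom(2) g(2,1) C(2)]
    proof eventually_elim
      case (elim x)
      show ?case
      proof
        assume "x \<in> E"
        with elim have "g / D \<le> G1 x" by blast
        then have "G1 x powr - b \<le> (g / D) powr - b" using ab g C by (intro powr_mono2') auto
        then have "H x powr a * G1 x powr - b \<le> H x powr a * (g / D) powr - b"
          by (intro mult_left_mono) auto
        moreover have "inverse (H x powr - a * G1 x powr b) = H x powr a * G1 x powr - b"
          by (simp add: powr_minus)
        ultimately show "\<bar>inverse (H x powr - a * G1 x powr b)\<bar> \<le> (g / D) powr - b * H x powr a"
          by (simp add: mult.commute)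
      qed
    qed
  qed (use nn[THEN nnfun_nonneg] ab h in auto)
  have 2: "avg M (inverse (ennreal b)) E (\<lambda>x. H2 x powr - a * G x powr b)
      \<le> ennreal ((h / C) powr - a * g powr b)"
  proof (rule avg_le_powr[OF Es, where v = G])
    show "AE x in M. x \<in> E \<longrightarrow> \<bar>H2 x powr - a * G x powr b\<bar> \<le> (h / C) powr - a * G x powr b"
      using ge[OF dom(1) h(2,1) C(1)]
    proof eventually_elim
      case (elim x)
      show ?case
      proof
        assume "x \<in> E"
        with elim have "h / C \<le> H2 x" by blast
        then have "H2 x powr - a \<le> (h / C) powr - a" using ab h C by (intro powr_mono2') auto
        then show "\<bar>H2 x powr - a * G x powr b\<bar> \<le> (h / C) powr - a * G x powr b"
          by (simp add: mult_right_mono)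
      qed
    qed
  qed (use nn[THEN nnfun_nonneg] ab g in auto)
  have "avg M (inverse (ennreal a)) E (\<lambda>x. inverse (H x powr - a * G1 x powr b))
      * avg M (inverse (ennreal b)) E (\<lambda>x. H2 x powr - a * G x powr b)
     \<le> ennreal ((g / D) powr - b * h powr a) * ennreal ((h / C) powr - a * g powr b)"
    by (intro mult_mono 1 2) auto
  also have "\<dots> = ennreal (C powr a * D powr b)"
    using g h C by (simp add: ennreal_mult[symmetric] powr_divide powr_minus field_simps)
  finally show "avg M (inverse (ennreal (1 / r\<^sub>1 - recip p\<^sub>1))) E (\<lambda>x. inverse (H x powr
      - (1 / r\<^sub>1 - recip p\<^sub>1) * G1 x powr (recip p\<^sub>2 - t\<^sub>2))) *
      avg M (inverse (ennreal (recip p\<^sub>2 - t\<^sub>2))) E (\<lambda>x. H2 x powr - (1 / r\<^sub>1 - recip p\<^sub>1) * G x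
          powr (recip p\<^sub>2 - t\<^sub>2))
    \<le> ennreal (C powr (1 / r\<^sub>1 - recip p\<^sub>1) * D powr (recip p\<^sub>2 - t\<^sub>2))"
    unfolding a_def b_def .
qed

section \<open>The Rubio de Francia algorithm\<close>

text \<open>
  What the Rubio de Francia algorithm requires of a positive isometric isomorphism.  The last clause
  does the work of a positive inverse: it allows one to go back from \<open>B2\<close> to nonnegative functions in \<open>B1\<close>
  at the cost of an inequality.
\<close>

definition dominating_map
    :: "'a measure \<Rightarrow> ('a \<Rightarrow> real) set \<Rightarrow> ('a \<Rightarrow> real) set \<Rightarrow> (('a \<Rightarrow> real) \<Rightarrow> 'a \<Rightarrow> real) \<Rightarrow> bool" where
  "dominating_map M B1 B2 l \<longleftrightarrow>
     (\<forall>u\<in>B1. l u \<in> B2) \<and>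
     (\<forall>u\<in>B1. \<forall>v\<in>B1. (AE x in M. u x \<le> v x) \<longrightarrow> (AE x in M. l u x \<le> l v x)) \<and>
     (\<forall>u\<in>B1. \<forall>c. 0 \<le> c \<longrightarrow> c \<le> 1 \<longrightarrow> (AE x in M. l (\<lambda>y. c * u y) x = c * l u x)) \<and>
     (\<forall>u\<in>B1. \<forall>v\<in>B1. (\<lambda>x. u x + v x) \<in> B1 \<longrightarrow> (AE x in M. l (\<lambda>y. u y + v y) x = l u x + l v x)) \<and>
     (\<forall>v\<in>B2. \<exists>u\<in>B1. AE x in M. v x \<le> l u x)"

lemma dominating_map_id: "dominating_map M B B (\<lambda>u. u)"
  by (auto simp: dominating_map_def)

text \<open>
  Define \<open>u\<^sub>0 = H\<^sub>0\<close> and choose \<open>u\<^bsub>k+1\<^esub>\<close> with \<open>M u\<^sub>k / N \<le> l u\<^bsub>k+1\<^esub>\<close>.  For \<open>H = \<Sum> u\<^sub>k / 2\<^bsup>k+1\<^esup>\<close>, sublinearity of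
  the maximal operator yields \<open>M H \<le> \<Sum> N l u\<^bsub>k+1\<^esub> / 2\<^bsup>k+1\<^esup> \<le> 2 N l H\<close>.
\<close>

theorem rubio_de_francia:
  assumes B1: "solid_ball M B1" "convex_ball B1" and l: "dominating_map M B1 B2 l"
    and B2: "B2 \<subseteq> nnfun M" and basis: "basis_of_sets M \<E>" and N: "0 < N"
    and max: "\<And>u. u \<in> B1 \<Longrightarrow> AE x in M. maximal M \<E> u x < \<infinity>"
      "\<And>u. u \<in> B1 \<Longrightarrow> (\<lambda>x. enn2real (maximal M \<E> u x) / N) \<in> B2"
    and H0: "H0 \<in> B1"
  shows "\<exists>H\<in>B1. (AE x in M. H0 x / 2 \<le> H x) \<and> l H \<in> B2 \<and> maximal_dominated M \<E> (2 * N) H (l H)"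
proof -
  have B1n: "u \<in> nnfun M" if "u \<in> B1" for u by (rule solid_ball_nnfun[OF B1(1) that])
  have l1: "l u \<in> B2" if "u \<in> B1" for u using l that unfolding dominating_map_def by blast
  have l2: "AE x in M. l u x \<le> l v x" if "u \<in> B1" "v \<in> B1" "AE x in M. u x \<le> v x" for u v
    using l that unfolding dominating_map_def by blast
  have l3: "AE x in M. l (\<lambda>y. c * u y) x = c * l u x" if "u \<in> B1" "0 \<le> c" "c \<le> 1" for u c
    using l that unfolding dominating_map_def by blast
  have l4: "AE x in M. l (\<lambda>y. u y + v y) x = l u x + l v x" if "u \<in> B1" "v \<in> B1"
      "(\<lambda>x. u x + v x) \<in> B1" for u v
    using l that unfolding dominating_map_def by blast
  have l5: "\<exists>u\<in>B1. AE x in M. v x \<le> l u x" if "v \<in> B2" for v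
    using l that unfolding dominating_map_def by blast
  have lnn: "0 \<le> l u x" if "u \<in> B1" for u x
    using nnfun_nonneg[of "l u" M x] l1[OF that] B2 by auto
  define T where "T u = (SOME v. v \<in> B1 \<and> (AE x in M. enn2real (maximal M \<E> u x) / N \<le> l v x))"
    for u :: "'a \<Rightarrow> real"
  have "T u \<in> B1 \<and> (AE x in M. enn2real (maximal M \<E> u x) / N \<le> l (T u) x)" if u: "u \<in> B1" for u
  proof -
    have ex: "\<exists>v. v \<in> B1 \<and> (AE x in M. enn2real (maximal M \<E> u x) / N \<le> l v x)"
      using l5[OF max(2)[OF u]] by auto
    show ?thesis using someI_ex[OF ex] unfolding T_def .
  qed
  then have T: "\<And>u. u \<in> B1 \<Longrightarrow> T u \<in> B1"
    "\<And>u. u \<in> B1 \<Longrightarrow> AE x in M. enn2real (maximal M \<E> u x) / N \<le> l (T u) x" by auto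
  define U where "U n = (T ^^ n) H0" for n
  have U0: "U 0 = H0" and US: "U (Suc n) = T (U n)" for n by (simp_all add: U_def)
  have U: "U n \<in> B1" for n by (induction n) (simp_all add: U0 US H0 T)
  note Unn = nnfun_nonneg[OF B1n[OF U]] and [measurable] = nnfun_measurable[OF B1n[OF U]]
  obtain H where H: "H \<in> B1" "AE x in M. (\<lambda>k. U k x / 2 ^ Suc k) sums H x"
    using dyadic_sum_mem[OF B1, of U] U by blast
  define S where "S n x = (\<Sum>k<n. U k x / 2 ^ Suc k)" for n x
  have S: "S n \<in> B1" for n unfolding S_def[abs_def] by (rule dyadic_partial_sum_mem[OF B1 U])
  have SH: "AE x in M. S n x \<le> H x" for n
    using H(2)
  proof eventually_elim
    case (elim x)
    then have "S n x \<le> (\<Sum>k. U k x / 2 ^ Suc k)"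
      unfolding S_def by (intro sum_le_suminf) (auto simp: sums_iff Unn)
    with elim show ?case by (simp add: sums_iff)
  qed
  \<comment> \<open>Additivity of \<open>l\<close> is used for finite partial sums only; monotonicity then covers the whole series.\<close>
  have lS: "AE x in M. l (S n) x = (\<Sum>k<n. l (U k) x / 2 ^ Suc k)" for n
  proof (induction n)
    case 0
    have "S 0 = (\<lambda>x. 0 * H0 x)" by (simp add: S_def fun_eq_iff)
    then show ?case using l3[OF H0, of 0] by simp
  next
    case (Suc n)
    have c: "(1::real) / 2 ^ Suc n \<le> 1" by (simp add: divide_le_eq_1 one_le_power del: power_Suc)
    have "(\<lambda>x. 1 / 2 ^ Suc n * U n x) \<in> B1"
    proof (rule solid_ball_solid[OF B1(1) U[of n]])
      show "AE x in M. 1 / 2 ^ Suc n * U n x \<le> U n x"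
        using mult_right_mono[OF c Unn] by (simp del: power_Suc)
    qed (auto intro!: nnfunI simp: Unn)
    moreover have e: "S (Suc n) = (\<lambda>x. S n x + 1 / 2 ^ Suc n * U n x)" by (simp add: S_def fun_eq_iff)
    ultimately have "AE x in M. l (S (Suc n)) x = l (S n) x + l (\<lambda>x. 1 / 2 ^ Suc n * U n x) x"
      using l4[OF S[of n]] S[of "Suc n"] unfolding e by blast
    moreover have "AE x in M. l (\<lambda>y. 1 / 2 ^ Suc n * U n y) x = 1 / 2 ^ Suc n * l (U n) x"
      by (rule l3[OF U _ c]) simp
    ultimately show ?case using Suc by eventually_elim simp
  qed
  have "AE x in M. (\<Sum>k<n. l (U k) x / 2 ^ Suc k) \<le> l H x" for n
    using lS[of n] l2[OF S H(1) SH[of n]] by eventually_elim simp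
  then have A1: "AE x in M. \<forall>n. (\<Sum>k<n. l (U k) x / 2 ^ Suc k) \<le> l H x" by (simp add: AE_all_countable)
  have A2: "AE x in M. \<forall>k. maximal M \<E> (U k) x < \<infinity>" using max(1)[OF U] by (simp add: AE_all_countable)
  have A3: "AE x in M. \<forall>k. enn2real (maximal M \<E> (U k) x) / N \<le> l (U (Suc k)) x"
    using T(2)[OF U] by (simp add: AE_all_countable US)
  have "maximal_dominated M \<E> (2 * N) H (l H)"
    unfolding maximal_dominated_def using A1 A2 A3
  proof eventually_elim
    case (elim x)
    show ?case
    proof (intro ballI impI)
      fix E assume E: "E \<in> \<E>" and xE: "x \<in> E"
      note Es = basis_of_setsD(1-3)[OF basis E]
      note [measurable] = Es(1)
      define m where "m = measure M E"
      have m: "0 < m" using Es by (simp add: measure_def enn2real_positive_iff m_def)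
      have avgU: "avg M 1 E (U k) \<le> ennreal (N * l (U (Suc k)) x)" for k
      proof -
        have "avg M 1 E (U k) \<le> maximal M \<E> (U k) x" by (rule avg_le_maximal[OF E xE])
        also have "\<dots> = ennreal (enn2real (maximal M \<E> (U k) x))" using elim(2)
          by (metis ennreal_enn2real infinity_ennreal_def)
        also have "\<dots> \<le> ennreal (N * l (U (Suc k)) x)"
          using elim(3) N by (intro ennreal_leI) (simp add: pos_divide_le_eq mult.commute)
        finally show ?thesis .
      qed
      have avgS: "avg M 1 E (S n) \<le> ennreal (2 * N * l H x)" for n
      proof -
        have "(\<integral>\<^sup>+y. ennreal (S n y) * indicator E y \<partial>M)
            = (\<integral>\<^sup>+y. (\<Sum>k<n. ennreal (1 / 2 ^ Suc k) * (ennreal (U k y) * indicator E y)) \<partial>M)"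
        proof (intro nn_integral_cong)
          fix y
          have "ennreal (S n y) = (\<Sum>k<n. ennreal (1 / 2 ^ Suc k) * ennreal (U k y))"
            unfolding S_def using Unn by (simp add: sum_ennreal ennreal_mult[symmetric]
                del: power_Suc)
          then show "ennreal (S n y) * indicator E y = (\<Sum>k<n. ennreal (1 / 2 ^ Suc k)
              * (ennreal (U k y) * indicator E y))"
            by (simp add: sum_distrib_right mult.assoc del: power_Suc)
        qed
        also have "\<dots> = (\<Sum>k<n. ennreal (1 / 2 ^ Suc k) * (\<integral>\<^sup>+y. ennreal (U k y) * indicator E y \<partial>M))"
          by (subst nn_integral_sum) (auto simp: nn_integral_cmult simp del: power_Suc)
        finally have "avg M 1 E (S n) = (\<Sum>k<n. ennreal (1 / 2 ^ Suc k) * avg M 1 E (U k))"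
          unfolding avg_one_real[OF Es(2,3) B1n[OF S]] avg_one_real[OF Es(2,3) B1n[OF U]]
              sum_distrib_left
          by (simp add: sum_distrib_left mult.left_commute del: power_Suc)
        also have "\<dots> \<le> (\<Sum>k<n. ennreal (1 / 2 ^ Suc k) * ennreal (N * l (U (Suc k)) x))"
          by (intro sum_mono mult_left_mono avgU) simp
        also have "\<dots> = ennreal (\<Sum>k<n. 1 / 2 ^ Suc k * (N * l (U (Suc k)) x))"
          using N lnn[OF U] by (subst sum_ennreal[symmetric]) (auto simp: ennreal_mult[symmetric]
              simp del: power_Suc)
        also have "\<dots> \<le> ennreal (2 * N * l H x)"
        proof (rule ennreal_leI)
          have "(\<Sum>k<n. 1 / 2 ^ Suc k * (N * l (U (Suc k)) x)) = 2 * N * (\<Sum>k<n. l (U (Suc k)) x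
              / 2 ^ Suc (Suc k))"
            unfolding sum_distrib_left by (intro sum.cong) auto
          also have "\<dots> \<le> 2 * N * (\<Sum>k<Suc n. l (U k) x / 2 ^ Suc k)"
            using N lnn[OF U] by (subst sum.lessThan_Suc_shift) (intro mult_left_mono, auto)
          also have "\<dots> \<le> 2 * N * l H x" using N elim(1) by (intro mult_left_mono) (auto
              simp del: sum.lessThan_Suc)
          finally show "(\<Sum>k<n. 1 / 2 ^ Suc k * (N * l (U (Suc k)) x)) \<le> 2 * N * l H x" .
        qed
        finally show ?thesis .
      qed
      have I: "(\<integral>\<^sup>+y. ennreal (H y) * indicator E y \<partial>M) \<le> ennreal m * ennreal (2 * N * l H x)"
      proof (rule nn_integral_le_of_tendsto[where f = "\<lambda>n y. ennreal (S n y) * indicator E y"])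
        show "(\<lambda>y. ennreal (S n y) * indicator E y) \<in> borel_measurable M" for n
          using nnfun_measurable[OF B1n[OF S]] by measurable
        show "AE y in M. (\<lambda>n. ennreal (S n y) * indicator E y) \<longlonglongrightarrow> ennreal (H y) * indicator E y"
          using H(2)
        proof eventually_elim
          case (elim y)
          then have "(\<lambda>n. ennreal (S n y)) \<longlonglongrightarrow> ennreal (H y)"
            unfolding sums_def S_def by (intro tendsto_ennrealI)
          then show ?case by (cases "y \<in> E") auto
        qed
        fix n
        have "(\<integral>\<^sup>+y. ennreal (S n y) * indicator E y \<partial>M) = ennreal m * avg M 1 E (S n)"
          unfolding avg_one_real[OF Es(2,3) B1n[OF S]] m_def[symmetric] mult.assoc[symmetric]
          using m by (simp add: ennreal_mult[symmetric])
        also have "\<dots> \<le> ennreal m * ennreal (2 * N * l H x)" by (intro mult_left_mono avgS) simp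
        finally show "(\<integral>\<^sup>+y. ennreal (S n y) * indicator E y \<partial>M)
            \<le> ennreal m * ennreal (2 * N * l H x)" .
      qed
      have "avg M 1 E H \<le> ennreal (1 / m) * (ennreal m * ennreal (2 * N * l H x))"
        unfolding avg_one_real[OF Es(2,3) B1n[OF H(1)]] m_def[symmetric] by (intro mult_left_mono I)
            simp
      also have "\<dots> = ennreal (2 * N * l H x)"
        unfolding mult.assoc[symmetric] using m by (simp add: ennreal_mult[symmetric])
      finally show "avg M 1 E H \<le> ennreal (2 * N * l H x)" .
    qed
  qed
  moreover have "AE x in M. H0 x / 2 \<le> H x"
    using SH[of 1] by eventually_elim (simp add: S_def U0)
  ultimately show ?thesis using H(1) l1[OF H(1)] by blast
qed

text \<open>
  Boundedness of the maximal operator with norm at most \<open>N\<close>, between spaces with unit balls \<open>B1\<close> and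
  \<open>B2\<close>; quantifying over \<open>c\<close> avoids dividing by \<open>N\<close> when it is zero.
\<close>

definition maximal_maps :: "'a measure \<Rightarrow> 'a set set \<Rightarrow> ('a \<Rightarrow> real) set \<Rightarrow> ('a \<Rightarrow> real) set \<Rightarrow> real \<Rightarrow>
    bool" where
  "maximal_maps M \<E> B1 B2 N \<longleftrightarrow>
     0 \<le> N \<and> (\<forall>u\<in>B1. (AE x in M. maximal M \<E> u x < \<infinity>) \<and>
       (\<forall>c>0. N \<le> c \<longrightarrow> (\<lambda>x. enn2real (maximal M \<E> u x) / c) \<in> B2))"

lemma maximal_bound_ball:
  fixes Z1 Z2 :: "('a, 'k::{real_normed_field, euclidean_space}) fspace"
  assumes Z1: "represents M Z1 B1" "B1 \<subseteq> nnfun M" and Z2: "represents M Z2 B2"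
    and bd: "maximal_bound M \<E> Z1 Z2 C" and c: "C \<le> c" "0 < c" and u: "u \<in> B1"
  shows "AE x in M. maximal M \<E> u x < \<infinity>" "(\<lambda>x. enn2real (maximal M \<E> u x) / c) \<in> B2"
proof -
  let ?f = "\<lambda>x. of_real (u x) :: 'k"
  note f = represents_of_real[OF Z1 u]
  have mm: "maximal M \<E> ?f = maximal M \<E> u" by (rule maximal_of_real)
  have b: "AE x in M. maximal M \<E> ?f x < \<infinity>" "maximal_fun M \<E> ?f \<in> carr Z2"
      "nrm Z2 (maximal_fun M \<E> ?f) \<le> C * nrm Z1 ?f" "0 \<le> C"
    using bd f(1) unfolding maximal_bound_def by blast+
  show "AE x in M. maximal M \<E> u x < \<infinity>" using b(1) unfolding mm .
  have "C * nrm Z1 ?f \<le> C" using f(2) b(4) by (simp add: mult_left_le)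
  with b(3) c have "nrm Z2 (maximal_fun M \<E> ?f) \<le> c" by linarith
  then have "(\<lambda>x. norm (maximal_fun M \<E> ?f x) / c) \<in> B2" using representsD(5)[OF Z2 b(2) c(2)] by simp
  then show "(\<lambda>x. enn2real (maximal M \<E> u x) / c) \<in> B2" by (simp add: maximal_fun_def mm)
qed

text \<open>
  Each inequality in the definition is a closed condition on the constant, and so the infimum satisfies
  all of them.
\<close>

lemma maximal_bound_opnorm:
  fixes Z1 Z2 :: "('a, 'k::{real_normed_field, euclidean_space}) fspace"
  assumes Z1: "represents M Z1 B1" and bd: "maximal_bounded M \<E> Z1 Z2"
  shows "maximal_bound M \<E> Z1 Z2 (maximal_opnorm M \<E> Z1 Z2)"
proof -
  let ?K = "{C. maximal_bound M \<E> Z1 Z2 C}"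
  have ne: "?K \<noteq> {}" using bd by (auto simp: maximal_bounded_def)
  have nn: "0 \<le> C" if "C \<in> ?K" for C using that by (auto simp: maximal_bound_def)
  obtain C0 where C0: "maximal_bound M \<E> Z1 Z2 C0" using ne by blast
  define K where "K = maximal_opnorm M \<E> Z1 Z2"
  have K: "K = Inf ?K" by (simp add: K_def maximal_opnorm_def)
  show ?thesis
    unfolding maximal_bound_def K_def[symmetric]
  proof (intro conjI ballI)
    show "0 \<le> K" unfolding K using ne nn by (intro cInf_greatest)
    fix f assume f: "f \<in> carr Z1"
    show "AE x in M. maximal M \<E> f x < \<infinity>" "maximal_fun M \<E> f \<in> carr Z2"
      using C0 f unfolding maximal_bound_def by blast+
    have le: "nrm Z2 (maximal_fun M \<E> f) \<le> C * nrm Z1 f" if "C \<in> ?K" for C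
      using that f unfolding maximal_bound_def by blast
    have n0: "0 \<le> nrm Z1 f" by (rule representsD(4)[OF Z1 f])
    show "nrm Z2 (maximal_fun M \<E> f) \<le> K * nrm Z1 f"
    proof (cases "nrm Z1 f = 0")
      case True
      then show ?thesis using le[of C0] C0 by simp
    next
      case False
      with n0 have n: "0 < nrm Z1 f" by simp
      have "nrm Z2 (maximal_fun M \<E> f) / nrm Z1 f \<le> K"
        unfolding K using ne le n by (intro cInf_greatest) (auto simp: pos_divide_le_eq)
      with n show ?thesis by (simp add: pos_divide_le_eq)
    qed
  qed
qed

lemma maximal_maps_opnorm:
  fixes Z1 Z2 :: "('a, 'k::{real_normed_field, euclidean_space}) fspace"
  assumes Z1: "represents M Z1 B1" "B1 \<subseteq> nnfun M" and Z2: "represents M Z2 B2"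
    and bd: "maximal_bounded M \<E> Z1 Z2"
  shows "maximal_maps M \<E> B1 B2 (maximal_opnorm M \<E> Z1 Z2)"
proof -
  note N = maximal_bound_opnorm[OF Z1(1) bd]
  have N0: "0 \<le> maximal_opnorm M \<E> Z1 Z2" using N by (simp add: maximal_bound_def)
  have "AE x in M. maximal M \<E> u x < \<infinity>" if "u \<in> B1" for u
    by (rule maximal_bound_ball(1)[OF Z1 Z2 N, of "maximal_opnorm M \<E> Z1 Z2 + 1"]) (use N0 that
        in auto)
  with N0 maximal_bound_ball(2)[OF Z1 Z2 N] show ?thesis by (simp add: maximal_maps_def)
qed

text \<open>
  The outcome of the algorithm in a form that includes \<open>a = 0\<close>, where the weights do not contain \<open>H\<close> and
  \<open>H2\<close>, and constants serve as majorants.  The constant \<open>C\<close> has to be positive, whereas \<open>N\<close> may be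
  zero if the measure is; this is the second alternative for \<open>C\<close>.
\<close>

lemma maximal_majorants_exist:
  assumes basis: "basis_of_sets M \<E>" and a: "0 \<le> a"
    and B1: "solid_ball M B1" "convex_ball B1" and B2: "solid_ball M B2"
    and l: "0 < a \<Longrightarrow> dominating_map M B1 B2 l" "0 < a \<Longrightarrow> maximal_maps M \<E> B1 B2 N"
    and H0: "H0 \<in> B1" "AE x in M. 0 < H0 x"
  obtains H H2 C where "H \<in> nnfun M" "H2 \<in> nnfun M" "AE x in M. 0 < H x" "AE x in M. 0 < H2 x" "0 < C"
    "maximal_dominated M \<E> C H H2" "C powr a = 2 powr a * rpow N a \<or> (AE x in M. False)"
    "0 < a \<longrightarrow> (AE x in M. H0 x / 2 \<le> H x)" "0 < a \<longrightarrow> H2 \<in> B2" "l = (\<lambda>u. u) \<longrightarrow> H2 = H"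
proof (cases "a = 0")
  case True
  show ?thesis
    by (rule that[of "\<lambda>x. 1" "\<lambda>x. 1" 1]) (use True maximal_dominated_one[OF basis] in \<open>auto
        simp: rpow_def\<close>)
next
  case False
  with a have a: "0 < a" by simp
  note l = l[OF a]
  have B1n: "u \<in> nnfun M" if "u \<in> B1" for u by (rule solid_ball_nnfun[OF B1(1) that])
  have B2n: "u \<in> nnfun M" if "u \<in> B2" for u by (rule solid_ball_nnfun[OF B2 that])
  have lB: "l u \<in> B2" if "u \<in> B1" for u using l(1) that unfolding dominating_map_def by blast
  have fin: "AE x in M. maximal M \<E> u x < \<infinity>" and mB: "0 < c \<Longrightarrow> N \<le> c
      \<Longrightarrow> (\<lambda>x. enn2real (maximal M \<E> u x) / c) \<in> B2"
    if "u \<in> B1" for u c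
    using l(2) that unfolding maximal_maps_def by auto
  have N0: "0 \<le> N" using l(2) by (simp add: maximal_maps_def)
  show ?thesis
  proof (cases "AE x in M. False")
    case True
    then have tr: "AE x in M. Q x" for Q by eventually_elim simp
    show ?thesis
      by (rule that[of H0 "l H0" 1]) (use H0 B1n B2n lB tr True in \<open>auto simp: maximal_dominated_def\<close>)
  next
    case nF: False
    \<comment> \<open>If \<open>N = 0\<close>, the maximal function of \<open>H0\<close> vanishes a.e., although it is positive everywhere.\<close>
    have "N \<noteq> 0"
    proof
      assume "N = 0"
      have m: "(\<lambda>x. enn2real (maximal M \<E> H0 x)) \<in> B2" using mB[OF H0(1), of 1] \<open>N = 0\<close> by simp
      have "AE x in M. enn2real (maximal M \<E> H0 x) = 0"
      proof (rule solid_ball_bounded[OF B2 B2n[OF m]])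
        fix n :: nat
        show "(\<lambda>x. real n * enn2real (maximal M \<E> H0 x)) \<in> B2"
        proof (cases "n = 0")
          case True
          then show ?thesis using solid_ball_zero[OF B2] by simp
        next
          case False
          then show ?thesis using mB[OF H0(1), of "1 / real n"] \<open>N = 0\<close> by (simp add: mult.commute)
        qed
      qed
      with fin[OF H0(1)] AE_space have "AE x in M. False"
      proof eventually_elim
        case (elim x)
        obtain E where E: "E \<in> \<E>" "x \<in> E" using basis_of_setsD(4)[OF basis elim(2)] by blast
        have "0 < avg M 1 E H0"
          by (rule avg_one_pos) (use basis_of_setsD(1-3)[OF basis E(1)] H0 B1n nnfun_measurable
              in auto)
        also have "\<dots> \<le> maximal M \<E> H0 x" by (rule avg_le_maximal[OF E])
        finally show ?case using elim by (auto simp: enn2real_eq_0_iff)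
      qed
      with nF show False ..
    qed
    with N0 have N: "0 < N" by simp
    have "\<exists>H\<in>B1. (AE x in M. H0 x / 2 \<le> H x) \<and> l H \<in> B2 \<and> maximal_dominated M \<E> (2 * N) H (l H)"
      by (rule rubio_de_francia[OF B1 l(1) _ basis N fin mB[OF _ N order_refl] H0(1)]) (use B2n
          in auto)
    then obtain H where H: "H \<in> B1" "AE x in M. H0 x / 2 \<le> H x" "l H \<in> B2"
        "maximal_dominated M \<E> (2 * N) H (l H)"
      by blast
    have Hp: "AE x in M. 0 < H x" using H0(2) H(2) by eventually_elim simp
    show ?thesis
    proof (rule that[of H "l H" "2 * N"])
      show "AE x in M. 0 < l H x"
        by (rule maximal_dominated_pos[OF basis H(4) _ Hp]) (use N B1n[OF H(1)] nnfun_measurable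
            in auto)
      show "(2 * N) powr a = 2 powr a * rpow N a \<or> (AE x in M. False)"
        using N a by (simp add: powr_mult rpow_def)
    qed (use H Hp N B1n B2n in auto)
  qed
qed

section \<open>Positive isometric isomorphisms\<close>

text \<open>
  The scalars are the reals or the complex numbers.  Multiplicativity of the Euclidean norm shows that
  \<open>w * w = - (norm w)\<^sup>2\<close> for all \<open>w\<close> orthogonal to \<open>1\<close>: the norm of \<open>1 - w * w\<close> attains the bound of
  the triangle inequality.  As \<open>- 1\<close> has at most two square roots in a field, the complement of \<open>1\<close>
  is at most one-dimensional.
\<close>

lemma scalar_structure:
  fixes dummy :: "'k::{real_normed_field, euclidean_space}"
  obtains j :: 'k where "j \<bullet> 1 = 0" "norm j \<le> 1" "\<And>z::'k. z = of_real (z \<bullet> 1) + of_real (z \<bullet> j) * j"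
proof -
  have n1: "(1::'k) \<bullet> 1 = 1" by (metis norm_eq_1 norm_one)
  have ofr: "of_real a \<bullet> (w::'k) = a * (1 \<bullet> w)" for a and w :: 'k by (simp add: of_real_def)
  have sq: "w * w = of_real (- (norm w)\<^sup>2)" if w: "w \<bullet> 1 = 0" for w :: 'k
  proof -
    have "norm (1 + w) ^ 2 = 1 + (norm w)\<^sup>2" "norm (1 - w) ^ 2 = 1 + (norm w)\<^sup>2"
      using w by (simp_all add: power2_norm_eq_inner inner_add_left inner_add_right inner_diff_left
          inner_diff_right inner_commute n1)
    then have "(norm (1 + w) * norm (1 - w)) ^ 2 = (1 + (norm w)\<^sup>2) ^ 2"
      by (simp only: power_mult_distrib) (simp only: power2_eq_square)
    moreover have "norm (1 + w) * norm (1 - w) = norm (1 - w * w)"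
      by (simp flip: norm_mult) (simp add: algebra_simps)
    ultimately have n: "norm (1 - w * w) ^ 2 = (1 + (norm w)\<^sup>2) ^ 2" by simp
    have "norm (1 - w * w) ^ 2 = 1 - 2 * ((w * w) \<bullet> 1) + (norm (w * w))\<^sup>2"
      by (simp add: power2_norm_eq_inner inner_diff_left inner_diff_right inner_commute n1)
    with n have ip: "(w * w) \<bullet> 1 = - (norm w)\<^sup>2"
      by (simp add: norm_mult power2_eq_square algebra_simps)
    have "(norm (w * w - of_real (- (norm w)\<^sup>2)))\<^sup>2 = (norm (w * w))\<^sup>2 - 2
        * ((w * w) \<bullet> of_real (- (norm w)\<^sup>2)) + (norm (of_real (- (norm w)\<^sup>2) :: 'k))\<^sup>2"
      unfolding power2_norm_eq_inner by (simp add: inner_diff_left inner_diff_right inner_commute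
          del: of_real_minus of_real_power)
    also have "\<dots> = 0"
      unfolding norm_of_real norm_mult inner_commute[of "w * w"] ofr using ip
      by (simp add: inner_commute[of 1] power2_eq_square)
    finally show ?thesis by (simp add: eq_neg_iff_add_eq_0)
  qed
  show ?thesis
  proof (cases "\<exists>w::'k. w \<bullet> 1 = 0 \<and> w \<noteq> 0")
    case False
    have z: "z = of_real (z \<bullet> 1)" for z :: 'k
    proof -
      have "(z - of_real (z \<bullet> 1)) \<bullet> 1 = 0" by (simp add: inner_diff_left ofr n1)
      with False show ?thesis by auto
    qed
    show ?thesis by (rule that[of 0]) (use z in auto)
  next
    case True
    then obtain w :: 'k where w: "w \<bullet> 1 = 0" "w \<noteq> 0" by blast
    define j where "j = (1 / norm w) *\<^sub>R w"
    have j1: "j \<bullet> 1 = 0" using w by (simp add: j_def)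
    have nj: "norm j = 1" using w by (simp add: j_def)
    have jj: "j * j = -1" using sq[OF j1] nj by simp
    have unit: "v = j \<or> v = - j" if "v \<bullet> 1 = 0" "norm v = 1" for v :: 'k
    proof -
      have "v * v = -1" using sq[OF that(1)] that(2) by simp
      then have "(v - j) * (v + j) = 0" using jj by (simp add: algebra_simps)
      then show ?thesis by (auto simp: eq_neg_iff_add_eq_0)
    qed
    have ofj: "of_real a * j = a *\<^sub>R j" for a by (simp add: scaleR_conv_of_real)
    have jij: "j \<bullet> j = 1" using nj by (simp add: norm_eq_1)
    have z: "z = of_real (z \<bullet> 1) + of_real (z \<bullet> j) * j" for z :: 'k
    proof -
      define y where "y = z - of_real (z \<bullet> 1)"
      have y1: "y \<bullet> 1 = 0" by (simp add: y_def inner_diff_left ofr n1)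
      have yj: "y \<bullet> j = z \<bullet> j" using j1 by (simp add: y_def inner_diff_left ofr inner_commute[of 1])
      have "y = of_real (y \<bullet> j) * j"
      proof (cases "y = 0")
        case False
        have "(1 / norm y) *\<^sub>R y = j \<or> (1 / norm y) *\<^sub>R y = - j" by (rule unit) (use y1 False in auto)
        then have "y = norm y *\<^sub>R j \<or> y = (- norm y) *\<^sub>R j" using False
          by (metis (no_types, lifting) divideR_right divide_inverse mult_1 norm_eq_zero
              scaleR_minus_left scaleR_minus_right inverse_eq_divide)
        then show ?thesis unfolding ofj using jij by (metis inner_scaleR_left mult.right_neutral)
      qed simp
      then show ?thesis unfolding yj by (simp add: y_def algebra_simps)
    qed
    show ?thesis by (rule that[of j]) (use j1 nj z in auto)
  qed
qed

text \<open>
  The last clause of \<open>dominating_map\<close> is the point.  If \<open>L f = v\<close>, split \<open>f\<close> into its real and imaginary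
  parts and these into positive and negative parts \<open>p1\<close>, \<open>p2\<close>, \<open>q1\<close>, \<open>q2\<close>.  Comparing real parts gives
  \<open>v = l p1 - l p2 \<le> l p1\<close>, and \<open>p1\<close> is in the unit ball because it is below the modulus of \<open>f\<close>.
\<close>

lemma dominating_map_of_pos_iso:
  fixes Z1 Z2 :: "('a, 'k::{real_normed_field, euclidean_space}) fspace"
  assumes Z1: "represents M Z1 B1" and B1: "solid_ball M B1" "convex_ball B1"
    and Z2: "represents M Z2 B2" and B2: "solid_ball M B2"
    and iso: "pos_isometric_iso M Z1 Z2 L"
  shows "dominating_map M B1 B2 (\<lambda>u x. norm (L (\<lambda>y. of_real (u y)) x))"
proof -
  let ?c = "\<lambda>u y. of_real (u y) :: 'k"
  define l where "l u x = norm (L (?c u) x)" for u x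
  note I = iso[unfolded pos_isometric_iso_def]
  note L = I[THEN conjunct1, rule_format] I[THEN conjunct2, THEN conjunct1, rule_format]
    I[THEN conjunct2, THEN conjunct2, THEN conjunct1, rule_format]
    I[THEN conjunct2, THEN conjunct2, THEN conjunct2, THEN conjunct1, rule_format]
    I[THEN conjunct2, THEN conjunct2, THEN conjunct2, THEN conjunct2, THEN conjunct1, rule_format]
    I[THEN conjunct2, THEN conjunct2, THEN conjunct2, THEN conjunct2, THEN conjunct2, rule_format]
  have B1n: "B1 \<subseteq> nnfun M" "B2 \<subseteq> nnfun M"
    using solid_ball_nnfun[OF B1(1)] solid_ball_nnfun[OF B2] by (simp_all add: subset_iff)
  note add = represents_add[OF Z1 B1] and scale = represents_scale[OF Z1 B1(1)]
  have cong: "AE x in M. L f x = L g x" if f: "f \<in> carr Z1" and g: "g \<in> carr Z1"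
      and eq: "AE x in M. f x = g x" for f g
  proof -
    let ?d = "\<lambda>x. f x + (-1) * g x"
    have d: "?d \<in> carr Z1" by (rule add[OF f scale[OF g]])
    have "AE x in M. ?d x = 0" using eq by eventually_elim simp
    then have "nrm Z1 ?d = 0" using represents_nrm_zero[OF Z1 B1(1) d] by simp
    then have "AE x in M. L ?d x = 0" using represents_nrm_zero[OF Z2 B2 L(1)[OF d]] L(4)[OF d]
      by simp
    with L(2)[OF f scale[OF g, of "-1"]] L(3)[OF g, of "-1"] show ?thesis
      by eventually_elim auto
  qed
  have cc: "?c u \<in> carr Z1" if "u \<in> B1" for u using represents_of_real(1)[OF Z1 B1n(1) that] .
  have Lc: "AE x in M. L (?c u) x = of_real (l u x)" if u: "u \<in> B1" for u
  proof -
    have "u \<in> nnfun M" using u B1n by blast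
    then have "AE x in M. ?c u x = of_real (norm (?c u x))" by (simp add: nnfun_nonneg)
    from L(6)[OF cc[OF u] this] show ?thesis unfolding l_def .
  qed
  have lB2: "l u \<in> B2" if u: "u \<in> B1" for u
  proof -
    have "nrm Z2 (L (?c u)) \<le> 1" using L(4)[OF cc[OF u]] represents_of_real(2)[OF Z1 B1n(1) u] by simp
    then have "(\<lambda>x. norm (L (?c u) x) / 1) \<in> B2" using representsD(5)[OF Z2 L(1)[OF cc[OF u]], of 1]
      by simp
    then show ?thesis by (simp add: l_def[abs_def])
  qed
  have ladd: "AE x in M. l (\<lambda>y. u y + v y) x = l u x + l v x" if u: "u \<in> B1" and v: "v \<in> B1" for u v
  proof -
    have "AE x in M. L (\<lambda>y. ?c u y + ?c v y) x = L (?c u) x + L (?c v) x"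
      by (rule L(2)[OF cc[OF u] cc[OF v]])
    with Lc[OF u] Lc[OF v] show ?thesis
    proof eventually_elim
      case (elim x)
      have "l (\<lambda>y. u y + v y) x = norm (L (\<lambda>y. ?c u y + ?c v y) x)" by (simp add: l_def)
      also have "\<dots> = norm (of_real (l u x + l v x) :: 'k)" using elim by simp
      also have "\<dots> = l u x + l v x" unfolding norm_of_real by (simp add: l_def)
      finally show ?case .
    qed
  qed
  have lmono: "AE x in M. l u x \<le> l v x" if u: "u \<in> B1" and v: "v \<in> B1" and le: "AE x in M. u x
      \<le> v x" for u v
  proof -
    have un: "u \<in> nnfun M" "v \<in> nnfun M" using u v B1n by auto
    define w where "w x = max 0 (v x - u x)" for x
    have w: "w \<in> B1"
      by (rule solid_ball_solid[OF B1(1) v]) (use un in \<open>auto simp: w_def[abs_def] nnfun_def\<close>)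
    have "AE x in M. ?c v x = ?c u x + ?c w x" using le by eventually_elim (simp add: w_def max_def
        flip: of_real_add)
    from cong[OF cc[OF v] add[OF cc[OF u] cc[OF w]] this]
    have "AE x in M. l v x = l (\<lambda>y. u y + w y) x" by eventually_elim (simp add: l_def)
    with ladd[OF u w] show ?thesis by eventually_elim (simp add: l_def)
  qed
  have lscale: "AE x in M. l (\<lambda>y. c * u y) x = c * l u x" if "u \<in> B1" "0 \<le> c" for u c
    using L(3)[OF cc[OF that(1)], of "of_real c"] by eventually_elim (use that(2)
        in \<open>simp add: l_def norm_mult\<close>)
  have ldom: "\<exists>u\<in>B1. AE x in M. v x \<le> l u x" if v: "v \<in> B2" for v
  proof -
    have vn: "v \<in> nnfun M" using v B1n by blast
    obtain f where f: "f \<in> carr Z1" and Lf: "AE x in M. L f x = of_real (v x)"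
      using L(5)[OF represents_of_real(1)[OF Z2 B1n(2) v]] by blast
    note [measurable] = representsD(1)[OF Z1 f] and LfZ = L(1)[OF f]
    have "(\<lambda>x. norm (L f x) / 1) \<in> B2"
    proof (rule solid_ball_solid[OF B2 v])
      show "(\<lambda>x. norm (L f x) / 1) \<in> nnfun M" using representsD(1)[OF Z2 LfZ] by (auto intro!: nnfunI)
      show "AE x in M. norm (L f x) / 1 \<le> v x" using Lf
        by eventually_elim (simp add: nnfun_nonneg[OF vn])
    qed
    then have "nrm Z2 (L f) \<le> 1" using representsD(5)[OF Z2 LfZ, of 1] by simp
    then have "nrm Z1 f \<le> 1" using L(4)[OF f] by simp
    then have nf: "(\<lambda>x. norm (f x)) \<in> B1" using representsD(5)[OF Z1 f, of 1] by simp
    obtain j :: 'k where j: "j \<bullet> 1 = 0" "norm j \<le> 1" "\<And>z::'k. z = of_real (z \<bullet> 1) + of_real (z \<bullet> j)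
        * j"
      using scalar_structure by blast
    have n1: "(1::'k) \<bullet> 1 = 1" by (metis norm_eq_1 norm_one)
    have small: "u \<in> B1" if "u \<in> nnfun M" "\<And>x. u x \<le> norm (f x)" for u
      by (rule solid_ball_solid[OF B1(1) nf that(1)]) (simp add: that(2))
    have i1: "\<bar>f x \<bullet> 1\<bar> \<le> norm (f x)" for x using Cauchy_Schwarz_ineq2[of "f x" 1] by simp
    have ij: "\<bar>f x \<bullet> j\<bar> \<le> norm (f x)" for x
      using Cauchy_Schwarz_ineq2[of "f x" j] mult_left_le[OF j(2) norm_ge_zero[of "f x"]] by linarith
    define p1 where "p1 x = max 0 (f x \<bullet> 1)" for x
    define p2 where "p2 x = max 0 (- (f x \<bullet> 1))" for x
    define q1 where "q1 x = max 0 (f x \<bullet> j)" for x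
    define q2 where "q2 x = max 0 (- (f x \<bullet> j))" for x
    have p: "p1 \<in> B1" "p2 \<in> B1" "q1 \<in> B1" "q2 \<in> B1"
      using i1 ij unfolding p1_def p2_def q1_def q2_def
      by (auto intro!: small nnfunI simp: abs_le_iff)
    let ?g = "\<lambda>y. (?c p1 y + (-1) * ?c p2 y) + j * (?c q1 y + (-1) * ?c q2 y)"
    have a1: "(\<lambda>y. ?c p1 y + (-1) * ?c p2 y) \<in> carr Z1" "(\<lambda>y. ?c q1 y + (-1) * ?c q2 y) \<in> carr Z1"
      by (intro add scale cc p)+
    have fg: "f = ?g"
    proof
      fix x
      have "f x \<bullet> 1 = p1 x + (-1) * p2 x" "f x \<bullet> j = q1 x + (-1) * q2 x"
        by (auto simp: p1_def p2_def q1_def q2_def)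
      then show "f x = ?g x" using j(3)[of "f x"] by (simp add: mult.commute)
    qed
    have "AE x in M. L f x = L (\<lambda>y. ?c p1 y + (-1) * ?c p2 y) x + L (\<lambda>y. j * (?c q1 y + (-1)
        * ?c q2 y)) x"
      unfolding fg by (rule L(2)[OF a1(1) scale[OF a1(2)]])
    with Lf L(3)[OF a1(2), of j] L(2)[OF cc[OF p(1)] scale[OF cc[OF p(2)], of "-1"]]
      L(2)[OF cc[OF p(3)] scale[OF cc[OF p(4)], of "-1"]] L(3)[OF cc[OF p(2)],
          of "-1"] L(3)[OF cc[OF p(4)], of "-1"]
      Lc[OF p(1)] Lc[OF p(2)] Lc[OF p(3)] Lc[OF p(4)]
    have "AE x in M. v x \<le> l p1 x"
    proof eventually_elim
      case (elim x)
      have "of_real (v x) = of_real (l p1 x - l p2 x) + of_real (l q1 x - l q2 x) * j"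
        using elim by (simp add: algebra_simps)
      then have "of_real (v x) \<bullet> (1::'k) = (of_real (l p1 x - l p2 x) + of_real (l q1 x - l q2 x)
          * j) \<bullet> 1" by simp
      moreover have "of_real a \<bullet> (1::'k) = a" for a by (simp add: of_real_def n1)
      moreover have "(of_real a * j) \<bullet> 1 = 0" for a using j(1) by (simp add: of_real_def)
      ultimately have "v x = l p1 x - l p2 x" by (simp only: inner_add_left)
      then show ?case by (simp add: l_def)
    qed
    with p(1) show ?thesis by blast
  qed
  show ?thesis
    unfolding dominating_map_def l_def[symmetric, abs_def]
    using lB2 lmono lscale ladd ldom by simp
qed

section \<open>Extrapolation\<close>

text \<open>
  Both norm estimates are Hoelder's inequality applied to pointwise bounds:
  \<open>|w1 f| \<le> 2\<^sup>a c (H0 G1)\<^sup>b k\<^bsup>1/s\<^sub>1\<^esup>\<close> follows from \<open>H \<ge> H0/2\<close>, and \<open>G0\<^bsup>a+b\<^esup> |h| \<le> 2\<^sup>b (H2 G0)\<^sup>a |w2 h|\<close> from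
  \<open>G \<ge> G0/2\<close>; the products \<open>H0 G1\<close> and \<open>H2 G0\<close> of functions in mutually dual balls have integral at
  most one.
\<close>

lemma (in sigma_finite_measure) weight_pair_exists:
  fixes P1 P2 :: "('a \<Rightarrow> real) set" and \<E> :: "'a set set" and r\<^sub>1 r\<^sub>2 t\<^sub>2 :: real
      and p\<^sub>1 p\<^sub>2 s\<^sub>1 :: ennreal
  defines "a \<equiv> 1 / r\<^sub>1 - recip p\<^sub>1" and "b \<equiv> recip p\<^sub>2 - t\<^sub>2"
  assumes basis: "basis_of_sets M \<E>"
    and ps: "0 < p\<^sub>1" "0 < p\<^sub>2" "0 < s\<^sub>1" "0 < r\<^sub>2"
    and ab: "0 \<le> a" "0 \<le> b" "recip p\<^sub>1 = recip s\<^sub>1 + b" "1 / r\<^sub>2 = recip p\<^sub>2 + a"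
    and P1: "solid_ball M P1" "convex_ball P1" and P2: "solid_ball M P2" "convex_ball P2"
    and l1: "0 < a \<Longrightarrow> dominating_map M (polar M P1) (polar M P2) l1"
      "0 < a \<Longrightarrow> maximal_maps M \<E> (polar M P1) (polar M P2) N1"
    and l2: "0 < b \<Longrightarrow> dominating_map M (polar M (polar M P2)) (polar M (polar M P1)) l2"
      "0 < b \<Longrightarrow> maximal_maps M \<E> (polar M (polar M P2)) (polar M (polar M P1)) N2"
    and H0: "H0 \<in> polar M P1" "AE x in M. 0 < H0 x"
    and G0: "G0 \<in> P2" "AE x in M. 0 < G0 x"
    and k: "k \<in> nnfun M" "(\<integral>\<^sup>+x. ennreal (k x) \<partial>M) \<le> 1"
  obtains w1 w2 where "weight M w1" "weight M w2"
    "A_const M \<E> p\<^sub>1 p\<^sub>2 r\<^sub>1 t\<^sub>2 w1 w2 \<le> ennreal (2 powr (a + b) * rpow N1 a * rpow N2 b)"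
    "\<forall>f :: 'a \<Rightarrow> 'k::{real_normed_field, euclidean_space}. \<forall>c\<ge>0. f \<in> borel_measurable M \<longrightarrow>
      (AE x in M. norm (f x) \<le> c * (H0 x powr (a + b) * k x powr recip s\<^sub>1)) \<longrightarrow>
      weighted_norm M p\<^sub>1 w1 f \<le> ennreal (2 powr a * c)"
    "\<forall>h :: 'a \<Rightarrow> 'k. h \<in> borel_measurable M \<longrightarrow>
      Lp_norm M (ennreal r\<^sub>2) (\<lambda>x. G0 x powr (a + b) *\<^sub>R h x) \<le> ennreal (2 powr b) * weighted_norm M
          p\<^sub>2 w2 h"
    "l1 = (\<lambda>u. u) \<longrightarrow> l2 = (\<lambda>u. u) \<longrightarrow> w1 = w2"
proof -
  have n: "u \<in> nnfun M" if "u \<in> P1 \<or> u \<in> P2" for u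
    using that solid_ball_nnfun[OF P1(1)] solid_ball_nnfun[OF P2(1)] by blast
  have pP1: "solid_ball M (polar M P1)" and pP2: "solid_ball M (polar M P2)"
    by (rule polar_solid_ball[OF P1], rule polar_solid_ball[OF P2])
  have cP1: "convex_ball (polar M P1)" and cP2: "convex_ball (polar M P2)"
    by (rule polar_convex, use n in blast)+
  have ppP1: "solid_ball M (polar M (polar M P1))" and ppP2: "solid_ball M (polar M (polar M P2))"
    by (rule polar_solid_ball[OF pP1 cP1], rule polar_solid_ball[OF pP2 cP2])
  have cppP2: "convex_ball (polar M (polar M P2))"
    by (rule polar_convex) (use polar_nnfun in blast)
  have H0n: "H0 \<in> nnfun M" and G0n: "G0 \<in> nnfun M" using polar_nnfun[OF H0(1)] n G0(1) by auto
  have G0': "G0 \<in> polar M (polar M P2)"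
    using G0n polarD[OF _ G0(1)] by (auto simp: polar_def mult.commute)
  obtain H H2 C where H: "H \<in> nnfun M" "H2 \<in> nnfun M" "AE x in M. 0 < H x" "AE x in M. 0 < H2 x"
      "0 < C"
    "maximal_dominated M \<E> C H H2" "C powr a = 2 powr a * rpow N1 a \<or> (AE x in M. False)"
    "0 < a \<longrightarrow> (AE x in M. H0 x / 2 \<le> H x)" "0 < a \<longrightarrow> H2 \<in> polar M P2" "l1 = (\<lambda>u. u) \<longrightarrow> H2 = H"
    by (rule maximal_majorants_exist[OF basis ab(1) pP1 cP1 pP2 l1 H0]) (assumption, assumption, rule that)
  obtain G G1 D where G: "G \<in> nnfun M" "G1 \<in> nnfun M" "AE x in M. 0 < G x" "AE x in M. 0 < G1 x"
      "0 < D"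
    "maximal_dominated M \<E> D G G1" "D powr b = 2 powr b * rpow N2 b \<or> (AE x in M. False)"
    "0 < b \<longrightarrow> (AE x in M. G0 x / 2 \<le> G x)" "0 < b \<longrightarrow> G1 \<in> polar M (polar M P1)" "l2 = (\<lambda>u. u) \<longrightarrow> G1 = G"
    by (rule maximal_majorants_exist[OF basis ab(2) ppP2 cppP2 ppP1 l2 G0' G0(2)]) (assumption, assumption,
        rule that)
  note [measurable] = H(1,2)[THEN nnfun_measurable] G(1,2)[THEN nnfun_measurable]
      H0n[THEN nnfun_measurable]
    G0n[THEN nnfun_measurable] k(1)[THEN nnfun_measurable]
  note nn = nnfun_nonneg[OF H(1)] nnfun_nonneg[OF H(2)] nnfun_nonneg[OF G(1)] nnfun_nonneg[OF G(2)]
    nnfun_nonneg[OF H0n] nnfun_nonneg[OF G0n] nnfun_nonneg[OF k(1)]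
  define w1 where "w1 = (\<lambda>x. H x powr - a * G1 x powr b)"
  define w2 where "w2 = (\<lambda>x. H2 x powr - a * G x powr b)"
  have [measurable]: "w1 \<in> borel_measurable M" "w2 \<in> borel_measurable M"
    unfolding w1_def w2_def by measurable
  have w0: "0 \<le> w1 x" "0 \<le> w2 x" for x by (auto simp: w1_def w2_def)
  have HG1: "(\<integral>\<^sup>+x. ennreal (H0 x * G1 x) \<partial>M) \<le> 1" if "0 < b"
    by (rule polarD[OF G(9)[rule_format, OF that] H0(1)])
  have HG2: "(\<integral>\<^sup>+x. ennreal (H2 x * G0 x) \<partial>M) \<le> 1" if "0 < a"
    using polarD[OF H(9)[rule_format, OF that] G0(1)] by (simp add: mult.commute)
  show ?thesis
  proof (rule that[of w1 w2]; (intro allI impI)?)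
    show "weight M w1" "weight M w2"
      unfolding weight_def using H(3) G(4) H(4) G(3)
      by (auto elim!: eventually_elim2 simp: w1_def w2_def)
    show "A_const M \<E> p\<^sub>1 p\<^sub>2 r\<^sub>1 t\<^sub>2 w1 w2 \<le> ennreal (2 powr (a + b) * rpow N1 a * rpow N2 b)"
    proof (cases "AE x in M. False")
      case True
      \<comment> \<open>Over a null space the basis is empty, since its sets have positive measure.\<close>
      have "E \<notin> \<E>" for E
      proof
        assume "E \<in> \<E>"
        note Es = basis_of_setsD(1-3)[OF basis this]
        have "AE x in M. x \<notin> E" using True by eventually_elim simp
        with Es show False by (simp add: AE_iff_null_sets[symmetric] null_sets_def)
      qed
      then have "\<E> = {}" by blast
      then show ?thesis by (simp add: A_const_def bot_ennreal)
    next
      case False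
      then have "C powr a * D powr b = 2 powr (a + b) * rpow N1 a * rpow N2 b"
        using H(7) G(7) by (simp add: powr_add)
      then show ?thesis
        using A_const_le[OF basis ab(1,2)[unfolded a_def b_def] H(1,2) G(1,2) H(3,4) G(3,4) H(5)
            G(5) H(6) G(6)]
        unfolding w1_def w2_def a_def[symmetric] b_def[symmetric] by simp
    qed
    show "weighted_norm M p\<^sub>1 w1 f \<le> ennreal (2 powr a * c)"
      if f [measurable]: "f \<in> borel_measurable M" and c: "0 \<le> c"
        and le: "AE x in M. norm (f x) \<le> c * (H0 x powr (a + b) * k x powr recip s\<^sub>1)"
          for f :: "'a \<Rightarrow> 'k" and c
    proof -
      let ?K = "\<lambda>x. 2 powr a * c * k x powr recip s\<^sub>1"
      have "weighted_norm M p\<^sub>1 w1 f \<le> Lp_norm M s\<^sub>1 ?K"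
        unfolding weighted_norm_def
      proof (rule Lp_norm_le_of_Hoelder[OF ps(3,1) ab(2,3), where v = "\<lambda>x. H0 x * G1 x"])
        have A: "AE x in M. H x powr - a \<le> 2 powr a * H0 x powr - a"
        proof (cases "0 < a")
          case True
          show ?thesis
            using H(8)[rule_format, OF True] H0(2)
          proof eventually_elim
            case (elim x)
            then have "H x powr - a \<le> (H0 x / 2) powr - a" using True by (intro powr_mono2') auto
            also have "\<dots> = 2 powr a * H0 x powr - a" by (simp add: powr_divide powr_minus_divide)
            finally show ?case .
          qed
        next
          case False
          with ab(1) have "a = 0" by simp
          then show ?thesis using H0(2) by (auto elim!: eventually_mono simp: powr_def)
        qed
        show "AE x in M. norm (w1 x *\<^sub>R f x) \<le> (H0 x * G1 x) powr b * norm (?K x)"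
          using A le H0(2)
        proof eventually_elim
          case (elim x)
          have "norm (w1 x *\<^sub>R f x) = H x powr - a * G1 x powr b * norm (f x)" by (simp add: w1_def)
          also have "\<dots> \<le> (2 powr a * H0 x powr - a) * G1 x powr b
              * (c * (H0 x powr (a + b) * k x powr recip s\<^sub>1))"
            using elim by (intro mult_mono) auto
          also have "\<dots> = (H0 x powr - a * H0 x powr (a + b)) * G1 x powr b * (2 powr a * c
              * k x powr recip s\<^sub>1)"
            by (simp add: ac_simps)
          also have "H0 x powr - a * H0 x powr (a + b) = H0 x powr b"
            by (simp add: powr_add[symmetric])
          finally show ?case using c by (simp add: powr_mult)
        qed
      qed (use HG1 nn in auto)
      also have "\<dots> \<le> Lp_norm M \<infinity> (\<lambda>x. 2 powr a * c)"
        by (rule Lp_norm_le_of_Hoelder[where a = "recip s\<^sub>1" and v = k])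
           (use ps recip_nonneg k nn recip_top in \<open>auto simp: abs_mult mult.commute\<close>)
      also have "\<dots> \<le> ennreal (2 powr a * c)"
        unfolding Lp_norm_def using c by (auto intro!: esssup_I)
      finally show ?thesis .
    qed
    show "Lp_norm M (ennreal r\<^sub>2) (\<lambda>x. G0 x powr (a + b) *\<^sub>R h x) \<le> ennreal (2 powr b)
        * weighted_norm M p\<^sub>2 w2 h"
      if h [measurable]: "h \<in> borel_measurable M" for h :: "'a \<Rightarrow> 'k"
    proof -
      have "Lp_norm M (ennreal r\<^sub>2) (\<lambda>x. G0 x powr (a + b) *\<^sub>R h x)
          \<le> Lp_norm M p\<^sub>2 (\<lambda>x. 2 powr b *\<^sub>R (w2 x *\<^sub>R h x))"
      proof (rule Lp_norm_le_of_Hoelder[OF ps(2) _ ab(1), where v = "\<lambda>x. H2 x * G0 x"])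
        show "recip (ennreal r\<^sub>2) = recip p\<^sub>2 + a" using ab(4) ps(4) by (simp add: recip_ennreal)
        have A: "AE x in M. G0 x powr b \<le> 2 powr b * G x powr b"
        proof (cases "0 < b")
          case True
          show ?thesis
            using G(8)[rule_format, OF True]
          proof eventually_elim
            case (elim x)
            then have "G0 x powr b \<le> (2 * G x) powr b" using True nn by (intro powr_mono2) auto
            then show ?case by (simp add: powr_mult)
          qed
        next
          case False
          with ab(2) have "b = 0" by simp
          then show ?thesis using G(3) by (auto elim!: eventually_mono simp: powr_def)
        qed
        show "AE x in M. norm (G0 x powr (a + b) *\<^sub>R h x) \<le> (H2 x * G0 x) powr a
            * norm (2 powr b *\<^sub>R (w2 x *\<^sub>R h x))"
          using A H(4)
        proof eventually_elim
          case (elim x)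
          have "norm (G0 x powr (a + b) *\<^sub>R h x) = G0 x powr a * G0 x powr b * norm (h x)"
            by (simp add: powr_add)
          also have "\<dots> \<le> G0 x powr a * (2 powr b * G x powr b) * norm (h x)"
            using elim by (intro mult_right_mono mult_left_mono) auto
          also have "\<dots> = (H2 x powr a * H2 x powr - a) * G0 x powr a * (2 powr b * G x powr b)
              * norm (h x)"
            using elim by (simp add: powr_add[symmetric])
          also have "\<dots> = (H2 x * G0 x) powr a * norm (2 powr b *\<^sub>R (w2 x *\<^sub>R h x))"
            by (simp add: powr_mult w2_def ac_simps)
          finally show ?case .
        qed
      qed (use HG2 nn ps in auto)
      also have "\<dots> \<le> ennreal (2 powr b) * weighted_norm M p\<^sub>2 w2 h"
        unfolding weighted_norm_def by (rule Lp_norm_scale_le[OF ps(2)]) auto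
      finally show ?thesis .
    qed
    show "w1 = w2" if "l1 = (\<lambda>u. u)" "l2 = (\<lambda>u. u)"
      using H(10)[rule_format, OF that(1)] G(10)[rule_format, OF that(2)] by (simp add: w1_def w2_def)
  qed
qed

text \<open>
  The bipolar theorem for the unit ball of \<open>Y\<^sup>r\<close>, with its dual parametrized by \<open>g0 = G\<^bsup>1-rt\<^esup>\<close>.  Positive
  test functions suffice because any \<open>g0\<close> in the dual ball is a limit of convex combinations with a
  weak unit.
\<close>

lemma (in sigma_finite_measure) carr_of_test_functions:
  fixes Y :: "('a, 'k::{real_normed_field, euclidean_space}) fspace"
  assumes Y: "quasi_BFS M Y" and r: "0 < r" and t: "r * t < 1" and conv: "fs_convex r Y"
    and g [measurable]: "g \<in> borel_measurable M" and c: "0 < c"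
    and test: "\<And>G. G \<in> power_ball M (1 / (1 - r * t)) (polar M (power_ball M r (ball_of M Y))) \<Longrightarrow>
      (AE x in M. 0 < G x) \<Longrightarrow> Lp_norm M (ennreal r) (\<lambda>x. G x powr (1 / r - t) *\<^sub>R g x) \<le> ennreal c"
  shows "g \<in> carr Y" "nrm Y g \<le> c"
proof -
  let ?B = "power_ball M r (ball_of M Y)"
  have sB: "solid_ball M ?B" by (rule power_ball_solid[OF ball_of_solid[OF Y] r])
  have cB: "convex_ball ?B" by (rule power_ball_convex_of_fs_convex[OF Y r conv])
  have pB: "solid_ball M (polar M ?B)" by (rule polar_solid_ball[OF sB cB])
  have cpB: "convex_ball (polar M ?B)" by (rule polar_convex) (auto simp: power_ball_def)
  obtain e where e: "e \<in> polar M ?B" "AE x in M. 0 < e x" using weak_unit_exists[OF pB cpB] by blast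
  define h where "h x = (norm (g x) / c) powr r" for x
  have hm [measurable]: "h \<in> borel_measurable M" unfolding h_def[abs_def] by measurable
  have h0: "0 \<le> h x" for x by (simp add: h_def)
  have pos: "(\<integral>\<^sup>+x. ennreal (h x * g0 x) \<partial>M) \<le> 1" if g0: "g0 \<in> polar M ?B" and g0p: "AE x in M. 0
      < g0 x" for g0
  proof -
    define \<theta> where "\<theta> = 1 - r * t"
    have \<theta>: "0 < \<theta>" using t by (simp add: \<theta>_def)
    note gn = polar_nnfun[OF g0] and [measurable] = nnfun_measurable[OF polar_nnfun[OF g0]]
    define G where "G x = g0 x powr (1 / \<theta>)" for x
    have Gt: "G x powr \<theta> = g0 x" for x using \<theta> nnfun_nonneg[OF gn] by (simp add: G_def powr_powr)
    have "G \<in> power_ball M (1 / \<theta>) (polar M ?B)"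
      using g0 Gt by (auto simp: power_ball_def G_def[abs_def] intro!: nnfunI)
    moreover have "AE x in M. 0 < G x" using g0p by eventually_elim (simp add: G_def)
    ultimately have "Lp_norm M (ennreal r) (\<lambda>x. G x powr (1 / r - t) *\<^sub>R g x) \<le> ennreal c"
      unfolding \<theta>_def by (rule test)
    then have "epowr (\<integral>\<^sup>+x. ennreal (norm (G x powr (1 / r - t) *\<^sub>R g x) powr r) \<partial>M) (1 / r)
        \<le> ennreal c"
      by (simp add: Lp_norm_ennreal[OF r])
    moreover have "norm (G x powr (1 / r - t) *\<^sub>R g x) powr r = c powr r * (h x * g0 x)" for x
    proof -
      have "(G x powr (1 / r - t)) powr r = g0 x"
      proof -
        have "(1 / r - t) * r = \<theta>" using r by (simp add: \<theta>_def left_diff_distrib)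
        then show ?thesis by (simp only: powr_powr Gt)
      qed
      then show ?thesis using c by (simp add: h_def powr_mult powr_divide)
    qed
    ultimately have "epowr (\<integral>\<^sup>+x. ennreal (c powr r * (h x * g0 x)) \<partial>M) (1 / r) \<le> ennreal c" by simp
    then have le: "epowr (epowr (\<integral>\<^sup>+x. ennreal (c powr r * (h x * g0 x)) \<partial>M) (1 / r)) r
        \<le> epowr (ennreal c) r"
      by (rule epowr_mono) (use r in simp)
    have ee: "epowr (epowr y (1 / r)) r = y" for y using r by (cases y) (auto
        simp: epowr_def powr_powr)
    have "(\<integral>\<^sup>+x. ennreal (c powr r * (h x * g0 x)) \<partial>M) \<le> ennreal (c powr r)"
      using le c unfolding ee by (simp add: epowr_ennreal)
    moreover have "(\<integral>\<^sup>+x. ennreal (h x * g0 x) \<partial>M) = ennreal (1 / c powr r)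
        * (\<integral>\<^sup>+x. ennreal (c powr r * (h x * g0 x)) \<partial>M)"
      using c h0 nnfun_nonneg[OF gn] by (subst nn_integral_cmult[symmetric]) (auto
          simp: ennreal_mult[symmetric] intro!: nn_integral_cong)
    ultimately have "(\<integral>\<^sup>+x. ennreal (h x * g0 x) \<partial>M) \<le> ennreal (1 / c powr r) * ennreal (c powr r)"
      by (simp add: mult_left_mono)
    also have "\<dots> = 1" using c by (simp add: ennreal_mult[symmetric])
    finally show ?thesis .
  qed
  have "h \<in> ?B"
  proof (rule bipolar[OF sB cB])
    show "h \<in> nnfun M" using h0 by auto
    fix g0 assume g0: "g0 \<in> polar M ?B"
    note gn = polar_nnfun[OF g0] and [measurable] = nnfun_measurable[OF polar_nnfun[OF g0]]
    show "(\<integral>\<^sup>+x. ennreal (h x * g0 x) \<partial>M) \<le> 1"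
    proof (rule nn_integral_le_of_tendsto[where f = "\<lambda>n x. ennreal ((1 - 1 / real (Suc n))
        * (h x * g0 x))"])
      have "(\<lambda>n. (1 - 1 / real (Suc n)) * (h x * g0 x)) \<longlonglongrightarrow> (1 - 0) * (h x * g0 x)" for x
        by (intro tendsto_intros LIMSEQ_Suc[OF lim_1_over_n])
      then show "AE x in M. (\<lambda>n. ennreal ((1 - 1 / real (Suc n)) * (h x * g0 x))) \<longlonglongrightarrow> ennreal (h x
          * g0 x)"
        by (intro AE_I2 tendsto_ennrealI) simp
      fix n
      define \<epsilon> where "\<epsilon> = 1 / real (Suc n)"
      have \<epsilon>: "0 < \<epsilon>" "\<epsilon> \<le> 1" by (auto simp: \<epsilon>_def divide_le_eq_1)
      define g1 where "g1 x = \<epsilon> * e x + (1 - \<epsilon>) * g0 x" for x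
      have g1: "g1 \<in> polar M ?B" unfolding g1_def[abs_def] by (rule convex_ballD[OF cpB e(1) g0])
          (use \<epsilon> in auto)
      have "AE x in M. 0 < g1 x"
        using e(2) by eventually_elim (use \<epsilon> nnfun_nonneg[OF gn] in \<open>auto
            simp: g1_def add_pos_nonneg\<close>)
      from pos[OF g1 this] have "(\<integral>\<^sup>+x. ennreal (h x * g1 x) \<partial>M) \<le> 1" .
      moreover have "(\<integral>\<^sup>+x. ennreal ((1 - \<epsilon>) * (h x * g0 x)) \<partial>M) \<le> (\<integral>\<^sup>+x. ennreal (h x * g1 x) \<partial>M)"
      proof (intro nn_integral_mono ennreal_leI)
        fix x
        have "h x * ((1 - \<epsilon>) * g0 x) \<le> h x * g1 x"
          using h0 \<epsilon> nnfun_nonneg[OF polar_nnfun[OF e(1)]] by (intro mult_left_mono) (auto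
              simp: g1_def)
        then show "(1 - \<epsilon>) * (h x * g0 x) \<le> h x * g1 x" by (simp add: ac_simps)
      qed
      ultimately show "(\<integral>\<^sup>+x. ennreal ((1 - 1 / real (Suc n)) * (h x * g0 x)) \<partial>M) \<le> 1"
        unfolding \<epsilon>_def by (rule order_trans[rotated])
    qed simp
  qed
  then have "(\<lambda>x. h x powr (1 / r)) \<in> ball_of M Y" by (simp add: power_ball_def)
  moreover have "h x powr (1 / r) = norm (g x) / c" for x using r c by (simp add: h_def powr_powr)
  ultimately have gB: "(\<lambda>x. norm (g x) / c) \<in> ball_of M Y" by simp
  show "g \<in> carr Y" by (rule representsD(3)[OF ball_of_represents[OF Y] g c gB])
  then show "nrm Y g \<le> c" using representsD(5)[OF ball_of_represents[OF Y] _ c] gB by blast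
qed

text \<open>
  Common to the situations of one and of two weights.  The hypothesis \<open>key\<close> is the weighted estimate,
  and \<open>D\<close> stands for the statement that the argument of the operator belongs to its domain, from which
  measurability of its value \<open>g\<close> follows.  The case of one weight is recovered from \<open>l1\<close> and \<open>l2\<close> being identities.
\<close>

lemma (in sigma_finite_measure) extrapolation_core:
  fixes X Y :: "('a, 'k::{real_normed_field, euclidean_space}) fspace"
    and r\<^sub>1 r\<^sub>2 t\<^sub>2 :: real and p\<^sub>1 p\<^sub>2 s\<^sub>1 :: ennreal and \<E> :: "'a set set"
  defines "a \<equiv> 1 / r\<^sub>1 - recip p\<^sub>1" and "b \<equiv> recip p\<^sub>2 - t\<^sub>2"
  assumes basis: "basis_of_sets M \<E>"
    and ps: "0 < p\<^sub>1" "0 < p\<^sub>2" "0 < s\<^sub>1" "0 < r\<^sub>1" "0 < r\<^sub>2"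
    and ab: "0 \<le> a" "0 \<le> b" "0 < a + b" "recip p\<^sub>1 = recip s\<^sub>1 + b" "1 / r\<^sub>2 = recip p\<^sub>2 + a"
    and X: "quasi_BFS M X" "fs_convex r\<^sub>1 X" "fs_concave (recip s\<^sub>1) X"
    and Y: "quasi_BFS M Y" "fs_convex r\<^sub>2 Y"
    and P1: "P1 = pre_ball M r\<^sub>1 (recip s\<^sub>1) X"
    and P2: "P2 = pre_ball M r\<^sub>2 t\<^sub>2 Y" "convex_ball P2"
    and l1: "0 < a \<longrightarrow> dominating_map M (polar M P1) (polar M P2) l1"
      "0 < a \<longrightarrow> maximal_maps M \<E> (polar M P1) (polar M P2) N1"
    and l2: "0 < b \<longrightarrow> dominating_map M (polar M (polar M P2)) (polar M (polar M P1)) l2"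
      "0 < b \<longrightarrow> maximal_maps M \<E> (polar M (polar M P2)) (polar M (polar M P1)) N2"
    and f: "f \<in> carr X" and K: "0 \<le> K"
    and key: "\<And>w1 w2. weight M w1 \<Longrightarrow> weight M w2 \<Longrightarrow>
      A_const M \<E> p\<^sub>1 p\<^sub>2 r\<^sub>1 t\<^sub>2 w1 w2 \<le> ennreal (2 powr (a + b) * rpow N1 a * rpow N2 b) \<Longrightarrow>
      (l1 = (\<lambda>u. u) \<longrightarrow> l2 = (\<lambda>u. u) \<longrightarrow> w1 = w2) \<Longrightarrow> weighted_norm M p\<^sub>1 w1 f < \<infinity> \<Longrightarrow>
      D \<and> g \<in> borel_measurable M \<and> weighted_norm M p\<^sub>2 w2 g \<le> ennreal K * weighted_norm M p\<^sub>1 w1 f"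
  shows "D \<and> g \<in> carr Y \<and> nrm Y g \<le> 2 powr (a + b) * K * nrm X f"
proof -
  have fm: "f \<in> borel_measurable M" by (rule quasi_BFS_meas[OF X(1) f])
  have n0: "0 \<le> nrm X f" by (rule quasi_BFS_nrm_nonneg[OF X(1) f])
  have \<delta>: "1 / r\<^sub>1 - recip s\<^sub>1 = a + b" "1 / r\<^sub>2 - t\<^sub>2 = a + b" using ab(4,5)
    by (simp_all add: a_def b_def)
  have rt1: "r\<^sub>1 * recip s\<^sub>1 < 1" and rt2: "r\<^sub>2 * t\<^sub>2 < 1"
  proof -
    have "recip s\<^sub>1 < 1 / r\<^sub>1" "t\<^sub>2 < 1 / r\<^sub>2" using \<delta> ab(3) by linarith+
    then show "r\<^sub>1 * recip s\<^sub>1 < 1" "r\<^sub>2 * t\<^sub>2 < 1" using ps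
      by (simp_all add: pos_less_divide_eq mult.commute)
  qed
  have sP: "solid_ball M (pre_ball M r t Z)" if "quasi_BFS M Z" "0 < r" "fs_convex r Z" "r * t < 1"
    for r t and Z :: "('a, 'k) fspace"
    using that
    by (intro power_ball_solid polar_solid_ball ball_of_solid power_ball_convex_of_fs_convex) auto
  have sP1: "solid_ball M P1" unfolding P1 by (rule sP[OF X(1) ps(4) X(2) rt1])
  have sP2: "solid_ball M P2" unfolding P2 by (rule sP[OF Y(1) ps(5) Y(2) rt2])
  have cP1: "convex_ball P1"
    unfolding P1 by (rule pre_ball_convex[OF sigma_finite_measure_axioms X(1) ps(4) rt1 X(2,3)])
  have main: "D \<and> g \<in> borel_measurable M \<and>
      Lp_norm M (ennreal r\<^sub>2) (\<lambda>x. G0 x powr (1 / r\<^sub>2 - t\<^sub>2) *\<^sub>R g x) \<le> ennreal (2 powr (a + b) * K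
          * c)"
    if c: "nrm X f < c" and G0: "G0 \<in> P2" "AE x in M. 0 < G0 x" for c G0
  proof -
    obtain H k where H: "H \<in> polar M P1" "AE x in M. 0 < H x" and k: "k \<in> nnfun M"
        "(\<integral>\<^sup>+x. ennreal (k x) \<partial>M) \<le> 1"
      and le: "AE x in M. norm (f x) \<le> c * (H x powr (a + b) * k x powr recip s\<^sub>1)"
      by (rule function_factorization[OF X(1) ps(4) recip_nonneg rt1 X(2,3) f c, folded P1, unfolded
          \<delta>]) (rule that)
    obtain w1 w2 where w: "weight M w1" "weight M w2"
      "A_const M \<E> p\<^sub>1 p\<^sub>2 r\<^sub>1 t\<^sub>2 w1 w2 \<le> ennreal (2 powr (a + b) * rpow N1 a * rpow N2 b)"
      and wf: "\<forall>f :: 'a \<Rightarrow> 'k. \<forall>c\<ge>0. f \<in> borel_measurable M \<longrightarrow>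
        (AE x in M. norm (f x) \<le> c * (H x powr (a + b) * k x powr recip s\<^sub>1)) \<longrightarrow>
        weighted_norm M p\<^sub>1 w1 f \<le> ennreal (2 powr a * c)"
      and wh: "\<forall>h :: 'a \<Rightarrow> 'k. h \<in> borel_measurable M \<longrightarrow>
        Lp_norm M (ennreal r\<^sub>2) (\<lambda>x. G0 x powr (a + b) *\<^sub>R h x) \<le> ennreal (2 powr b) * weighted_norm
            M p\<^sub>2 w2 h"
      and eq: "l1 = (\<lambda>u. u) \<longrightarrow> l2 = (\<lambda>u. u) \<longrightarrow> w1 = w2"
      by (rule weight_pair_exists[OF basis ps(1,2,3,5) ab(1,2,4,5)[unfolded a_def b_def] sP1 cP1 sP2
          P2(2)
          l1[unfolded a_def, rule_format] l2[unfolded b_def, rule_format] H G0 k,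
              where ?'k = 'k, folded a_def b_def])
        (assumption, assumption, assumption, assumption, rule that)
    have c0: "0 \<le> c" using c n0 by simp
    have wn: "weighted_norm M p\<^sub>1 w1 f \<le> ennreal (2 powr a * c)"
      by (rule wf[rule_format, OF c0 fm le])
    then have "weighted_norm M p\<^sub>1 w1 f < \<infinity>" by (rule order.strict_trans1) simp
    from key[OF w eq this] have g: "D" "g \<in> borel_measurable M"
      "weighted_norm M p\<^sub>2 w2 g \<le> ennreal K * weighted_norm M p\<^sub>1 w1 f" by auto
    have "Lp_norm M (ennreal r\<^sub>2) (\<lambda>x. G0 x powr (1 / r\<^sub>2 - t\<^sub>2) *\<^sub>R g x) \<le> ennreal (2 powr b)
        * weighted_norm M p\<^sub>2 w2 g"
      unfolding \<delta> by (rule wh[rule_format, OF g(2)])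
    also have "\<dots> \<le> ennreal (2 powr b) * (ennreal K * ennreal (2 powr a * c))"
      by (intro mult_left_mono order_trans[OF g(3)] wn) auto
    also have "\<dots> = ennreal (2 powr (a + b) * K * c)"
      using K c0 by (simp add: ennreal_mult[symmetric] powr_add ac_simps)
    finally show ?thesis using g by blast
  qed
  obtain G0 where G0: "G0 \<in> P2" "AE x in M. 0 < G0 x" using weak_unit_exists[OF sP2 P2(2)] by blast
  have D: "D" and gm: "g \<in> borel_measurable M" using main[of "nrm X f + 1", OF _ G0] by auto
  define Q where "Q = 2 powr (a + b) * K"
  have Q: "0 \<le> Q" using K by (simp add: Q_def)
  \<comment> \<open>The summand \<open>\<eta>\<close> outside keeps the level positive also for \<open>Q = 0\<close>.\<close>
  have est: "g \<in> carr Y" "nrm Y g \<le> Q * (nrm X f + \<eta>) + \<eta>" if \<eta>: "0 < \<eta>" for \<eta>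
  proof -
    have c': "0 < Q * (nrm X f + \<eta>) + \<eta>" using Q n0 \<eta> by (intro add_nonneg_pos mult_nonneg_nonneg)
        auto
    have t: "Lp_norm M (ennreal r\<^sub>2) (\<lambda>x. G x powr (1 / r\<^sub>2 - t\<^sub>2) *\<^sub>R g x)
        \<le> ennreal (Q * (nrm X f + \<eta>) + \<eta>)"
      if G: "G \<in> pre_ball M r\<^sub>2 t\<^sub>2 Y" "AE x in M. 0 < G x" for G
    proof -
      have "Lp_norm M (ennreal r\<^sub>2) (\<lambda>x. G x powr (1 / r\<^sub>2 - t\<^sub>2) *\<^sub>R g x)
          \<le> ennreal (Q * (nrm X f + \<eta>))"
        using main[of "nrm X f + \<eta>" G] G \<eta> unfolding P2 Q_def by simp
      also have "\<dots> \<le> ennreal (Q * (nrm X f + \<eta>) + \<eta>)" using \<eta> by (intro ennreal_leI) simp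
      finally show ?thesis .
    qed
    show "g \<in> carr Y" "nrm Y g \<le> Q * (nrm X f + \<eta>) + \<eta>"
      by (rule carr_of_test_functions[OF Y(1) ps(5) rt2 Y(2) gm c' t], assumption+)+
  qed
  have "nrm Y g \<le> Q * nrm X f"
  proof (rule field_le_epsilon)
    fix e :: real assume e: "0 < e"
    have "nrm Y g \<le> Q * (nrm X f + e / (Q + 1)) + e / (Q + 1)" by (rule est(2)) (use e Q in simp)
    also have "\<dots> = Q * nrm X f + (Q + 1) * (e / (Q + 1))"
      unfolding distrib_left distrib_right by simp
    also have "\<dots> = Q * nrm X f + e" using Q by simp
    finally show "nrm Y g \<le> Q * nrm X f + e" .
  qed
  with D est(1)[of 1] show ?thesis by (simp add: Q_def)
qed

theorem theorem5p1:
  fixes M :: "'a measure" and \<E> :: "'a set set"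
    and \<alpha> r\<^sub>1 r\<^sub>2 t\<^sub>2 :: real  \<comment> \<open>\<open>t\<^sub>2\<close> stands for $1/s_2$\<close>
    and s\<^sub>1 p\<^sub>1 p\<^sub>2 :: ennreal
    and V :: "'v set"
    and S T :: "'v \<Rightarrow> 'a \<Rightarrow> 'k::{real_normed_field, euclidean_space}"
    and \<phi> :: "real \<Rightarrow> real"
  assumes "sigma_finite_measure M" and "basis_of_sets M \<E>"
    and "0 < r\<^sub>1" and "0 < r\<^sub>2" and "0 < s\<^sub>1"
    and "1 / r\<^sub>1 > recip s\<^sub>1" and "1 / r\<^sub>2 > t\<^sub>2"
    and "1 / r\<^sub>2 - 1 / r\<^sub>1 = \<alpha>" and "t\<^sub>2 - recip s\<^sub>1 = \<alpha>"
    and "0 < p\<^sub>1" and "0 < p\<^sub>2"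
    and "recip p\<^sub>1 \<in> {recip s\<^sub>1..1 / r\<^sub>1}" and "recip p\<^sub>2 \<in> {t\<^sub>2..1 / r\<^sub>2}"
    and "recip p\<^sub>2 - recip p\<^sub>1 = \<alpha>"
    and "\<forall>f\<in>V. S f \<in> borel_measurable M"
    and "increasing_fun \<phi>"
  defines "A \<equiv> A_class M \<E> p\<^sub>1 p\<^sub>2 r\<^sub>1 t\<^sub>2"
    and "N \<equiv> maximal_opnorm M \<E>"
  shows
    "((\<forall>f\<in>one_weight_dom M p\<^sub>1 A V S. T f \<in> borel_measurable M) \<and>
      (\<forall>w. (w, w) \<in> A \<longrightarrow> (\<forall>f\<in>V. S f \<in> weighted_Lp M p\<^sub>1 w \<longrightarrow>
         weighted_norm M p\<^sub>2 w (T f)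
           \<le> ennreal (\<phi> (enn2real (A_const M \<E> p\<^sub>1 p\<^sub>2 r\<^sub>1 t\<^sub>2 w w))) * weighted_norm M p\<^sub>1 w (S f)))
      \<longrightarrow>
      (\<forall>X Y :: ('a, 'k) fspace.
         quasi_BFS M X \<and> quasi_BFS M Y \<and>
         fs_convex r\<^sub>1 X \<and> fs_convex r\<^sub>2 Y \<and> fs_concave (recip s\<^sub>1) X \<and> fs_concave t\<^sub>2 Y \<and>
         fspace_eq (pre_XRS M r\<^sub>1 (recip s\<^sub>1) X) (pre_XRS M r\<^sub>2 t\<^sub>2 Y) \<and>
         (p\<^sub>1 \<noteq> ennreal r\<^sub>1 \<longrightarrow>
            maximal_bounded M \<E> (XRS M r\<^sub>1 (recip s\<^sub>1) X) (XRS M r\<^sub>1 (recip s\<^sub>1) X)) \<and>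
         (p\<^sub>1 \<noteq> s\<^sub>1 \<longrightarrow>
            maximal_bounded M \<E> (koethe_dual M (XRS M r\<^sub>1 (recip s\<^sub>1) X))
                                (koethe_dual M (XRS M r\<^sub>1 (recip s\<^sub>1) X)))
         \<longrightarrow>
         (\<forall>f\<in>V. S f \<in> carr X \<longrightarrow>
            f \<in> one_weight_dom M p\<^sub>1 A V S \<and> T f \<in> carr Y \<and>
            nrm Y (T f) \<le>
              2 powr (1 / r\<^sub>1 - recip s\<^sub>1) *
              \<phi> (2 powr (1 / r\<^sub>1 - recip s\<^sub>1) *
                 rpow (N (XRS M r\<^sub>1 (recip s\<^sub>1) X) (XRS M r\<^sub>1 (recip s\<^sub>1) X)) (1 / r\<^sub>1 - recip p\<^sub>1) *
                 rpow (N (koethe_dual M (XRS M r\<^sub>1 (recip s\<^sub>1) X))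
                         (koethe_dual M (XRS M r\<^sub>1 (recip s\<^sub>1) X))) (recip p\<^sub>2 - t\<^sub>2)) *
              nrm X (S f))))
     \<and>
     ((\<forall>f\<in>two_weight_dom M p\<^sub>1 A V S. T f \<in> borel_measurable M) \<and>
      (\<forall>(w\<^sub>1, w\<^sub>2)\<in>A. \<forall>f\<in>V. S f \<in> weighted_Lp M p\<^sub>1 w\<^sub>1 \<longrightarrow>
         weighted_norm M p\<^sub>2 w\<^sub>2 (T f)
           \<le> ennreal (\<phi> (enn2real (A_const M \<E> p\<^sub>1 p\<^sub>2 r\<^sub>1 t\<^sub>2 w\<^sub>1 w\<^sub>2))) * weighted_norm M p\<^sub>1 w\<^sub>1 (S f))
      \<longrightarrow>
      (\<forall>X Y :: ('a, 'k) fspace.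
         quasi_BFS M X \<and> quasi_BFS M Y \<and>
         fs_convex r\<^sub>1 X \<and> fs_convex r\<^sub>2 Y \<and> fs_concave (recip s\<^sub>1) X \<and> fs_concave t\<^sub>2 Y \<and>
         (p\<^sub>1 \<noteq> ennreal r\<^sub>1 \<longrightarrow>
            (\<exists>L\<^sub>1. pos_isometric_iso M (XRS M r\<^sub>1 (recip s\<^sub>1) X) (XRS M r\<^sub>2 t\<^sub>2 Y) L\<^sub>1) \<and>
            maximal_bounded M \<E> (XRS M r\<^sub>1 (recip s\<^sub>1) X) (XRS M r\<^sub>2 t\<^sub>2 Y)) \<and>
         (recip p\<^sub>2 \<noteq> t\<^sub>2 \<longrightarrow>
            (\<exists>L\<^sub>2. pos_isometric_iso M (koethe_dual M (XRS M r\<^sub>2 t\<^sub>2 Y))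
                                     (koethe_dual M (XRS M r\<^sub>1 (recip s\<^sub>1) X)) L\<^sub>2) \<and>
            maximal_bounded M \<E> (koethe_dual M (XRS M r\<^sub>2 t\<^sub>2 Y))
                                (koethe_dual M (XRS M r\<^sub>1 (recip s\<^sub>1) X)))
         \<longrightarrow>
         (\<forall>f\<in>V. S f \<in> carr X \<longrightarrow>
            f \<in> two_weight_dom M p\<^sub>1 A V S \<and> T f \<in> carr Y \<and>
            nrm Y (T f) \<le>
              2 powr (1 / r\<^sub>1 - recip s\<^sub>1) *
              \<phi> (2 powr (1 / r\<^sub>1 - recip s\<^sub>1) *
                 rpow (N (XRS M r\<^sub>1 (recip s\<^sub>1) X) (XRS M r\<^sub>2 t\<^sub>2 Y)) (1 / r\<^sub>1 - recip p\<^sub>1) *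
                 rpow (N (koethe_dual M (XRS M r\<^sub>2 t\<^sub>2 Y))
                         (koethe_dual M (XRS M r\<^sub>1 (recip s\<^sub>1) X))) (recip p\<^sub>2 - t\<^sub>2)) *
              nrm X (S f))))"
proof -
  interpret sigma_finite_measure M by fact
  define a where "a = 1 / r\<^sub>1 - recip p\<^sub>1"
  define b where "b = recip p\<^sub>2 - t\<^sub>2"
  have ab: "0 \<le> a" "0 \<le> b" "0 < a + b" "recip p\<^sub>1 = recip s\<^sub>1 + b" "1 / r\<^sub>2 = recip p\<^sub>2 + a"
    and \<delta>: "1 / r\<^sub>1 - recip s\<^sub>1 = a + b"
    using assms(6-9,12-14) by (auto simp: a_def b_def)
  have rt: "r\<^sub>1 * recip s\<^sub>1 < 1" "r\<^sub>2 * t\<^sub>2 < 1"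
    using assms(3,4,6,7) by (simp_all add: pos_less_divide_eq mult.commute)
  \<comment> \<open>For \<open>a > 0\<close>, respectively \<open>b > 0\<close>, the assumptions on the maximal operators are in force.\<close>
  have p1r1: "p\<^sub>1 \<noteq> ennreal r\<^sub>1" if "0 < a"
    using that recip_ennreal[OF assms(3)] by (auto simp: a_def)
  have p1s1: "p\<^sub>1 \<noteq> s\<^sub>1" if "0 < b" using that ab(4) by auto
  have p2t2: "recip p\<^sub>2 \<noteq> t\<^sub>2" if "0 < b" using that by (auto simp: b_def)
  have nn: "polar M B \<subseteq> nnfun M" for B by (auto simp: polar_def)
  have \<phi>: "0 \<le> \<phi> x" "x \<le> y \<Longrightarrow> \<phi> x \<le> \<phi> y" if "0 \<le> x" for x y
    using assms(16) that unfolding increasing_fun_def by (auto intro: mono_onD)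
  have rp: "0 \<le> rpow x e" for x e by (simp add: rpow_def)
  have acls: "(w1, w2) \<in> A" "\<phi> (enn2real (A_const M \<E> p\<^sub>1 p\<^sub>2 r\<^sub>1 t\<^sub>2 w1 w2)) \<le> \<phi> Cst"
    if "weight M w1" "weight M w2" "A_const M \<E> p\<^sub>1 p\<^sub>2 r\<^sub>1 t\<^sub>2 w1 w2 \<le> ennreal Cst" "0 \<le> Cst"
      for w1 w2 Cst
  proof -
    have "A_const M \<E> p\<^sub>1 p\<^sub>2 r\<^sub>1 t\<^sub>2 w1 w2 < \<infinity>" using that(3) by (rule order.strict_trans1) simp
    then show "(w1, w2) \<in> A" using that by (simp add: A_def A_class_def)
    show "\<phi> (enn2real (A_const M \<E> p\<^sub>1 p\<^sub>2 r\<^sub>1 t\<^sub>2 w1 w2)) \<le> \<phi> Cst"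
      using enn2real_leI[OF that(4,3)] by (intro \<phi>) auto
  qed
  show ?thesis
  proof (intro conjI impI allI ballI; (elim conjE)?)
    fix X Y :: "('a, 'k) fspace" and f
    assume T: "\<forall>f\<in>one_weight_dom M p\<^sub>1 A V S. T f \<in> borel_measurable M"
      "\<forall>w. (w, w) \<in> A \<longrightarrow> (\<forall>f\<in>V. S f \<in> weighted_Lp M p\<^sub>1 w \<longrightarrow>
         weighted_norm M p\<^sub>2 w (T f)
           \<le> ennreal (\<phi> (enn2real (A_const M \<E> p\<^sub>1 p\<^sub>2 r\<^sub>1 t\<^sub>2 w w))) * weighted_norm M p\<^sub>1 w (S f))"
    assume X: "quasi_BFS M X" and Y: "quasi_BFS M Y" and XY: "fs_convex r\<^sub>1 X" "fs_convex r\<^sub>2 Y"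
      "fs_concave (recip s\<^sub>1) X" "fs_concave t\<^sub>2 Y"
      and eq: "fspace_eq (pre_XRS M r\<^sub>1 (recip s\<^sub>1) X) (pre_XRS M r\<^sub>2 t\<^sub>2 Y)"
      and m1: "p\<^sub>1 \<noteq> ennreal r\<^sub>1 \<longrightarrow>
            maximal_bounded M \<E> (XRS M r\<^sub>1 (recip s\<^sub>1) X) (XRS M r\<^sub>1 (recip s\<^sub>1) X)"
      and m2: "p\<^sub>1 \<noteq> s\<^sub>1 \<longrightarrow>
            maximal_bounded M \<E> (koethe_dual M (XRS M r\<^sub>1 (recip s\<^sub>1) X))
                                (koethe_dual M (XRS M r\<^sub>1 (recip s\<^sub>1) X))"
      and f: "f \<in> V" "S f \<in> carr X"
    let ?P = "pre_ball M r\<^sub>1 (recip s\<^sub>1) X"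
    note RX = represents_XRS[OF X assms(3) rt(1) XY(1,3)]
        and RY = represents_XRS[OF Y assms(4) rt(2) XY(2,4)]
    have cP: "convex_ball ?P" by (rule pre_ball_convex[OF assms(1) X assms(3) rt(1) XY(1,3)])
    \<comment> \<open>Equality of the two spaces means that \<open>X\<close> and \<open>Y\<close> lead to the same ball.\<close>
    have PY: "?P = pre_ball M r\<^sub>2 t\<^sub>2 Y"
      by (rule represents_unique[OF RX(1) _ RY(1) _ eq]) (auto simp: power_ball_def)
    let ?Z = "XRS M r\<^sub>1 (recip s\<^sub>1) X"
    let ?C = "2 powr (a + b) * rpow (N ?Z ?Z) a * rpow (N (koethe_dual M ?Z) (koethe_dual M ?Z)) b"
    have C: "0 \<le> ?C" using rp by simp
    have "f \<in> one_weight_dom M p\<^sub>1 A V S \<and> T f \<in> carr Y \<and> nrm Y (T f) \<le> 2 powr (a + b) * \<phi> ?C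
        * nrm X (S f)"
    proof (rule extrapolation_core[OF assms(2,10,11,5,3,4) ab[unfolded a_def b_def] X XY(1,3) Y
        XY(2) refl PY cP, folded a_def b_def])
      show "0 < a \<longrightarrow> dominating_map M (polar M ?P) (polar M ?P) (\<lambda>u. u)"
        "0 < b \<longrightarrow> dominating_map M (polar M (polar M ?P)) (polar M (polar M ?P)) (\<lambda>u. u)"
        by (simp_all add: dominating_map_id)
      show "0 < a \<longrightarrow> maximal_maps M \<E> (polar M ?P) (polar M ?P) (N ?Z ?Z)"
        unfolding N_def using m1 p1r1 by (auto intro!: maximal_maps_opnorm[OF RX(2) nn RX(2)])
      show "0 < b \<longrightarrow>
          maximal_maps M \<E> (polar M (polar M ?P)) (polar M (polar M ?P)) (N (koethe_dual M ?Z)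
          (koethe_dual M ?Z))"
        unfolding N_def using m2 p1s1 by (auto intro!: maximal_maps_opnorm[OF RX(3) nn RX(3)])
      show "0 \<le> \<phi> ?C" by (rule \<phi>(1)[OF C])
      fix w1 w2
      assume w: "weight M w1" "weight M w2" "A_const M \<E> p\<^sub>1 p\<^sub>2 r\<^sub>1 t\<^sub>2 w1 w2 \<le> ennreal ?C"
        and "(\<lambda>u :: 'a \<Rightarrow> real. u) = (\<lambda>u. u) \<longrightarrow> (\<lambda>u :: 'a \<Rightarrow> real. u) = (\<lambda>u. u) \<longrightarrow> w1 = w2"
        and fin: "weighted_norm M p\<^sub>1 w1 (S f) < \<infinity>"
      then have [simp]: "w2 = w1" by simp
      have wA: "(w1, w1) \<in> A" using acls(1)[OF w C] by simp
      have Sf: "S f \<in> weighted_Lp M p\<^sub>1 w1" using fin assms(15) f by (simp add: weighted_Lp_def)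
      have D: "f \<in> one_weight_dom M p\<^sub>1 A V S" using wA Sf f by (auto simp: one_weight_dom_def)
      have "weighted_norm M p\<^sub>2 w1 (T f)
          \<le> ennreal (\<phi> (enn2real (A_const M \<E> p\<^sub>1 p\<^sub>2 r\<^sub>1 t\<^sub>2 w1 w1))) * weighted_norm M p\<^sub>1 w1 (S f)"
        using T(2) wA f(1) Sf by blast
      also have "\<dots> \<le> ennreal (\<phi> ?C) * weighted_norm M p\<^sub>1 w1 (S f)"
        using acls(2)[OF w C] by (intro mult_right_mono ennreal_leI) auto
      finally show "f \<in> one_weight_dom M p\<^sub>1 A V S \<and> T f \<in> borel_measurable M \<and>
          weighted_norm M p\<^sub>2 w2 (T f) \<le> ennreal (\<phi> ?C) * weighted_norm M p\<^sub>1 w1 (S f)"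
        using D T(1) by simp
    qed (rule f(2))
    then show "f \<in> one_weight_dom M p\<^sub>1 A V S" "T f \<in> carr Y"
      "nrm Y (T f) \<le>
              2 powr (1 / r\<^sub>1 - recip s\<^sub>1) *
              \<phi> (2 powr (1 / r\<^sub>1 - recip s\<^sub>1) *
                 rpow (N (XRS M r\<^sub>1 (recip s\<^sub>1) X) (XRS M r\<^sub>1 (recip s\<^sub>1) X)) (1 / r\<^sub>1 - recip p\<^sub>1) *
                 rpow (N (koethe_dual M (XRS M r\<^sub>1 (recip s\<^sub>1) X))
                         (koethe_dual M (XRS M r\<^sub>1 (recip s\<^sub>1) X))) (recip p\<^sub>2 - t\<^sub>2)) *
              nrm X (S f)"
      unfolding \<delta> a_def[symmetric] b_def[symmetric] by blast+
  next
    fix X Y :: "('a, 'k) fspace" and f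
    assume T: "\<forall>f\<in>two_weight_dom M p\<^sub>1 A V S. T f \<in> borel_measurable M"
      "\<forall>(w\<^sub>1, w\<^sub>2)\<in>A. \<forall>f\<in>V. S f \<in> weighted_Lp M p\<^sub>1 w\<^sub>1 \<longrightarrow>
         weighted_norm M p\<^sub>2 w\<^sub>2 (T f)
           \<le> ennreal (\<phi> (enn2real (A_const M \<E> p\<^sub>1 p\<^sub>2 r\<^sub>1 t\<^sub>2 w\<^sub>1 w\<^sub>2))) * weighted_norm M p\<^sub>1 w\<^sub>1
               (S f)"
    assume X: "quasi_BFS M X" and Y: "quasi_BFS M Y" and XY: "fs_convex r\<^sub>1 X" "fs_convex r\<^sub>2 Y"
      "fs_concave (recip s\<^sub>1) X" "fs_concave t\<^sub>2 Y"
      and m1: "p\<^sub>1 \<noteq> ennreal r\<^sub>1 \<longrightarrow>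
            (\<exists>L\<^sub>1. pos_isometric_iso M (XRS M r\<^sub>1 (recip s\<^sub>1) X) (XRS M r\<^sub>2 t\<^sub>2 Y) L\<^sub>1) \<and>
            maximal_bounded M \<E> (XRS M r\<^sub>1 (recip s\<^sub>1) X) (XRS M r\<^sub>2 t\<^sub>2 Y)"
      and m2: "recip p\<^sub>2 \<noteq> t\<^sub>2 \<longrightarrow>
            (\<exists>L\<^sub>2. pos_isometric_iso M (koethe_dual M (XRS M r\<^sub>2 t\<^sub>2 Y))
                                     (koethe_dual M (XRS M r\<^sub>1 (recip s\<^sub>1) X)) L\<^sub>2) \<and>
            maximal_bounded M \<E> (koethe_dual M (XRS M r\<^sub>2 t\<^sub>2 Y))
                                (koethe_dual M (XRS M r\<^sub>1 (recip s\<^sub>1) X))"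
      and f: "f \<in> V" "S f \<in> carr X"
    let ?P1 = "pre_ball M r\<^sub>1 (recip s\<^sub>1) X" and ?P2 = "pre_ball M r\<^sub>2 t\<^sub>2 Y"
    note RX = represents_XRS[OF X assms(3) rt(1) XY(1,3)]
        and RY = represents_XRS[OF Y assms(4) rt(2) XY(2,4)]
    note BX = pre_ball_polars[OF X assms(3) rt(1) XY(1,3)]
        and BY = pre_ball_polars[OF Y assms(4) rt(2) XY(2,4)]
    let ?Z1 = "XRS M r\<^sub>1 (recip s\<^sub>1) X" and ?Z2 = "XRS M r\<^sub>2 t\<^sub>2 Y"
    let ?C = "2 powr (a + b) * rpow (N ?Z1 ?Z2) a
        * rpow (N (koethe_dual M ?Z2) (koethe_dual M ?Z1)) b"
    have C: "0 \<le> ?C" using rp by simp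
    have "\<exists>l. 0 < a \<longrightarrow> dominating_map M (polar M ?P1) (polar M ?P2) l"
      using m1 p1r1 dominating_map_of_pos_iso[OF RX(2) BX(3,4) RY(2) BY(3)] by (cases "0 < a") auto
    then obtain l1 where l1: "0 < a \<longrightarrow> dominating_map M (polar M ?P1) (polar M ?P2) l1" by blast
    have "\<exists>l. 0 < b \<longrightarrow> dominating_map M (polar M (polar M ?P2)) (polar M (polar M ?P1)) l"
      using m2 p2t2 dominating_map_of_pos_iso[OF RY(3) BY(5,6) RX(3) BX(5)] by (cases "0 < b") auto
    then obtain l2 where l2: "0 < b
        \<longrightarrow> dominating_map M (polar M (polar M ?P2)) (polar M (polar M ?P1)) l2" by blast
    have "f \<in> two_weight_dom M p\<^sub>1 A V S \<and> T f \<in> carr Y \<and> nrm Y (T f) \<le> 2 powr (a + b) * \<phi> ?C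
        * nrm X (S f)"
    proof (rule extrapolation_core[OF assms(2,10,11,5,3,4) ab[unfolded a_def b_def] X XY(1,3) Y
        XY(2) refl refl BY(2), folded a_def b_def])
      show "0 < a \<longrightarrow> dominating_map M (polar M ?P1) (polar M ?P2) l1"
        "0 < b \<longrightarrow> dominating_map M (polar M (polar M ?P2)) (polar M (polar M ?P1)) l2"
        by (fact l1, fact l2)
      show "0 < a \<longrightarrow> maximal_maps M \<E> (polar M ?P1) (polar M ?P2) (N ?Z1 ?Z2)"
        unfolding N_def using m1 p1r1 by (auto intro!: maximal_maps_opnorm[OF RX(2) nn RY(2)])
      show "0 < b \<longrightarrow> maximal_maps M \<E> (polar M (polar M ?P2)) (polar M (polar M ?P1))
          (N (koethe_dual M ?Z2) (koethe_dual M ?Z1))"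
        unfolding N_def using m2 p2t2 by (auto intro!: maximal_maps_opnorm[OF RY(3) nn RX(3)])
      show "0 \<le> \<phi> ?C" by (rule \<phi>(1)[OF C])
      fix w1 w2
      assume w: "weight M w1" "weight M w2" "A_const M \<E> p\<^sub>1 p\<^sub>2 r\<^sub>1 t\<^sub>2 w1 w2 \<le> ennreal ?C"
        and fin: "weighted_norm M p\<^sub>1 w1 (S f) < \<infinity>"
      have wA: "(w1, w2) \<in> A" using acls(1)[OF w C] .
      have Sf: "S f \<in> weighted_Lp M p\<^sub>1 w1" using fin assms(15) f by (simp add: weighted_Lp_def)
      have D: "f \<in> two_weight_dom M p\<^sub>1 A V S" using wA Sf f by (auto simp: two_weight_dom_def)
      have "weighted_norm M p\<^sub>2 w2 (T f)
          \<le> ennreal (\<phi> (enn2real (A_const M \<E> p\<^sub>1 p\<^sub>2 r\<^sub>1 t\<^sub>2 w1 w2))) * weighted_norm M p\<^sub>1 w1 (S f)"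
        using T(2) wA f(1) Sf by blast
      also have "\<dots> \<le> ennreal (\<phi> ?C) * weighted_norm M p\<^sub>1 w1 (S f)"
        using acls(2)[OF w C] by (intro mult_right_mono ennreal_leI) auto
      finally show "f \<in> two_weight_dom M p\<^sub>1 A V S \<and> T f \<in> borel_measurable M \<and>
          weighted_norm M p\<^sub>2 w2 (T f) \<le> ennreal (\<phi> ?C) * weighted_norm M p\<^sub>1 w1 (S f)"
        using D T(1) by simp
    qed (rule f(2))
    then show "f \<in> two_weight_dom M p\<^sub>1 A V S" "T f \<in> carr Y"
      "nrm Y (T f) \<le>
              2 powr (1 / r\<^sub>1 - recip s\<^sub>1) *
              \<phi> (2 powr (1 / r\<^sub>1 - recip s\<^sub>1) *
                 rpow (N (XRS M r\<^sub>1 (recip s\<^sub>1) X) (XRS M r\<^sub>2 t\<^sub>2 Y)) (1 / r\<^sub>1 - recip p\<^sub>1) *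
                 rpow (N (koethe_dual M (XRS M r\<^sub>2 t\<^sub>2 Y))
                         (koethe_dual M (XRS M r\<^sub>1 (recip s\<^sub>1) X))) (recip p\<^sub>2 - t\<^sub>2)) *
              nrm X (S f)"
      unfolding \<delta> a_def[symmetric] b_def[symmetric] by blast+
  qed
qed

end
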